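(* Let $n\ge2$, and let $h$, $F$, $F_k$, $t_k(x)$ be as constructed in the context. Then there is a constant $c>0$ such that for every $x\in F$ and every strictly increasing sequence $(k_j)_{j=1}^\infty$ of indices with $x\in F_{k_j}$ for all $j$, one has $$|S_{t_{k_j}(x)}h(x)|\ge c$$ for all sufficiently large $j$. Consequently, there is no localization almost everywhere of Schrödinger means for functions in $H_s(\mathbb{R}^n)$ if $s<\frac{n}{2(n+1)}$.
   Context: **General notation.** In any dimension $d$, $\widehat f(\xi)=\int_{\mathbb{R}^d}e^{-i\xi\cdot x}f(x)\,dx$ and $\check f(x)=(2\pi)^{-d}\int_{\mathbb{R}^d}e^{i\xi\cdot x}f(\xi)\,d\xi$. $H_s(\mathbb{R}^n)$ is the space of tempered distributions with $\|f\|_{H_s}=\left(\int(1+|\xi|^2)^s|\widehat f(\xi)|^2d\xi\right)^{1/2}<\infty$. For $f\in\mathcal{S}(\mathbb{R}^d)$ or $f\in L^2(\mathbb{R}^d)$, $S_tf(x)=\int_{\mathbb{R}^d}e^{i\xi\cdot x}e^{it|\xi|^2}\widehat f(\xi)\,d\xi$ (in the $L^2$ sense for general $f\in L^2$). For $f\in L^1(\mathbb{R}^d)$ and $t\ne0$, $S_tf=K_t\star f$, where $K_t(x)=c_\pm|t|^{-d/2}e^{-i|x|^2/(4t)}$ is the Fourier transform of $\xi\mapsto e^{it|\xi|^2}$ ($c_\pm$ a nonzero constant depending only on $d$ and the sign of $t$). One has *localization almost everywhere* for functions in $H_s$ if for every $f\in H_s$ one has $\lim_{t\to0}S_tf(x)=0$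 for almost every $x\in\mathbb{R}^n\setminus(\operatorname{supp}f)$. $m$ is Lebesgue measure, $B(x;r)$ a ball with center $x$ and radius $r$; points of $\mathbb{R}^n$ are written $x=(x_1,x')$ with $x'=(x_2,\dots,x_n)\in\mathbb{R}^{n-1}$. **Construction.** Take $0<v_1<1$ and $v_k=\varepsilon_kv_{k-1}^{\mu}$ for $k\ge2$, where $\varepsilon_k=2^{-k}$ and $\mu=\max(n,2+n/4)$. Choose $g\in\mathcal{S}(\mathbb{R})$ with $\operatorname{supp}\check g\subset(-1,1)$ and $\check g(x_1)=1$ for $|x_1|<1/2$, and for $0<v<1$ set $f_v(x_1)=e^{-ix_1/v^2}\check g(x_1/v)$, $x_1\in\mathbb{R}$. Let $\Phi\in\mathcal{S}(\mathbb{R}^{n-1})$ satisfy $\operatorname{supp}\widehat\Phi\subset B(0;1)$, $\Phi(0)=1$, and $\Phi(x')=\psi(x_2)\cdots\psi(x_n)$ for some $\psi\in\mathcal{S}(\mathbb{R})$. With $R=1/v^2$ and $D=R^{(n+2)/(2(n+1))}$ set $$G_v(x')=R^{-(n-1)/4}\,\Phi(x')\prod_{j=2}^n\Big(\sum_{l_j\in\mathbb{Z},\ R/(2D)<l_j<R/D}e^{iDl_jx_j}\Big),\qquad h_v(x)=f_v(x_1)G_v(x').$$ Put $R_k=1/v_k^2$. Let $E_k\subset B(0;1)\subset\mathbb{R}^n$ ($k=1,2,\dots$) be measurable sets with $mE_k\ge c_1>0$ such that for every $x\in E_k$ there is a real number $t_k(x)$, with $t_k(x)=\frac{x_1}{2R_k}+\tau$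 and $|\tau|<R_k^{-3/2}/10$, for which $$|S_{t_k(x)}G_{v_k}(x')|\ge c_0\quad\text{and}\quad|S_{t_k(x)}f_{v_k}(x_1)|\ge c_0,$$ where $c_0,c_1>0$ do not depend on $k$ and $x$ (such $E_k$ and $t_k(x)$ are provided by an estimate of Bourgain). Choose $0<\delta<1$ so small that $F_k=E_k\cap\{x:|x_1|>\delta/2\}$ satisfies $mF_k\ge c_1/2$ for all $k$. Set $F=\bigcap_{k=1}^\infty\bigcup_{j=k}^\infty F_j$, the set of points belonging to infinitely many $F_k$. Choose $K$ so large that $v_K<\delta/4$ and set $h=\sum_{k=K}^\infty h_{v_k}$ (the series converges in $L^1(\mathbb{R}^n)$). *)

theory Defs
  imports "HOL-Analysis.Analysis"
begin

text \<open>Throughout, \<open>'a\<close> is a Euclidean space. The space of points \<open>(x\<^sub>1, x')\<close>, with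
  \<open>x'\<close> in \<open>(n - 1)\<close>-dimensional space, is the type \<^typ>\<open>real \<times> (real ^ 'm)\<close> with the Euclidean norm
  of the product. Here \<open>n = CARD('m) + 1\<close>, and \<open>'m\<close> is an arbitrary nonempty finite type, so
  \<open>n\<close> is an arbitrary integer that is at least 2.\<close>

section \<open>Fourier transform and Schwartz functions\<close>

definition fourier :: "('a::euclidean_space \<Rightarrow> complex) \<Rightarrow> 'a \<Rightarrow> complex" where
  "fourier f \<xi> = (LINT x|lborel. cis (- (\<xi> \<bullet> x)) * f x)"

definition inv_fourier :: "('a::euclidean_space \<Rightarrow> complex) \<Rightarrow> 'a \<Rightarrow> complex" where
  "inv_fourier f x =
     complex_of_real ((2 * pi) powr (- real DIM('a))) * (LINT \<xi>|lborel. cis (\<xi> \<bullet> x) * f \<xi>)"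

primrec partials :: "'a list \<Rightarrow> ('a::euclidean_space \<Rightarrow> complex) \<Rightarrow> 'a \<Rightarrow> complex" where
  "partials [] f = f"
| "partials (b # bs) f = (\<lambda>x. frechet_derivative (partials bs f) (at x) b)"

text \<open>Iterated partial derivatives are indexed by lists of basis vectors instead of multi-indices.\<close>

definition schwartz :: "('a::euclidean_space \<Rightarrow> complex) \<Rightarrow> bool" where
  "schwartz f \<longleftrightarrow>
     (\<forall>bs. set bs \<subseteq> Basis \<longrightarrow>
        (\<forall>x. partials bs f differentiable (at x)) \<and>
        (\<forall>N::nat. \<exists>B. \<forall>x. (1 + norm x) ^ N * cmod (partials bs f x) \<le> B))"

section \<open>Tempered distributions and Sobolev spaces\<close>

text \<open>A distribution is a functional of which only the values at Schwartz functions matter.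
  The last clause is continuity: \<open>B\<close> ranges over the upper bounds of the seminorm of order \<open>N\<close>.\<close>

definition tempered_distribution :: "(('a::euclidean_space \<Rightarrow> complex) \<Rightarrow> complex) \<Rightarrow> bool" where
  "tempered_distribution T \<longleftrightarrow>
     (\<forall>\<phi> \<theta> a b. schwartz \<phi> \<longrightarrow> schwartz \<theta> \<longrightarrow> T (\<lambda>x. a * \<phi> x + b * \<theta> x) = a * T \<phi> + b * T \<theta>) \<and>
     (\<exists>(C::real) (N::nat). \<forall>\<phi> B. schwartz \<phi> \<longrightarrow>
        (\<forall>bs x. set bs \<subseteq> Basis \<longrightarrow> length bs \<le> N \<longrightarrow>
            (1 + norm x) ^ N * cmod (partials bs \<phi> x) \<le> B) \<longrightarrow>
        cmod (T \<phi>) \<le> C * B)"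

definition distribution_of :: "('a::euclidean_space \<Rightarrow> complex) \<Rightarrow> ('a \<Rightarrow> complex) \<Rightarrow> complex" where
  "distribution_of f \<phi> = (LINT x|lborel. f x * \<phi> x)"

text \<open>The Fourier transform of \<open>T\<close> is the distribution \<open>\<phi> \<mapsto> T (fourier \<phi>)\<close>; membership in \<open>H\<^sub>s\<close>
  means that it is a function \<open>g\<close> with finite weighted norm.\<close>

definition sobolev :: "real \<Rightarrow> (('a::euclidean_space \<Rightarrow> complex) \<Rightarrow> complex) set" where
  "sobolev s = {T. tempered_distribution T \<and>
     (\<exists>g \<in> borel_measurable lborel.
        (\<forall>\<phi>. schwartz \<phi> \<longrightarrow> T (fourier \<phi>) = distribution_of g \<phi>) \<and>
        integrable lborel (\<lambda>\<xi>. (1 + (norm \<xi>)\<^sup>2) powr s * (cmod (g \<xi>))\<^sup>2))}"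

section \<open>Schroedinger means\<close>

definition schrodinger :: "real \<Rightarrow> ('a::euclidean_space \<Rightarrow> complex) \<Rightarrow> 'a \<Rightarrow> complex" where
  "schrodinger t f x =
     (LINT \<xi>|lborel. cis (\<xi> \<bullet> x) * cis (t * (norm \<xi>)\<^sup>2) * fourier f \<xi>)"

text \<open>The Fourier transform of \<open>\<xi> \<mapsto> e\<^bsup>it|\<xi>|\<^sup>2\<^esup>\<close> for nonzero \<open>t\<close>, with the constant computed from
  the Fresnel integral: it is \<open>\<pi>\<^bsup>d/2\<^esup> e\<^bsup>i\<pi>d/4\<^esup>\<close> for positive \<open>t\<close>, and its conjugate for
  negative \<open>t\<close>.\<close>

definition schrodinger_kernel :: "real \<Rightarrow> 'a::euclidean_space \<Rightarrow> complex" where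
  "schrodinger_kernel t x =
     complex_of_real (pi powr (real DIM('a) / 2)) * cis (sgn t * pi * real DIM('a) / 4) *
     complex_of_real (\<bar>t\<bar> powr (- real DIM('a) / 2)) * cis (- ((norm x)\<^sup>2 / (4 * t)))"

text \<open>For integrable \<open>f\<close> and nonzero \<open>t\<close>, the mean is defined at every point by convolution.\<close>

definition schrodinger_L1 :: "real \<Rightarrow> ('a::euclidean_space \<Rightarrow> complex) \<Rightarrow> 'a \<Rightarrow> complex" where
  "schrodinger_L1 t f x = (LINT y|lborel. schrodinger_kernel t (x - y) * f y)"

definition square_integrable :: "('a::euclidean_space \<Rightarrow> complex) \<Rightarrow> bool" where
  "square_integrable f \<longleftrightarrow>
     f \<in> borel_measurable lborel \<and> integrable lborel (\<lambda>x. (cmod (f x))\<^sup>2)"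

definition L2_tendsto ::
    "(nat \<Rightarrow> 'a::euclidean_space \<Rightarrow> complex) \<Rightarrow> ('a \<Rightarrow> complex) \<Rightarrow> bool" where
  "L2_tendsto F f \<longleftrightarrow>
     (\<lambda>j. \<integral>\<^sup>+x. ennreal ((cmod (F j x - f x))\<^sup>2) \<partial>lborel) \<longlonglongrightarrow> 0"

text \<open>On square integrable functions the Schroedinger mean is the \<open>L\<^sup>2\<close>-continuous extension of
  its restriction to Schwartz functions. It is determined only up to null sets:
  \<open>schrodinger_L2 t f u\<close> says that \<open>u\<close> is a representative of the mean of \<open>f\<close> at time \<open>t\<close>.\<close>

definition schrodinger_L2 ::
    "real \<Rightarrow> ('a::euclidean_space \<Rightarrow> complex) \<Rightarrow> ('a \<Rightarrow> complex) \<Rightarrow> bool" where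
  "schrodinger_L2 t f u \<longleftrightarrow> square_integrable f \<and> square_integrable u \<and>
     (\<exists>\<phi>. (\<forall>j. schwartz (\<phi> j)) \<and> L2_tendsto \<phi> f \<and> L2_tendsto (\<lambda>j. schrodinger t (\<phi> j)) u)"

section \<open>Localization almost everywhere\<close>

text \<open>The support in the sense of distributions, which does not depend on the values of \<open>f\<close> on a
  null set.\<close>

definition ess_supp :: "('a::euclidean_space \<Rightarrow> complex) \<Rightarrow> 'a set" where
  "ess_supp f = - \<Union>{U. open U \<and> (AE x in lborel. x \<in> U \<longrightarrow> f x = 0)}"

text \<open>The functions considered are those in \<open>H\<^sub>s\<close> for which the means are defined, that is, the
  square integrable ones; for nonnegative \<open>s\<close> these are all elements of \<open>H\<^sub>s\<close>.
  The pointwise limit refers to a choice \<open>u\<close> of representatives, one for each time. Asking for it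
  for all choices would be unsatisfiable, since uncountably many null sets can cover everything.
  Asking for it for some choice is the weakest condition, hence its negation the strongest; if
  the means have a representative that is continuous in \<open>t\<close> for nonzero \<open>t\<close>, then the condition
  is equivalent to the one for that representative.\<close>

definition localization_ae :: "'a::euclidean_space itself \<Rightarrow> real \<Rightarrow> bool" where
  "localization_ae _ s \<longleftrightarrow>
     (\<forall>f :: 'a \<Rightarrow> complex. square_integrable f \<longrightarrow> distribution_of f \<in> sobolev s \<longrightarrow>
        (\<exists>u. (\<forall>t. schrodinger_L2 t f (u t)) \<and>
             (AE x in lborel. x \<notin> ess_supp f \<longrightarrow> ((\<lambda>t. u t x) \<longlongrightarrow> 0) (at 0))))"

section \<open>Building blocks of the counterexample\<close>

definition f_part :: "(real \<Rightarrow> complex) \<Rightarrow> real \<Rightarrow> real \<Rightarrow> complex" where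
  "f_part g v x1 = cis (- (x1 / v\<^sup>2)) * inv_fourier g (x1 / v)"

definition G_part :: "(real ^ 'm \<Rightarrow> complex) \<Rightarrow> real \<Rightarrow> real ^ 'm \<Rightarrow> complex" where
  "G_part \<Phi> v x' =
     (let n = real DIM(real \<times> (real ^ 'm)); R = 1 / v\<^sup>2; D = R powr ((n + 2) / (2 * (n + 1)))
      in complex_of_real (R powr (- (n - 1) / 4)) * \<Phi> x' *
         (\<Prod>j\<in>UNIV. \<Sum>l\<in>{l::int. R / (2 * D) < of_int l \<and> of_int l < R / D}.
            cis (D * of_int l * x' $ j)))"

definition h_part ::
    "(real \<Rightarrow> complex) \<Rightarrow> (real ^ 'm \<Rightarrow> complex) \<Rightarrow> real \<Rightarrow> real \<times> (real ^ 'm) \<Rightarrow> complex" where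
  "h_part g \<Phi> v x = f_part g v (fst x) * G_part \<Phi> v (snd x)"

text \<open>If \<open>v k\<close> tends to 0 and \<open>inv_fourier g\<close> vanishes off the interval \<open>(-1, 1)\<close>, then
  at every \<open>x\<close> with nonzero first coordinate only finitely many terms are nonzero, so the
  pointwise sum is defined almost everywhere and represents the sum of the series in \<open>L\<^sup>1\<close>.\<close>

definition h_sum ::
    "(real \<Rightarrow> complex) \<Rightarrow> (real ^ 'm \<Rightarrow> complex) \<Rightarrow> (nat \<Rightarrow> real) \<Rightarrow> nat \<Rightarrow>
     real \<times> (real ^ 'm) \<Rightarrow> complex" where
  "h_sum g \<Phi> v K x = (\<Sum>k. h_part g \<Phi> (v (K + k)) x)"

end

(* Both parts rest on one lower bound: at the point x and the time t_k(x) the mean of h is close to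
   that of its k-th block. The k-th mean factors as S_t f(x_1) S_t G(x') and is at least c0^2. The
   blocks j < k are supported away from x and the time is tiny compared with their frequency, so
   their means are almost equal to their values at time 0, which vanish. The blocks j > k have tiny
   L^1 norm, which beats the factor |t|^(-n/2) of the dispersive estimate. The frequencies of a block
   are of size v_k^(-2), and its H_s norm is at most a constant times v_k^(n/(n+1) - 2s), which is
   summable for s < n/(2(n+1)).

   For the failure of localization, an L^2 representative of the mean agrees with the convolution
   almost everywhere for each fixed time, hence for all rational times at once outside one null
   set; the convolution is continuous in time, so the limit at 0 passes from rational to all times
   and contradicts the lower bound on the limsup F of the F_k, which has positive measure. *)
theory Submission
  imports Defs "HOL-Probability.Characteristic_Functions" "HOL-Probability.Sinc_Integral"
begin

text \<open>The exponent \<mu> serves two purposes. At the k-th time, of size \<open>v_k^2\<close>,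
  the dispersive factor is of size \<open>v_k^(-n)\<close>, and a later block j has
  \<open>L^1\<close> norm at most a constant times \<open>2^(-j) v_k^\<mu>\<close>; so \<mu> >= n
  suffices. An earlier block j contributes at most a constant times
  \<open>|t| v_j^(-4-(n-1)/2)\<close>, while \<open>|t| <= 4^(-k) v_j^(2\<mu>)\<close>; so 2 \<mu>
  >= 4 + (n-1)/2 suffices, which 2 + n/4 provides. The Sobolev threshold comes from counting: each
  of the n - 1 exponential sums has at most \<open>R/D = v^(-n/(n+1))\<close> frequencies, and their
  translated bumps overlap boundedly on the frequency side. The obstacle in the second part is that
  the \<open>L^2\<close> mean is only a limit of means of Schwartz functions converging in
  \<open>L^2\<close>, whereas the convolution is stable under \<open>L^1\<close> convergence. The
  two are matched weakly, against test functions whose transposed means are square integrable. Boxes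
  multiplied by a quadratic phase have this property and still determine a function almost
  everywhere.\<close>

section \<open>Decaying functions and the Fourier transform\<close>

text \<open>The standard integrable majorant. Its product form lets integrals factor over
  coordinates, and each factor can be produced separately by a second derivative in its
  coordinate.\<close>

definition decay :: "'a::euclidean_space \<Rightarrow> real" where
  "decay x = (\<Prod>b\<in>Basis. 1 / (1 + (x \<bullet> b)\<^sup>2))"

lemma decay_real: "decay (x::real) = 1 / (1 + x\<^sup>2)"
  by (simp add: decay_def)

lemma decay_pos: "decay x > 0"
  unfolding decay_def by (intro prod_pos) (auto intro!: divide_pos_pos add_pos_nonneg)

lemma decay_nonneg [simp]: "decay x \<ge> 0"
  using decay_pos[of x] by simp

lemma decay_le_1: "decay x \<le> 1"
  unfolding decay_def by (intro prod_le_1) (auto simp: divide_le_eq_1 add_pos_nonneg)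

lemma decay_measurable [measurable]: "decay \<in> borel_measurable borel"
  unfolding decay_def by measurable

lemma borel_measurable_cis [measurable (raw)]:
  "f \<in> borel_measurable M \<Longrightarrow> (\<lambda>x. cis (f x)) \<in> borel_measurable M"
  unfolding cis_conv_exp by measurable

text \<open>\<open>lborel\<close> is the image of the finite product measure under the coordinate
  map, so this is Fubini for finitely many factors.\<close>

lemma
  fixes f :: "'a::euclidean_space \<Rightarrow> real \<Rightarrow> 'b::{real_normed_field,banach,second_countable_topology}"
  assumes "\<And>b. b \<in> Basis \<Longrightarrow> integrable lborel (f b)"
  shows integrable_prod_lborel: "integrable lborel (\<lambda>x::'a. \<Prod>b\<in>Basis. f b (x \<bullet> b))" (is ?A)
    and integral_prod_lborel:
      "(LINT x|lborel. (\<Prod>b\<in>Basis. f b (x \<bullet> b))) = (\<Prod>b\<in>Basis. LINT x|lborel. f b x)" (is ?B)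
proof -
  interpret product_sigma_finite "\<lambda>_::'a. lborel :: real measure" ..
  let ?T = "\<lambda>f::'a \<Rightarrow> real. \<Sum>b\<in>Basis. f b *\<^sub>R b"
  have T [measurable]: "?T \<in> measurable (Pi\<^sub>M Basis (\<lambda>_. lborel)) borel"
    by measurable
  have [measurable]: "f b \<in> borel_measurable borel" if "b \<in> Basis" for b
    using assms[OF that] by (simp add: integrable_iff_bounded)
  have m [measurable]: "(\<lambda>x::'a. \<Prod>b\<in>Basis. f b (x \<bullet> b)) \<in> borel_measurable borel"
    by measurable
  have T': "?T x \<bullet> b = x b" if "b \<in> Basis" for x b
    using that by simp
  have c: "(\<Prod>b\<in>Basis. f b (?T x \<bullet> b)) = (\<Prod>b\<in>Basis. f b (x b))" for x
    by (rule prod.cong) (simp_all only: T')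
  show ?A
    by (subst lborel_eq, subst integrable_distr_eq[OF T m])
      (simp only: c, intro product_integrable_prod finite_Basis assms)
  show ?B
    by (subst lborel_eq, subst integral_distr[OF T m])
      (simp only: c, intro product_integral_prod finite_Basis assms)
qed

lemma integrable_decay_real: "integrable lborel (\<lambda>x::real. 1 / (1 + x\<^sup>2))"
  using integrable_inverse_1_plus_square by (simp add: set_integrable_def divide_inverse)

lemma integrable_decay [simp]: "integrable lborel (decay :: 'a::euclidean_space \<Rightarrow> real)"
  unfolding decay_def by (intro integrable_prod_lborel integrable_decay_real)

lemma inverse_square_shift:
  fixes x s :: real
  assumes "\<bar>s\<bar> \<le> 1"
  shows "1 / (1 + (x + s)\<^sup>2) \<le> 3 * (1 / (1 + x\<^sup>2))"
proof -
  have "s\<^sup>2 \<le> 1" using assms by (simp add: abs_square_le_1)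
  \<comment> \<open>The square is chosen to expand to x^2 <= 2 (x + s)^2 + 2 s^2; together with s^2
    <= 1 this gives the factor 3.\<close>
  have "0 \<le> (x + 2 * s)\<^sup>2" by simp
  hence "x\<^sup>2 \<le> 2 * (x + s)\<^sup>2 + 2 * s\<^sup>2" by (simp add: power2_eq_square algebra_simps)
  moreover have "0 \<le> (x + s)\<^sup>2" by simp
  ultimately have "1 + x\<^sup>2 \<le> 3 * (1 + (x + s)\<^sup>2)" using \<open>s\<^sup>2 \<le> 1\<close>
    unfolding distrib_left by linarith
  thus ?thesis using zero_le_power2[of x] zero_le_power2[of "x+s"]
    by (simp add: field_simps add_pos_nonneg)
qed

text \<open>Differentiation under the integral needs a dominating function that serves all shifts of
  length at most 1 at once.\<close>

lemma decay_shift: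
  assumes "\<bar>s\<bar> \<le> 1" "b \<in> Basis"
  shows "decay (x + s *\<^sub>R b) \<le> 3 * decay x"
proof -
  have "decay (x + s *\<^sub>R b) = (1 / (1 + (x \<bullet> b + s)\<^sup>2)) * (\<Prod>c\<in>Basis - {b}. 1 / (1 + (x \<bullet> c)\<^sup>2))"
    unfolding decay_def using assms(2)
    by (subst prod.remove[of _ b]) (auto simp: inner_left_distrib inner_Basis intro!: prod.cong split: if_splits)
  also have "\<dots> \<le> (3 * (1 / (1 + (x \<bullet> b)\<^sup>2))) * (\<Prod>c\<in>Basis - {b}. 1 / (1 + (x \<bullet> c)\<^sup>2))"
    by (intro mult_right_mono inverse_square_shift assms prod_nonneg) auto
  also have "\<dots> = 3 * decay x"
    unfolding decay_def using assms(2) by (subst (2) prod.remove[of _ b]) auto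
  finally show ?thesis .
qed

section \<open>Differentiation under the integral sign\<close>

lemma norm_diff_quotient_le:
  fixes f f' :: "real \<Rightarrow> 'b::real_normed_vector"
  assumes "\<And>s. \<bar>s - s0\<bar> \<le> 1 \<Longrightarrow> (f has_vector_derivative f' s) (at s)"
    and "\<And>s. \<bar>s - s0\<bar> \<le> 1 \<Longrightarrow> norm (f' s) \<le> B"
    and "\<bar>h\<bar> \<le> 1"
  shows "norm (f (s0 + h) - f s0) \<le> B * \<bar>h\<bar>"
proof -
  have "norm (f (s0 + h) - f s0) \<le> B * norm (s0 + h - s0)"
  proof (rule differentiable_bound[where S = "{s0 - 1..s0 + 1}" and f' = "\<lambda>s x. x *\<^sub>R f' s"])
    fix s assume s: "s \<in> {s0 - 1..s0 + 1}"
    hence "\<bar>s - s0\<bar> \<le> 1" by auto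
    thus "(f has_derivative (\<lambda>x. x *\<^sub>R f' s)) (at s within {s0 - 1..s0 + 1})"
      using assms(1)[of s] by (auto simp: has_vector_derivative_def intro: has_derivative_at_withinI)
    show "onorm (\<lambda>x. x *\<^sub>R f' s) \<le> B"
      using assms(2)[OF \<open>\<bar>s - s0\<bar> \<le> 1\<close>]
      by (intro onorm_le) (simp add: mult.commute[of B] mult_left_mono)
  qed (use assms(3) in auto)
  thus ?thesis by simp
qed

lemma has_vector_derivative_iff_quotient:
  "(f has_vector_derivative D) (at x) \<longleftrightarrow> ((\<lambda>h. (f (x + h) - f x) /\<^sub>R h) \<longlongrightarrow> D) (at 0)"
proof -
  have "norm (f (x + h) - f x - h *\<^sub>R D) / norm h = norm ((f (x + h) - f x) /\<^sub>R h - D)" if "h \<noteq> 0" for h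
  proof -
    have "(f (x + h) - f x) /\<^sub>R h - D = (f (x + h) - f x - h *\<^sub>R D) /\<^sub>R h"
      using that by (simp add: scaleR_diff_right)
    thus ?thesis by (simp add: divide_inverse mult.commute)
  qed
  hence "((\<lambda>h. norm (f (x + h) - f x - h *\<^sub>R D) / norm h) \<longlongrightarrow> 0) (at 0) \<longleftrightarrow>
      ((\<lambda>h. norm ((f (x + h) - f x) /\<^sub>R h - D)) \<longlongrightarrow> 0) (at 0)"
    by (intro filterlim_cong refl) (auto simp: eventually_at intro!: exI[of _ 1])
  thus ?thesis
    by (simp add: has_vector_derivative_def has_derivative_at bounded_linear_scaleR_left
        tendsto_norm_zero_iff LIM_zero_iff)
qed

text \<open>The mean value inequality dominates all difference quotients by \<open>w\<close>, so
  dominated convergence applies along every sequence of steps tending to 0.\<close>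

lemma has_vector_derivative_lebesgue_integral:
  fixes f f' :: "real \<Rightarrow> 'a \<Rightarrow> 'b::{banach,second_countable_topology}"
  assumes int: "\<And>s. \<bar>s - s0\<bar> \<le> 1 \<Longrightarrow> integrable M (f s)"
    and deriv: "\<And>s x. \<bar>s - s0\<bar> \<le> 1 \<Longrightarrow> x \<in> space M \<Longrightarrow>
      ((\<lambda>s. f s x) has_vector_derivative f' s x) (at s)"
    and bound: "\<And>s x. \<bar>s - s0\<bar> \<le> 1 \<Longrightarrow> x \<in> space M \<Longrightarrow> norm (f' s x) \<le> w x"
    and w: "integrable M w"
  shows "((\<lambda>s. LINT x|M. f s x) has_vector_derivative (LINT x|M. f' s0 x)) (at s0)"
    and "integrable M (f' s0)"
proof -
  define q where "q = (\<lambda>h x. (f (s0 + h) x - f s0 x) /\<^sub>R h)"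
  have q_lim: "((\<lambda>h. q h x) \<longlongrightarrow> f' s0 x) (at 0)" if "x \<in> space M" for x
    using deriv[of s0 x] that by (simp add: has_vector_derivative_iff_quotient q_def)
  have q_bound: "norm (q h x) \<le> w x" if "x \<in> space M" "\<bar>h\<bar> \<le> 1" "h \<noteq> 0" for x h
  proof -
    have "norm (f (s0 + h) x - f s0 x) \<le> w x * \<bar>h\<bar>"
      by (rule norm_diff_quotient_le[where f' = "\<lambda>s. f' s x"]) (use deriv bound that in auto)
    moreover have "norm (q h x) = norm (f (s0 + h) x - f s0 x) / \<bar>h\<bar>"
      unfolding q_def by (simp add: divide_inverse mult.commute)
    ultimately show ?thesis using that by (simp add: divide_le_eq)
  qed
  \<comment> \<open>Such a sequence also exhibits \<open>f' s0\<close> as a pointwise limit of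
    measurable quotients, which yields its measurability.\<close>
  have dct: "(\<lambda>n. LINT x|M. q (X n) x) \<longlonglongrightarrow> (LINT x|M. f' s0 x)" "integrable M (f' s0)"
    if X: "\<And>n. \<bar>X n\<bar> \<le> 1" "\<And>n. X n \<noteq> 0" "X \<longlonglongrightarrow> 0" for X
  proof -
    have Xa: "filterlim X (at 0) sequentially"
      using X by (auto simp: filterlim_at)
    have m: "q (X n) \<in> borel_measurable M" for n
      using int[of "s0 + X n"] int[of s0] X(1)[of n] unfolding q_def by auto
    have lim: "(\<lambda>n. q (X n) x) \<longlonglongrightarrow> f' s0 x" if "x \<in> space M" for x
      using filterlim_compose[OF q_lim[OF that] Xa] .
    have m': "f' s0 \<in> borel_measurable M"
      by (rule borel_measurable_LIMSEQ_metric[OF m lim])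
    show "(\<lambda>n. LINT x|M. q (X n) x) \<longlonglongrightarrow> (LINT x|M. f' s0 x)"
      using m m' w lim q_bound X by (intro integral_dominated_convergence[where w = w]) auto
    show "integrable M (f' s0)"
    proof (intro Bochner_Integration.integrable_bound[OF w m'] AE_I2)
      fix x assume "x \<in> space M"
      hence "norm (f' s0 x) \<le> w x" using bound[of s0 x] by simp
      also have "\<dots> \<le> norm (w x)" by simp
      finally show "norm (f' s0 x) \<le> norm (w x)" .
    qed
  qed
  have "(\<lambda>n. inverse (1 + real n)) \<longlonglongrightarrow> 0"
    using LIMSEQ_inverse_real_of_nat by simp
  thus "integrable M (f' s0)"
    by (intro dct(2)[of "\<lambda>n. inverse (1 + real n)"]) (auto simp: field_simps)
  have "((\<lambda>h. LINT x|M. q h x) \<longlongrightarrow> (LINT x|M. f' s0 x)) (at 0)"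
    unfolding tendsto_at_iff_sequentially
  proof (intro allI impI)
    fix X :: "nat \<Rightarrow> real"
    assume X: "\<forall>i. X i \<in> UNIV - {0}" "X \<longlonglongrightarrow> 0"
    \<comment> \<open>Dropping an initial segment brings the steps into the range where the
      quotients are dominated.\<close>
    obtain N where N: "\<And>n. n \<ge> N \<Longrightarrow> norm (X n - 0) < 1"
      using LIMSEQ_D[OF X(2), of 1] by auto
    have "\<bar>X (n + N)\<bar> \<le> 1" for n using N[of "n + N"] by simp
    hence "(\<lambda>n. LINT x|M. q (X (n + N)) x) \<longlonglongrightarrow> (LINT x|M. f' s0 x)"
      using X(1) by (intro dct LIMSEQ_ignore_initial_segment X(2)) auto
    thus "((\<lambda>h. LINT x|M. q h x) \<circ> X) \<longlonglongrightarrow> (LINT x|M. f' s0 x)"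
      unfolding o_def by (rule LIMSEQ_offset)
  qed
  moreover have "\<forall>\<^sub>F h in at 0. (LINT x|M. q h x) = ((LINT x|M. f (s0 + h) x) - (LINT x|M. f s0 x)) /\<^sub>R h"
    unfolding eventually_at
  proof (intro exI[of _ 1] conjI ballI impI)
    fix h :: real assume "h \<noteq> 0 \<and> dist h 0 < 1"
    hence "integrable M (f (s0 + h))" "integrable M (f s0)" using int[of "s0 + h"] int[of s0] by auto
    thus "(LINT x|M. q h x) = ((LINT x|M. f (s0 + h) x) - (LINT x|M. f s0 x)) /\<^sub>R h"
      unfolding q_def by simp
  qed simp
  ultimately show "((\<lambda>s. LINT x|M. f s x) has_vector_derivative (LINT x|M. f' s0 x)) (at s0)"
    unfolding has_vector_derivative_iff_quotient by (rule Lim_transform_eventually)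
qed

lemma integrable_le_decay:
  fixes f :: "'a::euclidean_space \<Rightarrow> 'b::{banach,second_countable_topology}"
  assumes "f \<in> borel_measurable borel" "\<And>x. norm (f x) \<le> B * decay x"
  shows "integrable lborel f"
proof (rule Bochner_Integration.integrable_bound[of lborel "\<lambda>x. B * decay x"])
  show "AE x in lborel. norm (f x) \<le> norm (B * decay x)"
    using assms(2) by (intro AE_I2) (metis abs_ge_self order_trans real_norm_def)
qed (use assms(1) in auto)

lemma integral_shift_lborel:
  fixes f :: "'a::euclidean_space \<Rightarrow> 'b::{banach,second_countable_topology}"
  assumes [measurable]: "f \<in> borel_measurable borel"
  shows "(LINT x|lborel. f (a + x)) = (LINT x|lborel. f x)"
    and "integrable lborel (\<lambda>x. f (a + x)) \<longleftrightarrow> integrable lborel f"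
proof -
  show "(LINT x|lborel. f (a + x)) = (LINT x|lborel. f x)"
    by (subst (2) lborel_distr_plus[of a, symmetric], subst integral_distr) auto
  show "integrable lborel (\<lambda>x. f (a + x)) \<longleftrightarrow> integrable lborel f"
    by (subst (2) lborel_distr_plus[of a, symmetric], subst integrable_distr_eq) auto
qed

section \<open>Translation, differentiation and decay under the Fourier transform\<close>

lemma fourier_shift:
  fixes f :: "'a::euclidean_space \<Rightarrow> complex"
  assumes [measurable]: "f \<in> borel_measurable borel"
  shows "fourier (\<lambda>x. f (x + a)) \<xi> = cis (\<xi> \<bullet> a) * fourier f \<xi>"
proof -
  have "cis (\<xi> \<bullet> a) * fourier f \<xi> = (LINT x|lborel. cis (\<xi> \<bullet> a) * (cis (- (\<xi> \<bullet> (a + x))) * f (a + x)))"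
    unfolding fourier_def
    by (subst integral_shift_lborel(1)[of "\<lambda>x. cis (- (\<xi> \<bullet> x)) * f x" a, symmetric]) auto
  also have "\<dots> = (LINT x|lborel. cis (- (\<xi> \<bullet> x)) * f (x + a))"
    by (simp add: mult.assoc[symmetric] cis_mult inner_right_distrib add.commute)
  finally show ?thesis by (simp add: fourier_def)
qed

text \<open>Translating f along b multiplies its transform by a character. Computing the derivative
  of this at s = 0 in two ways takes the place of an integration by parts.\<close>

lemma fourier_deriv:
  fixes f f' :: "'a::euclidean_space \<Rightarrow> complex"
  assumes b: "b \<in> Basis" and f: "f \<in> borel_measurable borel"
    and f_le: "\<And>x. norm (f x) \<le> A * decay x"
    and f': "\<And>x. ((\<lambda>s. f (x + s *\<^sub>R b)) has_vector_derivative f' x) (at 0)"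
    and f'_le: "\<And>x. norm (f' x) \<le> B * decay x"
  shows "fourier f' \<xi> = \<i> * (\<xi> \<bullet> b) * fourier f \<xi>"
proof -
  have B: "B \<ge> 0"
    using order_trans[OF norm_ge_zero f'_le[of 0]] decay_pos[of "0::'a"] by (simp add: zero_le_mult_iff)
  have meas: "(\<lambda>x. f (x + a)) \<in> borel_measurable borel" for a using f by measurable
  have fi: "integrable lborel f" by (rule integrable_le_decay[OF f f_le])
  have fa: "integrable lborel (\<lambda>x. f (x + a))" for a
    using integral_shift_lborel(2)[OF f, of a] fi by (simp add: add.commute)
  have d: "((\<lambda>s. f (x + s *\<^sub>R b)) has_vector_derivative f' (x + s0 *\<^sub>R b)) (at s0)" for x s0
  proof -
    have "((\<lambda>s. f (x + s0 *\<^sub>R b + s *\<^sub>R b)) \<circ> (\<lambda>s. s - s0) has_vector_derivative 1 *\<^sub>R f' (x + s0 *\<^sub>R b)) (at s0)"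
      using f'[of "x + s0 *\<^sub>R b"]
      by (intro vector_diff_chain_at) (auto intro!: derivative_eq_intros simp: has_real_derivative_iff_has_vector_derivative[symmetric])
    thus ?thesis by (simp add: o_def algebra_simps)
  qed
  have "((\<lambda>s. LINT x|lborel. cis (- (\<xi> \<bullet> x)) * f (x + s *\<^sub>R b)) has_vector_derivative
      (LINT x|lborel. cis (- (\<xi> \<bullet> x)) * f' (x + 0 *\<^sub>R b))) (at 0)"
  proof (rule has_vector_derivative_lebesgue_integral(1)[where w = "\<lambda>x. B * (3 * decay x)"])
    fix s :: real assume s: "\<bar>s - 0\<bar> \<le> 1"
    show "integrable lborel (\<lambda>x. cis (- (\<xi> \<bullet> x)) * f (x + s *\<^sub>R b))"
      by (rule Bochner_Integration.integrable_bound[OF fa[of "s *\<^sub>R b"]])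
        (use meas in \<open>auto simp: norm_mult\<close>)
    fix x
    show "((\<lambda>s. cis (- (\<xi> \<bullet> x)) * f (x + s *\<^sub>R b)) has_vector_derivative cis (- (\<xi> \<bullet> x)) * f' (x + s *\<^sub>R b)) (at s)"
      by (rule has_vector_derivative_mult_right[OF d])
    show "norm (cis (- (\<xi> \<bullet> x)) * f' (x + s *\<^sub>R b)) \<le> B * (3 * decay x)"
      using order_trans[OF f'_le mult_left_mono[OF decay_shift[of s b x] B]] s b
      by (simp add: norm_mult)
  qed auto
  hence "((\<lambda>s. fourier (\<lambda>x. f (x + s *\<^sub>R b)) \<xi>) has_vector_derivative fourier f' \<xi>) (at 0)"
    by (simp add: fourier_def)
  moreover have "((\<lambda>s. fourier (\<lambda>x. f (x + s *\<^sub>R b)) \<xi>) has_vector_derivative \<i> * (\<xi> \<bullet> b) * fourier f \<xi>) (at 0)"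
  proof -
    have "((\<lambda>s. exp (\<i> * (\<xi> \<bullet> b) * of_real s) * fourier f \<xi>) has_vector_derivative \<i> * (\<xi> \<bullet> b) * fourier f \<xi>) (at 0)"
      by (rule has_vector_derivative_real_field[where s = UNIV, simplified]) (auto intro!: derivative_eq_intros)
    thus ?thesis by (simp add: fourier_shift[OF f] cis_conv_exp algebra_simps)
  qed
  ultimately show ?thesis by (rule vector_derivative_unique_at)
qed

text \<open>Every factor 1 + (x . b)^2 is at most (1 + norm x)^2; hence a single Schwartz seminorm
  yields a \<open>decay\<close> majorant.\<close>

lemma decay_inverse_le: "1 \<le> decay x * (1 + norm x) ^ (2 * DIM('a))" for x :: "'a::euclidean_space"
proof -
  have "(\<Prod>b\<in>Basis. 1 + (x \<bullet> b)\<^sup>2) \<le> (\<Prod>b\<in>(Basis::'a set). (1 + norm x)\<^sup>2)"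
  proof (intro prod_mono conjI)
    fix b :: 'a assume "b \<in> Basis"
    hence "(x \<bullet> b)\<^sup>2 \<le> (norm x)\<^sup>2" using Basis_le_norm[of b x] by (simp add: abs_le_square_iff[symmetric])
    thus "1 + (x \<bullet> b)\<^sup>2 \<le> (1 + norm x)\<^sup>2" unfolding power2_sum by (simp add: add_increasing2)
  qed auto
  moreover have "(\<Prod>b\<in>Basis. 1 + (x \<bullet> b)\<^sup>2) = 1 / decay x"
    by (simp add: decay_def prod_dividef)
  ultimately have "1 / decay x \<le> (1 + norm x) ^ (2 * DIM('a))" by (simp add: power_mult)
  thus ?thesis using decay_pos[of x] by (simp add: field_simps)
qed

lemma partials_append: "partials (cs @ bs) f = partials cs (partials bs f)"
  by (induction cs) auto

lemma schwartz_partials: "schwartz \<phi> \<Longrightarrow> set bs \<subseteq> Basis \<Longrightarrow> schwartz (partials bs \<phi>)"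
  unfolding schwartz_def partials_append[symmetric] by auto

lemma schwartz_differentiable: "schwartz \<phi> \<Longrightarrow> \<phi> differentiable (at x)"
  unfolding schwartz_def by (metis empty_subsetI list.set(1) partials.simps(1))

lemma schwartz_continuous: "schwartz \<phi> \<Longrightarrow> continuous_on UNIV \<phi>"
  by (simp add: continuous_at_imp_continuous_on differentiable_imp_continuous_within schwartz_differentiable)

lemma schwartz_measurable: "schwartz \<phi> \<Longrightarrow> \<phi> \<in> borel_measurable borel"
  by (intro borel_measurable_continuous_onI schwartz_continuous)

lemma schwartz_le_decay:
  fixes \<phi> :: "'a::euclidean_space \<Rightarrow> complex"
  assumes "schwartz \<phi>"
  obtains B where "\<And>x. norm (\<phi> x) \<le> B * decay x"
proof -
  obtain B where B: "\<And>x. (1 + norm x) ^ (2 * DIM('a)) * cmod (partials [] \<phi> x) \<le> B"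
    using assms unfolding schwartz_def by (metis empty_subsetI list.set(1))
  have "norm (\<phi> x) \<le> B * decay x" for x
  proof -
    have "norm (\<phi> x) * 1 \<le> norm (\<phi> x) * (decay x * (1 + norm x) ^ (2 * DIM('a)))"
      by (intro mult_left_mono decay_inverse_le) auto
    also have "\<dots> = ((1 + norm x) ^ (2 * DIM('a)) * cmod (\<phi> x)) * decay x" by simp
    also have "\<dots> \<le> B * decay x" using B[of x] by (intro mult_right_mono) auto
    finally show ?thesis by simp
  qed
  thus ?thesis using that by blast
qed

lemma schwartz_integrable: "schwartz \<phi> \<Longrightarrow> integrable lborel \<phi>"
  by (metis schwartz_le_decay schwartz_measurable integrable_le_decay)

lemma fourier_partial:
  assumes "schwartz \<phi>" "b \<in> Basis"
  shows "fourier (partials [b] \<phi>) \<xi> = \<i> * (\<xi> \<bullet> b) * fourier \<phi> \<xi>"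
proof -
  obtain A where A: "\<And>x. norm (\<phi> x) \<le> A * decay x" using schwartz_le_decay[OF assms(1)] by blast
  obtain B where B: "\<And>x. norm (partials [b] \<phi> x) \<le> B * decay x"
    using schwartz_le_decay[OF schwartz_partials[OF assms(1), of "[b]"]] assms(2) by auto
  show ?thesis
  proof (rule fourier_deriv[OF assms(2) schwartz_measurable[OF assms(1)] A _ B])
    fix x
    have "(\<phi> has_derivative frechet_derivative \<phi> (at x)) (at x)"
      using schwartz_differentiable[OF assms(1)] by (simp add: frechet_derivative_works)
    hence d: "(\<phi> has_derivative frechet_derivative \<phi> (at x)) (at (x + 0 *\<^sub>R b))" by simp
    have "(\<phi> \<circ> (\<lambda>s. x + s *\<^sub>R b) has_derivative frechet_derivative \<phi> (at x) \<circ> (\<lambda>s. s *\<^sub>R b)) (at 0)"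
      by (rule diff_chain_at[of "\<lambda>s. x + s *\<^sub>R b", OF _ d]) (auto intro!: derivative_eq_intros)
    moreover have "frechet_derivative \<phi> (at x) \<circ> (\<lambda>s. s *\<^sub>R b) = (\<lambda>s. s *\<^sub>R partials [b] \<phi> x)"
      using linear_frechet_derivative[OF schwartz_differentiable[OF assms(1), of x]]
      by (auto simp: linear_cmul)
    ultimately show "((\<lambda>s. \<phi> (x + s *\<^sub>R b)) has_vector_derivative partials [b] \<phi> x) (at 0)"
      by (simp add: has_vector_derivative_def o_def)
  qed
qed

lemma norm_fourier_le: "norm (fourier f \<xi>) \<le> (LINT x|lborel. norm (f x))"
proof -
  have "norm (fourier f \<xi>) \<le> (LINT x|lborel. norm (cis (- (\<xi> \<bullet> x)) * f x))"
    unfolding fourier_def by (rule integral_norm_bound)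
  thus ?thesis by (simp add: norm_mult)
qed

text \<open>Multiplying the transform by 1 + (\<xi> . b)^2 amounts to subtracting the second partial
  derivative along b, which is again Schwartz. Doing this for each coordinate builds up the
  reciprocal of \<open>decay\<close>.\<close>

lemma fourier_schwartz_le_decay:
  fixes \<phi> :: "'a::euclidean_space \<Rightarrow> complex"
  assumes "schwartz \<phi>"
  obtains B where "\<And>\<xi>. norm (fourier \<phi> \<xi>) \<le> B * decay \<xi>"
proof -
  \<comment> \<open>The induction over coordinates quantifies over all Schwartz functions because
    its step is applied both to \<psi> and to a second partial derivative of \<psi>.\<close>
  have "\<exists>B. \<forall>\<xi>. (\<Prod>b\<in>A. 1 + (\<xi> \<bullet> b)\<^sup>2) * norm (fourier \<psi> \<xi>) \<le> B"
    if "A \<subseteq> Basis" "schwartz \<psi>" for A and \<psi> :: "'a \<Rightarrow> complex"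
    using finite_subset[OF that(1) finite_Basis] that
  proof (induction A arbitrary: \<psi> rule: finite_induct)
    case empty
    show ?case using norm_fourier_le by auto
  next
    case (insert b A)
    have s: "schwartz (partials [b] \<psi>)" "schwartz (partials [b] (partials [b] \<psi>))"
      using insert.prems by (metis schwartz_partials insert_subset list.simps(15) list.set(1) empty_subsetI)+
    obtain B1 B2 where B: "\<And>\<xi>. (\<Prod>b\<in>A. 1 + (\<xi> \<bullet> b)\<^sup>2) * norm (fourier \<psi> \<xi>) \<le> B1"
       "\<And>\<xi>. (\<Prod>b\<in>A. 1 + (\<xi> \<bullet> b)\<^sup>2) * norm (fourier (partials [b] (partials [b] \<psi>)) \<xi>) \<le> B2"
      using insert.IH[of \<psi>] insert.IH[OF _ s(2)] insert.prems by auto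
    have "(\<Prod>b\<in>insert b A. 1 + (\<xi> \<bullet> b)\<^sup>2) * norm (fourier \<psi> \<xi>) \<le> B1 + B2" for \<xi>
    proof -
      have b: "b \<in> Basis" using insert.prems by auto
      have n: "norm (fourier (partials [b] (partials [b] \<psi>)) \<xi>) = (\<xi> \<bullet> b)\<^sup>2 * norm (fourier \<psi> \<xi>)"
        unfolding fourier_partial[OF s(1) b] fourier_partial[OF insert.prems(2) b]
        by (simp add: norm_mult power2_eq_square abs_mult[symmetric] flip: mult.assoc)
      have "(\<Prod>b\<in>insert b A. 1 + (\<xi> \<bullet> b)\<^sup>2) * norm (fourier \<psi> \<xi>) =
          (\<Prod>b\<in>A. 1 + (\<xi> \<bullet> b)\<^sup>2) * norm (fourier \<psi> \<xi>) +
          (\<Prod>b\<in>A. 1 + (\<xi> \<bullet> b)\<^sup>2) * norm (fourier (partials [b] (partials [b] \<psi>)) \<xi>)"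
        unfolding n using insert.hyps by (simp add: algebra_simps)
      thus ?thesis using B[of \<xi>] by linarith
    qed
    thus ?case by blast
  qed
  from this[OF subset_refl assms] obtain B
    where B: "\<And>\<xi>. (\<Prod>b\<in>Basis. 1 + (\<xi> \<bullet> b)\<^sup>2) * norm (fourier \<phi> \<xi>) \<le> B" by blast
  have "norm (fourier \<phi> \<xi>) \<le> B * decay \<xi>" for \<xi>
  proof -
    have "(\<Prod>b\<in>Basis. 1 + (\<xi> \<bullet> b)\<^sup>2) = 1 / decay \<xi>" by (simp add: decay_def prod_dividef)
    thus ?thesis using B[of \<xi>] decay_pos[of \<xi>] by (simp add: pos_divide_le_eq)
  qed
  thus ?thesis using that by blast
qed

lemma continuous_on_fourier:
  assumes "integrable lborel f"
  shows "continuous_on UNIV (fourier f)"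
  unfolding continuous_on_sequentially o_def
proof (intro ballI allI impI, elim conjE)
  fix X and \<xi> :: 'a assume "X \<longlonglongrightarrow> \<xi>"
  thus "(\<lambda>n. fourier f (X n)) \<longlonglongrightarrow> fourier f \<xi>"
    unfolding fourier_def using assms borel_measurable_integrable[OF assms]
    by (intro integral_dominated_convergence[where w = "\<lambda>x. norm (f x)"])
      (auto intro!: tendsto_intros AE_I2 simp: norm_mult cis_conv_exp)
qed

lemma fourier_measurable: "integrable lborel f \<Longrightarrow> fourier f \<in> borel_measurable borel"
  by (intro borel_measurable_continuous_onI continuous_on_fourier)

lemma fourier_schwartz_integrable: "schwartz \<phi> \<Longrightarrow> integrable lborel (fourier \<phi>)"
  by (metis fourier_schwartz_le_decay fourier_measurable schwartz_integrable integrable_le_decay)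

section \<open>Gaussian integrals with a complex parameter\<close>

lemma exp_neg_square_le:
  fixes a :: real assumes "a > 0"
  obtains C where "C > 0" "\<And>x::real. exp (- (a * x\<^sup>2)) \<le> C * (1 / (1 + x\<^sup>2)) ^ 3"
proof -
  \<comment> \<open>With this b, b (1 + x^2) <= 1 + a x^2 / 3, and (1 + y/3)^3 <= exp y concludes.
    Beyond one integrable factor the cube leaves room for polynomial weights up to (1 +
    x^2)^2.\<close>
  define b where "b = min 1 (a / 3)"
  have b: "b > 0" "b \<le> 1" "b \<le> a / 3" using assms by (auto simp: b_def)
  have "exp (- (a * x\<^sup>2)) \<le> (1 / b ^ 3) * (1 / (1 + x\<^sup>2)) ^ 3" for x :: real
  proof -
    have "b * x\<^sup>2 \<le> a / 3 * x\<^sup>2" by (intro mult_right_mono b) auto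
    hence "b * (1 + x\<^sup>2) \<le> 1 + a * x\<^sup>2 / 3" using b unfolding distrib_left by linarith
    hence "(b * (1 + x\<^sup>2)) ^ 3 \<le> (1 + a * x\<^sup>2 / real 3) ^ 3"
      using b by (intro power_mono) auto
    also have "\<dots> \<le> exp (a * x\<^sup>2)"
      using assms by (intro exp_ge_one_plus_x_over_n_power_n) (auto intro: order_trans[of _ 0])
    finally have "1 / exp (a * x\<^sup>2) \<le> 1 / (b * (1 + x\<^sup>2)) ^ 3"
      using b by (intro divide_left_mono mult_pos_pos zero_less_power add_pos_nonneg) auto
    thus ?thesis by (simp add: exp_minus divide_inverse power_mult_distrib power_inverse)
  qed
  thus ?thesis using that[of "1 / b^3"] b by auto
qed

text \<open>The integral is the Fourier transform at frequency 0, where differentiation becomes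
  multiplication by 0.\<close>

lemma integral_derivative_eq_0:
  fixes f f' :: "real \<Rightarrow> complex"
  assumes "\<And>x. (f has_vector_derivative f' x) (at x)"
    and "\<And>x. norm (f x) \<le> A * decay x" "\<And>x. norm (f' x) \<le> B * decay x"
  shows "(LINT x|lborel. f' x) = 0"
proof -
  have "continuous_on UNIV f"
    using assms(1) by (meson continuous_at_imp_continuous_on has_vector_derivative_continuous)
  hence m: "f \<in> borel_measurable borel" by (rule borel_measurable_continuous_onI)
  have "((\<lambda>s. f (x + s *\<^sub>R 1)) has_vector_derivative f' x) (at 0)" for x
    using assms(1)[of x] by (simp add: has_vector_derivative_iff_quotient)
  hence "fourier f' 0 = \<i> * complex_of_real ((0::real) \<bullet> 1) * fourier f 0"
    by (intro fourier_deriv[where b = "1::real" and A = A and B = B] m assms) auto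
  thus ?thesis by (simp add: fourier_def)
qed

definition gaussian :: "complex \<Rightarrow> real \<Rightarrow> real \<Rightarrow> complex" where
  "gaussian z y x = exp (- z * x\<^sup>2 + \<i> * y * x)"

lemma norm_gaussian: "norm (gaussian z y x) = exp (- (Re z * x\<^sup>2))"
  by (simp add: gaussian_def power2_eq_square)

lemma gaussian_measurable [measurable]: "gaussian z y \<in> borel_measurable borel"
  unfolding gaussian_def by measurable

lemma gaussian_bounds:
  assumes "Re z > 0"
  obtains C where "C > 0" "\<And>x. norm (gaussian z y x) * (1 + x\<^sup>2)\<^sup>2 \<le> C * decay x"
proof -
  obtain C where C: "C > 0" "\<And>x::real. exp (- (Re z * x\<^sup>2)) \<le> C * (1 / (1 + x\<^sup>2)) ^ 3"
    using exp_neg_square_le[OF assms] by blast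
  have "norm (gaussian z y x) * (1 + x\<^sup>2)\<^sup>2 \<le> C * decay x" for x
  proof -
    have p: "1 + x\<^sup>2 > 0" by (simp add: add_pos_nonneg)
    have "norm (gaussian z y x) * (1 + x\<^sup>2)\<^sup>2 \<le> C * (1 / (1 + x\<^sup>2)) ^ 3 * (1 + x\<^sup>2)\<^sup>2"
      unfolding norm_gaussian by (intro mult_right_mono C) auto
    also have "\<dots> = C * decay x" using p by (simp add: decay_real power_divide eval_nat_numeral)
    finally show ?thesis .
  qed
  thus ?thesis using that C(1) by blast
qed

lemma gaussian_moments_le:
  assumes "Re z > 0"
  obtains C where "C > 0" "\<And>x p. norm p \<le> (K::real) * (1 + x\<^sup>2)\<^sup>2 \<Longrightarrow> norm (p * gaussian z y x) \<le> K * C * decay x"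
proof -
  obtain C where C: "C > 0" "\<And>x. norm (gaussian z y x) * (1 + x\<^sup>2)\<^sup>2 \<le> C * decay x"
    using gaussian_bounds[OF assms] by blast
  have "norm (p * gaussian z y x) \<le> K * C * decay x" if p: "norm p \<le> K * (1 + x\<^sup>2)\<^sup>2" for x p
  proof -
    have "0 \<le> K * (1 + x\<^sup>2)\<^sup>2" using p norm_ge_zero order_trans by blast
    moreover have "(1 + x\<^sup>2)\<^sup>2 > 0" by (intro zero_less_power add_pos_nonneg) auto
    ultimately have K: "K \<ge> 0" by (simp add: zero_le_mult_iff)
    have "norm (p * gaussian z y x) \<le> K * (1 + x\<^sup>2)\<^sup>2 * norm (gaussian z y x)"
      unfolding norm_mult by (intro mult_right_mono p) auto
    also have "\<dots> \<le> K * (C * decay x)"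
      using mult_left_mono[OF C(2)[of x] K] by (simp add: mult_ac)
    finally show ?thesis by simp
  qed
  thus ?thesis using that C(1) by blast
qed

lemma abs_le_1_plus_square: "\<bar>x\<bar> \<le> 1 + x\<^sup>2" for x :: real
proof -
  have "0 \<le> (\<bar>x\<bar> - 1)\<^sup>2" by simp
  thus ?thesis unfolding power2_diff by simp
qed

lemma gaussian_poly_bounds:
  fixes c0 c1 c2 :: complex
  assumes "Re z > 0"
  obtains B where "\<And>x::real. norm ((c0 + c1 * x + c2 * x\<^sup>2) * gaussian z y x) \<le> B * decay x"
proof -
  obtain C where C: "C > 0" "\<And>x p. norm p \<le> (norm c0 + norm c1 + norm c2) * (1 + x\<^sup>2)\<^sup>2 \<Longrightarrow>
      norm (p * gaussian z y x) \<le> (norm c0 + norm c1 + norm c2) * C * decay x"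
    using gaussian_moments_le[OF assms] by metis
  have "norm ((c0 + c1 * x + c2 * x\<^sup>2) * gaussian z y x) \<le> (norm c0 + norm c1 + norm c2) * C * decay x" for x :: real
  proof (rule C(2))
    have a: "1 + x\<^sup>2 \<le> (1 + x\<^sup>2)\<^sup>2" by (rule self_le_power) auto
    have "norm (c0 + c1 * x + c2 * x\<^sup>2) \<le> norm c0 + norm (c1 * x) + norm (c2 * x\<^sup>2)"
      by (intro norm_triangle_mono order_refl)
    also have "\<dots> = norm c0 * 1 + norm c1 * \<bar>x\<bar> + norm c2 * x\<^sup>2"
      by (simp add: norm_mult norm_power)
    also have "\<dots> \<le> norm c0 * (1 + x\<^sup>2)\<^sup>2 + norm c1 * (1 + x\<^sup>2)\<^sup>2 + norm c2 * (1 + x\<^sup>2)\<^sup>2"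
      using a abs_le_1_plus_square[of x] by (intro add_mono mult_left_mono) (auto intro: order_trans[OF _ a])
    finally show "norm (c0 + c1 * x + c2 * x\<^sup>2) \<le> (norm c0 + norm c1 + norm c2) * (1 + x\<^sup>2)\<^sup>2"
      by (simp add: algebra_simps)
  qed
  thus ?thesis using that by blast
qed

lemma gaussian_integrable:
  assumes "Re z > 0"
  shows "integrable lborel (gaussian z y)"
    and "integrable lborel (\<lambda>x. x * gaussian z y x)"
    and "integrable lborel (\<lambda>x. of_real (x\<^sup>2) * gaussian z y x)"
proof -
  obtain B0 where B0: "\<And>x::real. norm (gaussian z y x) \<le> B0 * decay x"
    using gaussian_poly_bounds[OF assms, of 1 0 0 y] by auto
  obtain B1 where B1: "\<And>x::real. norm (x * gaussian z y x) \<le> B1 * decay x"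
    using gaussian_poly_bounds[OF assms, of 0 1 0 y] by auto
  obtain B2 where B2: "\<And>x::real. norm (of_real (x\<^sup>2) * gaussian z y x) \<le> B2 * decay x"
    using gaussian_poly_bounds[OF assms, of 0 0 1 y] by auto
  show "integrable lborel (gaussian z y)" by (rule integrable_le_decay[OF _ B0]) measurable
  show "integrable lborel (\<lambda>x. x * gaussian z y x)" by (rule integrable_le_decay[OF _ B1]) measurable
  show "integrable lborel (\<lambda>x. of_real (x\<^sup>2) * gaussian z y x)" by (rule integrable_le_decay[OF _ B2]) measurable
qed

lemma gaussian_has_vector_derivative:
  "(gaussian z y has_vector_derivative (- 2 * z * x + \<i> * y) * gaussian z y x) (at x)"
proof -
  have "((\<lambda>w. exp (- z * w\<^sup>2 + \<i> * y * w)) has_field_derivative (- 2 * z * x + \<i> * y) * gaussian z y x)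
      (at (complex_of_real x))"
    unfolding gaussian_def by (auto intro!: derivative_eq_intros simp: algebra_simps)
  from has_vector_derivative_real_field[OF this] show ?thesis
    by (simp add: gaussian_def[abs_def])
qed

text \<open>Integrating the derivatives of the Gaussian and of x times the Gaussian gives two linear
  relations between the moments of orders 0, 1 and 2; the first moment is eliminated. The result
  supplies the differential equation for the complex Gaussian integral.\<close>

lemma gaussian_moments:
  assumes "Re z > 0"
  shows "(LINT x|lborel. of_real (x\<^sup>2) * gaussian z y x) = (1 / (2 * z) - y\<^sup>2 / (4 * z\<^sup>2)) * (LINT x|lborel. gaussian z y x)"
proof -
  let ?J = "LINT x|lborel. gaussian z y x" and ?M1 = "LINT x|lborel. x * gaussian z y x"
    and ?M2 = "LINT x|lborel. of_real (x\<^sup>2) * gaussian z y x"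
  have z: "z \<noteq> 0" using assms by auto
  note int = gaussian_integrable[OF assms, of y]
  obtain B0 where B0: "\<And>x. norm (gaussian z y x) \<le> B0 * decay x"
    using gaussian_poly_bounds[OF assms, of 1 0 0 y] by auto
  obtain B1 where B1: "\<And>x. norm ((- 2 * z * x + \<i> * y) * gaussian z y x) \<le> B1 * decay x"
    using gaussian_poly_bounds[OF assms, of "\<i> * y" "- 2 * z" 0 y] by (auto simp: add.commute)
  note B = B0 B1
  have "0 = (LINT x|lborel. (- 2 * z * x + \<i> * y) * gaussian z y x)"
    using integral_derivative_eq_0[OF gaussian_has_vector_derivative B] by simp
  also have "\<dots> = (LINT x|lborel. - 2 * z * (x * gaussian z y x) + \<i> * y * gaussian z y x)"
    by (simp add: algebra_simps)
  also have "\<dots> = - 2 * z * ?M1 + \<i> * y * ?J"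
    using int by (subst Bochner_Integration.integral_add) auto
  finally have M1: "?M1 = \<i> * y * ?J / (2 * z)" using z by (simp add: field_simps)
  obtain B2 where B2: "\<And>x::real. norm (x * gaussian z y x) \<le> B2 * decay x"
    using gaussian_poly_bounds[OF assms, of 0 1 0 y] by auto
  obtain B3 where B3: "\<And>x::real. norm ((1 + \<i> * y * x + (- 2 * z) * of_real (x\<^sup>2)) * gaussian z y x) \<le> B3 * decay x"
    using gaussian_poly_bounds[OF assms, of 1 "\<i> * y" "- 2 * z" y] by metis
  note B' = B2 B3
  have d: "((\<lambda>x. x * gaussian z y x) has_vector_derivative (1 + \<i> * y * x + (- 2 * z) * of_real (x\<^sup>2)) * gaussian z y x) (at x)" for x
  proof -
    have "((\<lambda>x. of_real x * gaussian z y x) has_vector_derivative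
        of_real x * ((- 2 * z * x + \<i> * y) * gaussian z y x) + 1 * gaussian z y x) (at x)"
      by (rule has_vector_derivative_mult[OF _ gaussian_has_vector_derivative])
        (rule has_vector_derivative_real_field, auto intro!: derivative_eq_intros)
    thus ?thesis by (simp add: algebra_simps power2_eq_square)
  qed
  have "0 = (LINT x|lborel. (1 + \<i> * y * x + (- 2 * z) * of_real (x\<^sup>2)) * gaussian z y x)"
    using integral_derivative_eq_0[OF d B'] by simp
  also have "\<dots> = (LINT x|lborel. gaussian z y x + \<i> * y * (x * gaussian z y x) + (- 2 * z) * (of_real (x\<^sup>2) * gaussian z y x))"
    by (simp add: algebra_simps)
  also have "\<dots> = ?J + \<i> * y * ?M1 + (- 2 * z) * ?M2"
    using int by (subst Bochner_Integration.integral_add, auto)+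
  finally have "?M2 = (?J + \<i> * y * ?M1) / (2 * z)" using z by (simp add: field_simps)
  thus ?thesis using z unfolding M1 by (simp add: field_simps power2_eq_square)
qed

text \<open>The starting value for the complex case, read off from the characteristic function of
  the standard normal distribution by rescaling with sqrt (2 a).\<close>

lemma gaussian_integral_real:
  fixes a :: real assumes a: "a > 0"
  shows "(LINT x|lborel. gaussian a y x) = sqrt (pi / a) * exp (- (y\<^sup>2 / (4 * a)))"
proof -
  let ?t = "y / sqrt (2 * a)"
  have "exp (- (?t\<^sup>2) / 2) = char std_normal_distribution ?t"
    by (simp add: char_std_normal_distribution)
  also have "\<dots> = (LINT x|lborel. std_normal_density x *\<^sub>R iexp (?t * x))"
    unfolding char_def by (subst integral_density) auto
  also have "\<dots> = \<bar>sqrt (2 * a)\<bar> *\<^sub>R (LINT x|lborel. std_normal_density (0 + sqrt (2 * a) * x) *\<^sub>R iexp (?t * (0 + sqrt (2 * a) * x)))"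
    using a by (intro lborel_integral_real_affine) auto
  also have "\<dots> = \<bar>sqrt (2 * a)\<bar> *\<^sub>R (LINT x|lborel. (1 / sqrt (2 * pi)) * gaussian a y x)"
  proof -
    have "std_normal_density (0 + sqrt (2 * a) * x) *\<^sub>R iexp (?t * (0 + sqrt (2 * a) * x)) = (1 / sqrt (2 * pi)) * gaussian a y x" for x
    proof -
      have "?t * (0 + sqrt (2 * a) * x) = y * x" using a by simp
      moreover have "std_normal_density (0 + sqrt (2 * a) * x) = (1 / sqrt (2 * pi)) * exp (- (a * x\<^sup>2))"
        using a by (simp add: std_normal_density_def power_mult_distrib)
      moreover have "gaussian a y x = of_real (exp (- (a * x\<^sup>2))) * iexp (y * x)"
        by (simp add: gaussian_def exp_add[symmetric] exp_of_real[symmetric] algebra_simps)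
      ultimately show ?thesis by (simp add: scaleR_conv_of_real)
    qed
    thus ?thesis by simp
  qed
  also have "\<dots> = complex_of_real (sqrt (2 * a) / sqrt (2 * pi)) * (LINT x|lborel. gaussian a y x)"
    using a by (simp add: scaleR_conv_of_real)
  finally have e: "complex_of_real (exp (- (?t\<^sup>2) / 2)) = complex_of_real (sqrt (2 * a) / sqrt (2 * pi)) * (LINT x|lborel. gaussian a y x)"
    by simp
  have "complex_of_real (sqrt (pi / a)) * complex_of_real (sqrt (2 * a) / sqrt (2 * pi)) = 1"
    using a by (simp add: real_sqrt_divide real_sqrt_mult flip: of_real_mult)
  hence "(LINT x|lborel. gaussian a y x) = complex_of_real (sqrt (pi / a)) * complex_of_real (exp (- (?t\<^sup>2) / 2))"
    unfolding e by (simp add: mult.assoc[symmetric])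
  moreover have "- (?t\<^sup>2) / 2 = - (y\<^sup>2 / (4 * a))" using a by (simp add: power_divide)
  ultimately show ?thesis by simp
qed

text \<open>On the vertical line through Re z the integral J solves a linear first-order equation
  whose coefficient is the second moment. Up to the factor sqrt pi, H is J divided by the claimed
  value; it is therefore constant on the line and known at the real point.\<close>

theorem gaussian_integral:
  assumes "Re z > 0"
  shows "(LINT x|lborel. gaussian z y x) = sqrt pi / csqrt z * exp (- (y\<^sup>2 / (4 * z)))"
proof -
  define a where "a = Re z"
  have a: "a > 0" using assms by (simp add: a_def)
  define Z where "Z = (\<lambda>s::real. complex_of_real a - \<i> * s)"
  have Z: "Re (Z s) > 0" "Z s \<noteq> 0" "Z s \<notin> \<real>\<^sub>\<le>\<^sub>0" for s
  proof -
    show "Re (Z s) > 0" using a by (simp add: Z_def)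
    thus "Z s \<noteq> 0" "Z s \<notin> \<real>\<^sub>\<le>\<^sub>0" by (auto simp: complex_nonpos_Reals_iff)
  qed
  define J where "J = (\<lambda>s. LINT x|lborel. gaussian (Z s) y x)"
  define H where "H = (\<lambda>s. J s * (csqrt (Z s) * exp (y\<^sup>2 / (4 * Z s))))"
  have dJ: "(J has_vector_derivative (LINT x|lborel. \<i> * of_real (x\<^sup>2) * gaussian (Z s) y x)) (at s)" for s
  proof -
    \<comment> \<open>The modulus of \<open>gaussian\<close> depends only on the real part of its
      parameter, so the bound at the real point serves for every s.\<close>
    obtain B where B: "\<And>x::real. norm (of_real (x\<^sup>2) * gaussian (Z 0) y x) \<le> B * decay x"
      using gaussian_poly_bounds[OF Z(1)[of 0], of 0 0 1 y] by auto
    show ?thesis unfolding J_def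
    proof (rule has_vector_derivative_lebesgue_integral(1))
      fix s' :: real assume "\<bar>s' - s\<bar> \<le> 1"
      show "integrable lborel (gaussian (Z s') y)" by (rule gaussian_integrable[OF Z(1)])
      fix x :: real
      show "((\<lambda>s. gaussian (Z s) y x) has_vector_derivative \<i> * of_real (x\<^sup>2) * gaussian (Z s') y x) (at s')"
      proof -
        have "((\<lambda>w. exp (- (complex_of_real a - \<i> * w) * x\<^sup>2 + \<i> * y * x)) has_field_derivative
            \<i> * of_real (x\<^sup>2) * gaussian (Z s') y x) (at (complex_of_real s'))"
          unfolding gaussian_def Z_def by (auto intro!: derivative_eq_intros)
        from has_vector_derivative_real_field[OF this] show ?thesis
          unfolding gaussian_def Z_def .
      qed
      show "norm (\<i> * of_real (x\<^sup>2) * gaussian (Z s') y x) \<le> B * decay x"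
        using B[of x] by (simp add: norm_mult norm_gaussian Z_def)
    qed simp
  qed
  have M2: "(LINT x|lborel. \<i> * of_real (x\<^sup>2) * gaussian (Z s) y x) = \<i> * ((1 / (2 * Z s) - y\<^sup>2 / (4 * (Z s)\<^sup>2)) * J s)" for s
    using gaussian_integrable[OF Z(1)[of s], of y]
    by (simp add: mult.assoc J_def flip: gaussian_moments[OF Z(1)])
  have dZ: "((\<lambda>s. csqrt (Z s) * exp (y\<^sup>2 / (4 * Z s))) has_vector_derivative
      - \<i> * (1 / (2 * Z s) - y\<^sup>2 / (4 * (Z s)\<^sup>2)) * (csqrt (Z s) * exp (y\<^sup>2 / (4 * Z s)))) (at s)" for s
  proof -
    have "((\<lambda>w. csqrt w * exp (y\<^sup>2 / (4 * w))) has_field_derivative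
        (1 / (2 * Z s) - y\<^sup>2 / (4 * (Z s)\<^sup>2)) * (csqrt (Z s) * exp (y\<^sup>2 / (4 * Z s)))) (at (Z s))"
    proof -
      have e: "inverse (2 * csqrt (Z s)) = csqrt (Z s) / (2 * Z s)"
        using Z(2)[of s] by (simp add: field_simps flip: power2_eq_square)
      have "((\<lambda>w. csqrt w * exp (y\<^sup>2 / (4 * w))) has_field_derivative
          inverse (2 * csqrt (Z s)) * exp (y\<^sup>2 / (4 * Z s)) +
          (exp (y\<^sup>2 / (4 * Z s)) * (- (y\<^sup>2 / (4 * (Z s)\<^sup>2)))) * csqrt (Z s)) (at (Z s))"
        using Z(2)[of s]
        by (intro DERIV_mult has_field_derivative_csqrt Z DERIV_chain'[where g = exp] DERIV_exp)
          (auto intro!: derivative_eq_intros simp: power2_eq_square field_simps)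
      thus ?thesis unfolding e by (simp add: algebra_simps)
    qed
    moreover have "(Z has_vector_derivative - \<i>) (at s)"
      unfolding Z_def by (auto intro!: derivative_eq_intros)
    ultimately have "((\<lambda>w. csqrt w * exp (y\<^sup>2 / (4 * w))) \<circ> Z has_vector_derivative
        - \<i> * ((1 / (2 * Z s) - y\<^sup>2 / (4 * (Z s)\<^sup>2)) * (csqrt (Z s) * exp (y\<^sup>2 / (4 * Z s))))) (at s)"
      by (rule field_vector_diff_chain_at[rotated])
    thus ?thesis by (simp add: o_def mult.assoc)
  qed
  have "(H has_vector_derivative 0) (at s)" for s
    using has_vector_derivative_mult[OF dJ[of s] dZ[of s]] unfolding H_def M2 by (simp add: algebra_simps)
  \<comment> \<open>The line is parametrised by \<open>a - \<i> * s\<close>, so z itself sits at s =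
    - Im z.\<close>
  hence "H (- Im z) = H 0"
    using has_vector_derivative_zero_constant[of UNIV H] by (metis UNIV_I convex_UNIV)
  moreover have "Z (- Im z) = z" by (simp add: Z_def a_def complex_eq_iff)
  moreover have "H 0 = sqrt pi"
  proof -
    have "csqrt (Z 0) = complex_of_real (sqrt a)" using a by (simp add: Z_def csqrt_of_real_nonneg)
    moreover have "J 0 = sqrt (pi / a) * exp (- (y\<^sup>2 / (4 * a)))"
      using gaussian_integral_real[OF a] by (simp add: J_def Z_def)
    moreover have "exp (y\<^sup>2 / (4 * Z 0)) = complex_of_real (exp (y\<^sup>2 / (4 * a)))"
      by (simp add: Z_def exp_of_real[symmetric])
    ultimately have "H 0 = complex_of_real (sqrt (pi / a) * sqrt a * (exp (- (y\<^sup>2 / (4 * a))) * exp (y\<^sup>2 / (4 * a))))"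
      unfolding H_def by simp
    also have "exp (- (y\<^sup>2 / (4 * a))) * exp (y\<^sup>2 / (4 * a)) = 1" by (simp flip: exp_add)
    also have "sqrt (pi / a) * sqrt a * 1 = sqrt pi" using a by (simp flip: real_sqrt_mult)
    finally show ?thesis .
  qed
  ultimately have "(LINT x|lborel. gaussian z y x) * (csqrt z * exp (y\<^sup>2 / (4 * z))) = sqrt pi"
    by (simp add: H_def J_def)
  hence J: "(LINT x|lborel. gaussian z y x) * (csqrt z * E) = sqrt pi" if "E = exp (y\<^sup>2 / (4 * z))" for E
    using that by simp
  have c: "csqrt z \<noteq> 0" using assms by auto
  have "(LINT x|lborel. gaussian z y x) = (LINT x|lborel. gaussian z y x) * (csqrt z * exp (y\<^sup>2 / (4 * z)))
      / csqrt z * exp (- (y\<^sup>2 / (4 * z)))"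
    using c by (simp add: exp_minus)
  thus ?thesis unfolding J[OF refl] by (simp only: of_real_power)
qed

section \<open>Gaussian regularisation: Fresnel kernel and Fourier inversion\<close>

lemma Fubini_bounded_kernel:
  fixes f :: "'a::euclidean_space \<Rightarrow> complex" and g :: "'b::euclidean_space \<Rightarrow> complex"
  assumes f: "integrable lborel f" and g: "integrable lborel g"
    and k: "case_prod k \<in> borel_measurable borel" "\<And>x y. norm (k x y) \<le> B"
  shows "(LINT y|lborel. LINT x|lborel. k x y * (f x * g y)) =
    (LINT x|lborel. LINT y|lborel. k x y * (f x * g y))"
proof -
  have [measurable]: "f \<in> borel_measurable borel" "g \<in> borel_measurable borel"
    using f g by (auto dest: borel_measurable_integrable)
  have [measurable]: "case_prod k \<in> borel_measurable (borel \<Otimes>\<^sub>M borel)"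
    using k(1) by (simp add: borel_prod)
  have 1: "integrable (lborel \<Otimes>\<^sub>M lborel) (\<lambda>(x, y). f x * g y)"
  proof (rule lborel_pair.Fubini_integrable)
    show "integrable lborel (\<lambda>x. LINT y|lborel. norm (case (x, y) of (x, y) \<Rightarrow> f x * g y))"
      using f by (simp add: norm_mult)
    show "AE x in lborel. integrable lborel (\<lambda>y. case (x, y) of (x, y) \<Rightarrow> f x * g y)"
      using g by simp
  qed measurable
  have 2: "integrable (lborel \<Otimes>\<^sub>M lborel) (\<lambda>(x, y). k x y * (f x * g y))"
  proof (rule Bochner_Integration.integrable_bound)
    show "integrable (lborel \<Otimes>\<^sub>M lborel) (\<lambda>p. B * norm (case p of (x, y) \<Rightarrow> f x * g y))"
      using 1 by auto
    show "AE p in lborel \<Otimes>\<^sub>M lborel. norm (case p of (x, y) \<Rightarrow> k x y * (f x * g y))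
        \<le> norm (B * norm (case p of (x, y) \<Rightarrow> f x * g y))"
    proof (intro AE_I2, clarify)
      fix x y
      have "norm (k x y) \<le> \<bar>B\<bar>" using k(2)[of x y] by simp
      thus "norm (k x y * (f x * g y)) \<le> norm (B * norm (f x * g y))"
        by (simp add: norm_mult mult_right_mono abs_mult)
    qed
  qed measurable
  show "(LINT y|lborel. LINT x|lborel. k x y * (f x * g y)) = (LINT x|lborel. LINT y|lborel. k x y * (f x * g y))"
    by (rule lborel_pair.Fubini_integral[OF 2])
qed

lemma fourier_kernel_measurable:
  "(\<lambda>(x :: 'a::euclidean_space, y). cis (- (x \<bullet> y))) \<in> borel_measurable borel"
  unfolding split_beta by (intro borel_measurable_cis borel_measurable_continuous_onI continuous_intros)

text \<open>The squared norm and the inner product are sums over coordinates, so the exponential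
  splits into one-dimensional Gaussians.\<close>

lemma
  fixes y :: "'a::euclidean_space" and z :: complex
  assumes z: "Re z > 0"
  shows integrable_gaussian_euclidean: "integrable lborel (\<lambda>\<xi>. exp (- z * (norm \<xi>)\<^sup>2) * cis (\<xi> \<bullet> y))" (is "integrable lborel ?g")
    and integral_gaussian_euclidean: "(LINT \<xi>|lborel. exp (- z * (norm \<xi>)\<^sup>2) * cis (\<xi> \<bullet> y)) =
      (sqrt pi / csqrt z) ^ DIM('a) * exp (- ((norm y)\<^sup>2 / (4 * z)))"
proof -
  have g: "?g = (\<lambda>\<xi>. \<Prod>b\<in>Basis. gaussian z (y \<bullet> b) (\<xi> \<bullet> b))"
  proof
    fix \<xi> :: 'a
    have "(\<Prod>b\<in>Basis. gaussian z (y \<bullet> b) (\<xi> \<bullet> b)) =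
        exp (\<Sum>b\<in>Basis. - z * of_real ((\<xi> \<bullet> b)\<^sup>2) + \<i> * of_real ((\<xi> \<bullet> b) * (y \<bullet> b)))"
      unfolding gaussian_def by (subst exp_sum) (auto simp: algebra_simps)
    also have "(\<Sum>b\<in>Basis. - z * of_real ((\<xi> \<bullet> b)\<^sup>2) + \<i> * of_real ((\<xi> \<bullet> b) * (y \<bullet> b))) =
        - z * of_real (\<Sum>b\<in>Basis. (\<xi> \<bullet> b)\<^sup>2) + \<i> * of_real (\<Sum>b\<in>Basis. (\<xi> \<bullet> b) * (y \<bullet> b))"
      by (simp only: sum.distrib sum_distrib_left of_real_sum)
    also have "(\<Sum>b\<in>Basis. (\<xi> \<bullet> b) * (y \<bullet> b)) = \<xi> \<bullet> y" by (rule euclidean_inner[symmetric])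
    also have "(\<Sum>b\<in>Basis. (\<xi> \<bullet> b)\<^sup>2) = (norm \<xi>)\<^sup>2"
      unfolding power2_norm_eq_inner by (subst euclidean_inner) (simp add: power2_eq_square)
    finally show "?g \<xi> = (\<Prod>b\<in>Basis. gaussian z (y \<bullet> b) (\<xi> \<bullet> b))"
      by (simp only: exp_add cis_conv_exp of_real_power)
  qed
  show "integrable lborel ?g"
    unfolding g by (intro integrable_prod_lborel gaussian_integrable z)
  have "integral\<^sup>L lborel ?g = (\<Prod>b\<in>Basis. LINT x|lborel. gaussian z (y \<bullet> b) x)"
    unfolding g by (intro integral_prod_lborel gaussian_integrable z)
  also have "\<dots> = (\<Prod>b\<in>(Basis::'a set). sqrt pi / csqrt z) * (\<Prod>b\<in>Basis. exp (- (of_real ((y \<bullet> b)\<^sup>2) / (4 * z))))"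
    by (simp only: gaussian_integral[OF z] prod.distrib of_real_power)
  also have "(\<Prod>b\<in>Basis. exp (- (of_real ((y \<bullet> b)\<^sup>2) / (4 * z)))) = exp (- (of_real (\<Sum>b\<in>Basis. (y \<bullet> b)\<^sup>2) / (4 * z)))"
    by (simp only: exp_sum[OF finite_Basis, symmetric] sum_negf of_real_sum sum_divide_distrib)
  also have "(\<Sum>b\<in>Basis. (y \<bullet> b)\<^sup>2) = (norm y)\<^sup>2"
    unfolding power2_norm_eq_inner by (subst euclidean_inner) (simp add: power2_eq_square)
  finally show "integral\<^sup>L lborel ?g = (sqrt pi / csqrt z) ^ DIM('a) * exp (- ((norm y)\<^sup>2 / (4 * z)))"
    by simp
qed

text \<open>The kernel is the boundary value of the Gaussian formula at z = -i t. The principal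
  square root of -i t has phase - sgn t * pi / 4, which accounts for the constant and its dependence
  on the sign of t.\<close>

lemma schrodinger_kernel_eq:
  assumes t: "t \<noteq> 0"
  shows "schrodinger_kernel t (x :: 'a::euclidean_space) =
    (sqrt pi / csqrt (- \<i> * t)) ^ DIM('a) * exp (- ((norm x)\<^sup>2 / (4 * (- \<i> * t))))"
proof -
  have c: "csqrt (- \<i> * t) = sqrt \<bar>t\<bar> * cis (- (sgn t * pi / 4))"
  proof (rule csqrt_unique)
    have "(complex_of_real (sqrt \<bar>t\<bar>) * cis (- (sgn t * pi / 4)))\<^sup>2 = \<bar>t\<bar> * cis (- (sgn t * pi / 2))"
      by (simp add: power_mult_distrib Complex.DeMoivre mult.commute flip: of_real_power)
    also have "cis (- (sgn t * pi / 2)) = - \<i> * sgn t"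
      using t by (cases "t > 0") (auto simp: cis.ctr complex_eq_iff sgn_if)
    also have "\<bar>t\<bar> * (- \<i> * sgn t) = - \<i> * t"
      by (simp add: abs_sgn[of t] algebra_simps flip: of_real_mult)
    finally show "(complex_of_real (sqrt \<bar>t\<bar>) * cis (- (sgn t * pi / 4)))\<^sup>2 = - \<i> * t" by simp
    have "cos (sgn t * pi / 4) > 0" using t by (cases "t > 0") (auto simp: cos_45)
    thus "0 < Re (complex_of_real (sqrt \<bar>t\<bar>) * cis (- (sgn t * pi / 4))) \<or>
      Re (complex_of_real (sqrt \<bar>t\<bar>) * cis (- (sgn t * pi / 4))) = 0 \<and>
      0 \<le> Im (complex_of_real (sqrt \<bar>t\<bar>) * cis (- (sgn t * pi / 4)))"
      using t by simp
  qed
  have "sqrt pi / csqrt (- \<i> * t) = complex_of_real (sqrt pi * (1 / sqrt \<bar>t\<bar>)) * cis (sgn t * pi / 4)"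
    unfolding c using t by (simp add: field_simps cis_mult)
  hence "(sqrt pi / csqrt (- \<i> * t)) ^ DIM('a) =
      complex_of_real (sqrt pi ^ DIM('a) * (1 / sqrt \<bar>t\<bar>) ^ DIM('a)) * cis (sgn t * pi * real DIM('a) / 4)"
    by (simp only: power_mult_distrib of_real_mult of_real_power Complex.DeMoivre) (simp add: mult_ac)
  also have "sqrt pi ^ DIM('a) = pi powr (real DIM('a) / 2)"
    by (simp add: powr_half_sqrt[symmetric] powr_realpow[symmetric] powr_powr)
  also have "(1 / sqrt \<bar>t\<bar>) ^ DIM('a) = \<bar>t\<bar> powr (- real DIM('a) / 2)"
    using t by (simp add: powr_half_sqrt[symmetric] powr_realpow[symmetric] powr_powr powr_minus_divide power_divide)
  finally have "(sqrt pi / csqrt (- \<i> * t)) ^ DIM('a) = complex_of_real (pi powr (real DIM('a) / 2) *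
      \<bar>t\<bar> powr (- real DIM('a) / 2)) * cis (sgn t * pi * real DIM('a) / 4)" .
  moreover have "- (complex_of_real ((norm x)\<^sup>2) / (4 * (- \<i> * t))) = \<i> * complex_of_real (- ((norm x)\<^sup>2 / (4 * t)))"
    using t by (simp add: divide_simps)
  ultimately show ?thesis
    unfolding schrodinger_kernel_def cis_conv_exp[of "- ((norm x)\<^sup>2 / (4 * t))"] by (simp add: mult_ac)
qed

lemma norm_schrodinger_kernel:
  "norm (schrodinger_kernel t (x :: 'a::euclidean_space)) = pi powr (real DIM('a) / 2) * \<bar>t\<bar> powr (- real DIM('a) / 2)"
  by (simp add: schrodinger_kernel_def norm_mult)

lemma schrodinger_kernel_measurable [measurable]:
  "schrodinger_kernel t \<in> borel_measurable borel"
  unfolding schrodinger_kernel_def[abs_def] by measurable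

text \<open>Both sides are limits of the means damped by a Gaussian factor, for which Fubini applies.\<close>

theorem schrodinger_eq_schrodinger_L1:
  fixes f :: "'a::euclidean_space \<Rightarrow> complex"
  assumes f: "integrable lborel f" and F: "integrable lborel (fourier f)" and t: "t \<noteq> 0"
  shows "schrodinger t f x = schrodinger_L1 t f x"
proof -
  have [measurable]: "f \<in> borel_measurable borel" "fourier f \<in> borel_measurable borel"
    using f F by (auto dest: borel_measurable_integrable)
  \<comment> \<open>Parameters in the open right half-plane tending to -i t; for each of them the
    Gaussian integral converges absolutely.\<close>
  define z where "z = (\<lambda>n::nat. complex_of_real (1 / Suc n) - \<i> * t)"
  have z: "Re (z n) > 0" for n by (simp add: z_def)
  have "(\<lambda>n. complex_of_real (1 / Suc n)) \<longlonglongrightarrow> of_real 0"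
    using LIMSEQ_inverse_real_of_nat by (intro tendsto_of_real) (simp add: divide_inverse)
  from tendsto_diff[OF this tendsto_const[of "\<i> * t"]] have z_lim: "z \<longlonglongrightarrow> - \<i> * t" by (simp add: z_def)
  have t': "- \<i> * t \<notin> \<real>\<^sub>\<le>\<^sub>0" "- \<i> * t \<noteq> 0" using t by (auto simp: complex_nonpos_Reals_iff)
  \<comment> \<open>The imaginary part of \<open>z n\<close> is always - t, so the damped kernels
    are bounded uniformly in n, as dominated convergence requires.\<close>
  have norm_csqrt: "norm (csqrt (z n)) \<ge> sqrt \<bar>t\<bar>" for n
  proof -
    have "\<bar>t\<bar> = \<bar>Im (z n)\<bar>" by (simp add: z_def)
    also have "\<dots> \<le> norm (z n)" by (rule abs_Im_le_cmod)
    finally show ?thesis by (simp add: norm_csqrt)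
  qed
  define K where "K = (\<lambda>(z::complex) y::'a. (sqrt pi / csqrt z) ^ DIM('a) * exp (- ((norm y)\<^sup>2 / (4 * z))))"
  have K_bound: "norm (K (z n) y) \<le> (sqrt pi / sqrt \<bar>t\<bar>) ^ DIM('a)" for n y
  proof -
    have "norm (sqrt pi / csqrt (z n)) \<le> sqrt pi / sqrt \<bar>t\<bar>"
      unfolding norm_divide using norm_csqrt[of n] t by (auto intro!: divide_left_mono mult_pos_pos)
    hence "norm ((sqrt pi / csqrt (z n)) ^ DIM('a)) \<le> (sqrt pi / sqrt \<bar>t\<bar>) ^ DIM('a)"
      unfolding norm_power by (intro power_mono) auto
    moreover have "Re (of_real ((norm y)\<^sup>2) / (4 * z n)) \<ge> 0"
      using z[of n] by (simp add: Re_divide)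
    hence "norm (exp (- (of_real ((norm y)\<^sup>2) / (4 * z n)))) \<le> 1"
      by (simp only: norm_exp_eq_Re uminus_complex.sel exp_le_one_iff)
    ultimately show ?thesis
      unfolding K_def norm_mult using mult_mono[of _ _ _ 1] by fastforce
  qed
  have K_lim: "(\<lambda>n. K (z n) y) \<longlonglongrightarrow> schrodinger_kernel t y" for y
  proof -
    have "(\<lambda>n. csqrt (z n)) \<longlonglongrightarrow> csqrt (- \<i> * t)"
      by (rule isCont_tendsto_compose[OF continuous_at_csqrt[OF t'(1)] z_lim])
    thus ?thesis unfolding K_def schrodinger_kernel_eq[OF t] using z_lim t'(2)
      by (intro tendsto_intros) auto
  qed
  define A where "A = (\<lambda>n. LINT \<xi>|lborel. exp (- z n * (norm \<xi>)\<^sup>2) * cis (\<xi> \<bullet> x) * fourier f \<xi>)"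
  have "A \<longlonglongrightarrow> (LINT \<xi>|lborel. cis (\<xi> \<bullet> x) * cis (t * (norm \<xi>)\<^sup>2) * fourier f \<xi>)"
    unfolding A_def
  proof (rule integral_dominated_convergence[where w = "\<lambda>\<xi>. norm (fourier f \<xi>)"])
    show "AE \<xi> in lborel. norm (exp (- z n * (norm \<xi>)\<^sup>2) * cis (\<xi> \<bullet> x) * fourier f \<xi>) \<le> norm (fourier f \<xi>)" for n
    proof (rule AE_I2)
      fix \<xi> :: 'a
      have "norm (exp (- z n * of_real ((norm \<xi>)\<^sup>2))) \<le> 1"
        using z[of n] by (simp add: norm_exp_eq_Re del: of_real_power)
      thus "norm (exp (- z n * (norm \<xi>)\<^sup>2) * cis (\<xi> \<bullet> x) * fourier f \<xi>) \<le> norm (fourier f \<xi>)"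
        by (simp add: norm_mult mult_left_le_one_le)
    qed
    show "AE \<xi> in lborel. (\<lambda>n. exp (- z n * (norm \<xi>)\<^sup>2) * cis (\<xi> \<bullet> x) * fourier f \<xi>)
        \<longlonglongrightarrow> cis (\<xi> \<bullet> x) * cis (t * (norm \<xi>)\<^sup>2) * fourier f \<xi>"
    proof (rule AE_I2)
      fix \<xi> :: 'a
      have "(\<lambda>n. exp (- z n * (norm \<xi>)\<^sup>2) * cis (\<xi> \<bullet> x) * fourier f \<xi>)
        \<longlonglongrightarrow> exp (- (- \<i> * t) * (norm \<xi>)\<^sup>2) * cis (\<xi> \<bullet> x) * fourier f \<xi>"
        by (intro tendsto_intros z_lim)
      thus "(\<lambda>n. exp (- z n * (norm \<xi>)\<^sup>2) * cis (\<xi> \<bullet> x) * fourier f \<xi>)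
        \<longlonglongrightarrow> cis (\<xi> \<bullet> x) * cis (t * (norm \<xi>)\<^sup>2) * fourier f \<xi>"
        by (simp add: cis_conv_exp mult_ac)
    qed
  qed (use F in auto)
  hence lim1: "A \<longlonglongrightarrow> schrodinger t f x" by (simp add: schrodinger_def)
  have A_eq: "A n = (LINT y|lborel. K (z n) (x - y) * f y)" for n
  proof -
    let ?G = "\<lambda>\<xi>::'a. exp (- z n * (norm \<xi>)\<^sup>2) * cis (\<xi> \<bullet> x)"
    have inner: "(LINT \<xi>|lborel. cis (- (\<xi> \<bullet> y)) * (?G \<xi> * f y)) = K (z n) (x - y) * f y" for y
    proof -
      have "(LINT \<xi>|lborel. cis (- (\<xi> \<bullet> y)) * (?G \<xi> * f y)) =
          (LINT \<xi>|lborel. exp (- z n * (norm \<xi>)\<^sup>2) * cis (\<xi> \<bullet> (x - y)) * f y)"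
        by (rule Bochner_Integration.integral_cong) (simp_all add: inner_diff_right mult_ac cis_mult)
      thus ?thesis using integral_gaussian_euclidean[OF z, of n "x - y"] by (simp add: K_def)
    qed
    have "A n = (LINT \<xi>|lborel. LINT y|lborel. cis (- (\<xi> \<bullet> y)) * (?G \<xi> * f y))"
      unfolding A_def fourier_def
      by (intro Bochner_Integration.integral_cong refl, subst integral_mult_right_zero[symmetric])
        (simp add: mult_ac)
    also have "\<dots> = (LINT y|lborel. LINT \<xi>|lborel. cis (- (\<xi> \<bullet> y)) * (?G \<xi> * f y))"
      by (rule Fubini_bounded_kernel[OF integrable_gaussian_euclidean[OF z] f fourier_kernel_measurable,
            where B = 1, symmetric]) simp
    finally show ?thesis by (simp only: inner)
  qed
  have "(\<lambda>n. LINT y|lborel. K (z n) (x - y) * f y) \<longlonglongrightarrow> (LINT y|lborel. schrodinger_kernel t (x - y) * f y)"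
  proof (rule integral_dominated_convergence[where w = "\<lambda>y. (sqrt pi / sqrt \<bar>t\<bar>) ^ DIM('a) * norm (f y)"])
    show "AE y in lborel. norm (K (z n) (x - y) * f y) \<le> (sqrt pi / sqrt \<bar>t\<bar>) ^ DIM('a) * norm (f y)" for n
      unfolding norm_mult by (intro AE_I2 mult_right_mono K_bound) auto
    show "(\<lambda>y. K (z n) (x - y) * f y) \<in> borel_measurable lborel" for n
      unfolding K_def by measurable
  qed (use f in \<open>auto intro!: tendsto_intros K_lim\<close>)
  hence "A \<longlonglongrightarrow> schrodinger_L1 t f x"
    unfolding schrodinger_L1_def by (simp only: A_eq[symmetric])
  with lim1 show ?thesis by (rule LIMSEQ_unique)
qed


text \<open>Gaussian summability: the damped outer integral is, by Fubini, an average of g around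
  \<eta> against Gaussians that concentrate as the damping is removed. Dominated convergence
  identifies the limits of both expressions.\<close>

theorem fourier_inv_fourier:
  fixes g :: "real \<Rightarrow> complex"
  assumes g: "integrable lborel g" and cont: "continuous_on UNIV g" and bdd: "\<And>x. norm (g x) \<le> M"
    and int: "integrable lborel (inv_fourier g)"
  shows "fourier (inv_fourier g) \<eta> = g \<eta>"
proof -
  have [measurable]: "g \<in> borel_measurable borel" "inv_fourier g \<in> borel_measurable borel"
    using g int by (auto dest: borel_measurable_integrable)
  define e where "e = (\<lambda>n::nat. 1 / real (Suc n))"
  have e: "e n > 0" for n by (simp add: e_def)
  have e_lim: "e \<longlonglongrightarrow> 0" unfolding e_def using LIMSEQ_inverse_real_of_nat by (simp add: divide_inverse)
  define A where "A = (\<lambda>n. LINT x|lborel. gaussian (e n) (- \<eta>) x * inv_fourier g x)"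
  have "A \<longlonglongrightarrow> (LINT x|lborel. cis (- (\<eta> \<bullet> x)) * inv_fourier g x)"
    unfolding A_def
  proof (rule integral_dominated_convergence[where w = "\<lambda>x. norm (inv_fourier g x)"])
    show "AE x in lborel. norm (gaussian (e n) (- \<eta>) x * inv_fourier g x) \<le> norm (inv_fourier g x)" for n
      using e[of n] by (intro AE_I2) (simp add: norm_mult norm_gaussian mult_left_le_one_le)
    show "AE x in lborel. (\<lambda>n. gaussian (e n) (- \<eta>) x * inv_fourier g x) \<longlonglongrightarrow> cis (- (\<eta> \<bullet> x)) * inv_fourier g x"
    proof (rule AE_I2)
      fix x :: real
      have "(\<lambda>n. gaussian (e n) (- \<eta>) x) \<longlonglongrightarrow> exp (- complex_of_real 0 * x\<^sup>2 + \<i> * (- \<eta>) * x)"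
        unfolding gaussian_def by (intro tendsto_intros e_lim)
      thus "(\<lambda>n. gaussian (e n) (- \<eta>) x * inv_fourier g x) \<longlonglongrightarrow> cis (- (\<eta> \<bullet> x)) * inv_fourier g x"
        by (intro tendsto_mult) (simp_all add: cis_conv_exp mult_ac)
    qed
  qed (use int in auto)
  hence lim1: "A \<longlonglongrightarrow> fourier (inv_fourier g) \<eta>" by (simp add: fourier_def)
  \<comment> \<open>Substituting \<xi> = \<eta> + 2 sqrt (e n) u turns the concentrating Gaussian
    into a fixed weight and moves the dependence on n into the argument of g.\<close>
  have A_eq: "A n = 1 / sqrt pi * (LINT u|lborel. g (\<eta> + 2 * sqrt (e n) * u) * complex_of_real (exp (- (u\<^sup>2))))" for n
  proof -
    let ?G = "gaussian (e n) (- \<eta>)"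
    have "A n = 1 / (2 * pi) * (LINT x|lborel. LINT \<xi>|lborel. cis (x \<bullet> \<xi>) * (?G x * g \<xi>))"
    proof -
      have "?G x * inv_fourier g x = 1 / (2 * pi) * (LINT \<xi>|lborel. cis (x \<bullet> \<xi>) * (?G x * g \<xi>))" for x
      proof -
        have "(LINT \<xi>|lborel. cis (x \<bullet> \<xi>) * (?G x * g \<xi>)) = (LINT \<xi>|lborel. ?G x * (cis (\<xi> \<bullet> x) * g \<xi>))"
          by (simp add: mult_ac)
        thus ?thesis by (simp add: inv_fourier_def powr_minus_divide)
      qed
      thus ?thesis unfolding A_def by simp
    qed
    also have "(LINT x|lborel. LINT \<xi>|lborel. cis (x \<bullet> \<xi>) * (?G x * g \<xi>)) =
        (LINT \<xi>|lborel. LINT x|lborel. cis (x \<bullet> \<xi>) * (?G x * g \<xi>))"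
    proof (rule Fubini_bounded_kernel[OF _ g, where B = 1, symmetric])
      show "integrable lborel ?G" using e by (intro gaussian_integrable) simp
      show "(\<lambda>(x :: real, y). cis (x \<bullet> y)) \<in> borel_measurable borel"
        unfolding split_beta by (intro borel_measurable_cis borel_measurable_continuous_onI continuous_intros)
    qed simp
    also have "(\<lambda>\<xi>. LINT x|lborel. cis (x \<bullet> \<xi>) * (?G x * g \<xi>)) = (\<lambda>\<xi>. sqrt pi / sqrt (e n) * exp (- ((\<xi> - \<eta>)\<^sup>2 / (4 * e n))) * g \<xi>)"
    proof
      fix \<xi>
      have "(LINT x|lborel. cis (x \<bullet> \<xi>) * (?G x * g \<xi>)) = (LINT x|lborel. gaussian (e n) (\<xi> - \<eta>) x * g \<xi>)"
        by (rule Bochner_Integration.integral_cong) (auto simp: gaussian_def cis_conv_exp exp_add[symmetric] algebra_simps)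
      also have "\<dots> = sqrt (pi / e n) * exp (- ((\<xi> - \<eta>)\<^sup>2 / (4 * e n))) * g \<xi>"
        using gaussian_integral_real[OF e, of n "\<xi> - \<eta>"] by simp
      finally show "(LINT x|lborel. cis (x \<bullet> \<xi>) * (?G x * g \<xi>)) = sqrt pi / sqrt (e n) * exp (- ((\<xi> - \<eta>)\<^sup>2 / (4 * e n))) * g \<xi>"
        by (simp add: real_sqrt_divide)
    qed
    also have "(LINT \<xi>|lborel. sqrt pi / sqrt (e n) * exp (- ((\<xi> - \<eta>)\<^sup>2 / (4 * e n))) * g \<xi>) =
        \<bar>2 * sqrt (e n)\<bar> *\<^sub>R (LINT u|lborel. sqrt pi / sqrt (e n) * exp (- ((\<eta> + 2 * sqrt (e n) * u - \<eta>)\<^sup>2 / (4 * e n))) * g (\<eta> + 2 * sqrt (e n) * u))"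
      using e[of n] by (intro lborel_integral_real_affine) auto
    also have "(\<lambda>u. sqrt pi / sqrt (e n) * exp (- ((\<eta> + 2 * sqrt (e n) * u - \<eta>)\<^sup>2 / (4 * e n))) * g (\<eta> + 2 * sqrt (e n) * u))
        = (\<lambda>u. of_real (sqrt pi / sqrt (e n)) * (g (\<eta> + 2 * sqrt (e n) * u) * complex_of_real (exp (- (u\<^sup>2)))))"
      using e[of n] by (simp add: power_mult_distrib mult_ac less_imp_le)
    also have "1 / (2 * pi) * (\<bar>2 * sqrt (e n)\<bar> *\<^sub>R (LINT u|lborel. of_real (sqrt pi / sqrt (e n)) * (g (\<eta> + 2 * sqrt (e n) * u) * complex_of_real (exp (- (u\<^sup>2)))))) =
        of_real (1 / (2 * pi) * (2 * sqrt (e n)) * (sqrt pi / sqrt (e n))) * (LINT u|lborel. g (\<eta> + 2 * sqrt (e n) * u) * complex_of_real (exp (- (u\<^sup>2))))"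
      using e[of n] by (simp add: scaleR_conv_of_real)
    also have "1 / (2 * pi) * (2 * sqrt (e n)) * (sqrt pi / sqrt (e n)) = 1 / sqrt pi"
      using e[of n] by (simp add: field_simps)
    finally show ?thesis by simp
  qed
  have "(\<lambda>n. LINT u|lborel. g (\<eta> + 2 * sqrt (e n) * u) * complex_of_real (exp (- (u\<^sup>2)))) \<longlonglongrightarrow> (LINT u|lborel. g \<eta> * complex_of_real (exp (- (u\<^sup>2))))"
  proof (rule integral_dominated_convergence[where w = "\<lambda>u. M * norm (gaussian 1 0 u)"])
    show "integrable lborel (\<lambda>u. M * norm (gaussian 1 0 u))"
      using gaussian_integrable(1)[of 1 0] by auto
    show "AE u in lborel. norm (g (\<eta> + 2 * sqrt (e n) * u) * complex_of_real (exp (- (u\<^sup>2)))) \<le> M * norm (gaussian 1 0 u)" for n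
      using bdd by (intro AE_I2) (simp add: norm_mult norm_gaussian mult_right_mono)
    show "AE u in lborel. (\<lambda>n. g (\<eta> + 2 * sqrt (e n) * u) * complex_of_real (exp (- (u\<^sup>2)))) \<longlonglongrightarrow> g \<eta> * complex_of_real (exp (- (u\<^sup>2)))"
    proof (rule AE_I2)
      fix u :: real
      have "(\<lambda>n. \<eta> + 2 * sqrt (e n) * u) \<longlonglongrightarrow> \<eta> + 2 * sqrt 0 * u"
        by (intro tendsto_intros e_lim)
      hence "(\<lambda>n. g (\<eta> + 2 * sqrt (e n) * u)) \<longlonglongrightarrow> g \<eta>"
        using cont by (intro isCont_tendsto_compose[of _ g]) (auto simp: continuous_on_eq_continuous_at)
      thus "(\<lambda>n. g (\<eta> + 2 * sqrt (e n) * u) * complex_of_real (exp (- (u\<^sup>2)))) \<longlonglongrightarrow> g \<eta> * complex_of_real (exp (- (u\<^sup>2)))"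
        by (intro tendsto_intros)
    qed
  qed auto
  from tendsto_mult[OF tendsto_const[of "complex_of_real (1 / sqrt pi)"] this]
  have lim2: "A \<longlonglongrightarrow> 1 / sqrt pi * (LINT u|lborel. g \<eta> * complex_of_real (exp (- (u\<^sup>2))))"
    by (simp only: A_eq[symmetric])
  have "(LINT u|lborel. g \<eta> * complex_of_real (exp (- (u\<^sup>2)))) = (LINT u|lborel. gaussian (of_real 1) 0 u * g \<eta>)"
    by (rule Bochner_Integration.integral_cong) (auto simp: gaussian_def exp_of_real[symmetric])
  also have "\<dots> = sqrt pi * g \<eta>"
    using gaussian_integral_real[of 1 0] by simp
  finally have I: "(LINT u|lborel. g \<eta> * complex_of_real (exp (- (u\<^sup>2)))) = sqrt pi * g \<eta>" .
  have "1 / sqrt pi * (LINT u|lborel. g \<eta> * complex_of_real (exp (- (u\<^sup>2)))) = g \<eta>"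
    unfolding I by simp
  with lim1 lim2 show ?thesis by (metis LIMSEQ_unique)
qed

section \<open>Schroedinger means of square integrable functions\<close>

text \<open>Boxes form an intersection-stable generator of the Borel sets, so vanishing integrals
  over boxes propagate to all Borel sets.\<close>

lemma AE_eq_0_if_integral_box_eq_0:
  fixes f :: "'a::euclidean_space \<Rightarrow> complex"
  assumes int: "\<And>a b. integrable lborel (\<lambda>x. indicat_real (box a b) x *\<^sub>R f x)"
    and zero: "\<And>a b. (LINT x|lborel. indicat_real (box a b) x *\<^sub>R f x) = 0"
  shows "AE x in lborel. f x = 0"
proof -
  \<comment> \<open>The hypothesis is only local integrability, so f is cut off to each of countably
    many boxes exhausting the space.\<close>
  have "AE x in lborel. indicat_real (box (- real N *\<^sub>R One) (real N *\<^sub>R One)) x *\<^sub>R f x = 0" for N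
  proof (rule sigma_finite_measure.density_zero[OF sigma_finite_lborel int])
    let ?B = "box (- real N *\<^sub>R One) (real N *\<^sub>R One :: 'a)"
    let ?f = "\<lambda>x. indicat_real ?B x *\<^sub>R f x"
    have box: "(LINT x:box a b|lborel. ?f x) = 0" for a b
      using zero unfolding set_lebesgue_integral_def scaleR_scaleR indicator_inter_arith[symmetric] box_Int_box
      by simp
    fix A :: "'a set" assume "A \<in> sets lborel"
    hence A: "A \<in> sigma_sets UNIV (range (\<lambda>(a, b). box a b))" by (simp add: borel_eq_box)
    have "Int_stable (range (\<lambda>(a, b). box a b :: 'a set))"
      by (auto simp: Int_stable_def box_Int_box)
    moreover have "range (\<lambda>(a, b). box a b :: 'a set) \<subseteq> Pow UNIV" by simp
    ultimately show "(LINT x:A|lborel. ?f x) = 0" using A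
    proof (induction rule: sigma_sets_induct_disjoint)
      case (basic A)
      then obtain a b where "A = box a b" by auto
      thus ?case using box by simp
    next
      case (compl A)
      hence A: "A \<in> sets lborel" by (simp add: borel_eq_box)
      have "(LINT x:UNIV - A|lborel. ?f x) = (LINT x|lborel. ?f x - indicat_real A x *\<^sub>R ?f x)"
        unfolding set_lebesgue_integral_def
        by (intro Bochner_Integration.integral_cong) (auto simp: indicator_def)
      also have "\<dots> = (LINT x|lborel. ?f x) - (LINT x:A|lborel. ?f x)"
        unfolding set_lebesgue_integral_def
        by (intro Bochner_Integration.integral_diff int integrable_mult_indicator A)
      also have "\<dots> = 0" using zero compl by simp
      finally show ?case .
    next
      case (union A)
      hence "A i \<in> sets lborel" for i by (auto simp: borel_eq_box)
      moreover from this have "set_integrable lborel (\<Union>i. A i) ?f"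
        unfolding set_integrable_def by (intro integrable_mult_indicator int) auto
      ultimately have "(LINT x:(\<Union>i. A i)|lborel. ?f x) = (\<Sum>i. LINT x:A i|lborel. ?f x)"
        using union by (intro lebesgue_integral_countable_add) (auto simp: disjoint_family_on_def)
      thus ?case using union by simp
    qed (auto simp: set_lebesgue_integral_def)
  qed
  hence "AE x in lborel. \<forall>N. indicat_real (box (- real N *\<^sub>R One) (real N *\<^sub>R One)) x *\<^sub>R f x = 0"
    unfolding AE_all_countable by blast
  thus ?thesis
  proof eventually_elim
    case (elim x)
    obtain N :: nat where N: "norm x < real N" using reals_Archimedean2 by blast
    have "x \<in> box (- real N *\<^sub>R One) (real N *\<^sub>R One)"
    proof -
      have "\<bar>x \<bullet> b\<bar> < real N" if "b \<in> Basis" for b using Basis_le_norm[OF that, of x] N by simp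
      thus ?thesis by (auto simp: box_def abs_less_iff) (metis minus_less_iff)
    qed
    with elim show ?case by (metis indicator_simps(1) scaleR_one)
  qed
qed

text \<open>Cauchy-Schwarz applied to the difference. It is carried out in \<open>ennreal\<close>
  because the members of the sequence may fail to be square integrable; this is also why the
  products are assumed integrable separately.\<close>

lemma L2_tendsto_pairing:
  fixes F :: "nat \<Rightarrow> 'a::euclidean_space \<Rightarrow> complex"
  assumes lim: "L2_tendsto F f"
    and [measurable]: "\<And>j. F j \<in> borel_measurable borel" "f \<in> borel_measurable borel" "\<Theta> \<in> borel_measurable borel"
    and \<Theta>: "integrable lborel (\<lambda>x. (norm (\<Theta> x))\<^sup>2)"
    and int: "\<And>j. integrable lborel (\<lambda>x. F j x * \<Theta> x)" "integrable lborel (\<lambda>x. f x * \<Theta> x)"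
  shows "(\<lambda>j. LINT x|lborel. F j x * \<Theta> x) \<longlonglongrightarrow> (LINT x|lborel. f x * \<Theta> x)"
proof -
  define d where "d = (\<lambda>j. norm ((LINT x|lborel. F j x * \<Theta> x) - (LINT x|lborel. f x * \<Theta> x)))"
  let ?e = "\<lambda>j. \<integral>\<^sup>+x. ennreal ((cmod (F j x - f x))\<^sup>2) \<partial>lborel"
  let ?C = "\<integral>\<^sup>+x. ennreal ((cmod (\<Theta> x))\<^sup>2) \<partial>lborel"
  have C: "?C < \<infinity>" using \<Theta> by (simp add: integrable_iff_bounded)
  have le: "ennreal ((d j)\<^sup>2) \<le> ?C * ?e j" for j
  proof -
    have "ennreal (d j) = ennreal (norm (LINT x|lborel. (F j x - f x) * \<Theta> x))"
      unfolding d_def using int by (simp add: left_diff_distrib)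
    also have "\<dots> \<le> (\<integral>\<^sup>+x. ennreal (norm ((F j x - f x) * \<Theta> x)) \<partial>lborel)"
    proof (rule integral_norm_bound_ennreal)
      show "integrable lborel (\<lambda>x. (F j x - f x) * \<Theta> x)"
        unfolding left_diff_distrib by (intro Bochner_Integration.integrable_diff int)
    qed
    also have "\<dots> = (\<integral>\<^sup>+x. ennreal (norm (F j x - f x)) * ennreal (norm (\<Theta> x)) \<partial>lborel)"
      by (simp add: norm_mult ennreal_mult)
    finally have "(ennreal (d j))\<^sup>2 \<le> (\<integral>\<^sup>+x. ennreal (norm (F j x - f x)) * ennreal (norm (\<Theta> x)) \<partial>lborel)\<^sup>2"
      by (intro power_mono) auto
    also have "\<dots> \<le> (\<integral>\<^sup>+x. (ennreal (norm (F j x - f x)))\<^sup>2 \<partial>lborel) * (\<integral>\<^sup>+x. (ennreal (norm (\<Theta> x)))\<^sup>2 \<partial>lborel)"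
      by (intro Cauchy_Schwarz_nn_integral) auto
    finally show ?thesis by (simp add: ennreal_power d_def mult.commute)
  qed
  have "(\<lambda>j. ?C * ?e j) \<longlonglongrightarrow> ?C * 0"
    using lim C unfolding L2_tendsto_def by (intro ennreal_tendsto_cmult) auto
  hence up: "(\<lambda>j. ?C * ?e j) \<longlonglongrightarrow> 0" by simp
  have "(\<lambda>j. ennreal ((d j)\<^sup>2)) \<longlonglongrightarrow> 0"
  proof (rule tendsto_sandwich[OF _ _ tendsto_const up])
    show "\<forall>\<^sub>F j in sequentially. 0 \<le> ennreal ((d j)\<^sup>2)" by simp
    show "\<forall>\<^sub>F j in sequentially. ennreal ((d j)\<^sup>2) \<le> ?C * ?e j" by (rule always_eventually) (rule allI, rule le)
  qed
  hence "(\<lambda>j. (d j)\<^sup>2) \<longlonglongrightarrow> 0"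
    using tendsto_ennreal_iff[of "\<lambda>j. (d j)\<^sup>2" sequentially 0] by simp
  hence "(\<lambda>j. sqrt ((d j)\<^sup>2)) \<longlonglongrightarrow> sqrt 0" by (rule tendsto_real_sqrt)
  hence "d \<longlonglongrightarrow> 0" by (simp add: d_def)
  thus ?thesis unfolding d_def by (simp add: tendsto_norm_zero_iff LIM_zero_iff)
qed

text \<open>The modulus is at most the length of the interval, and at most 2 / |\<eta>| by the
  antiderivative. Adding the squares of both bounds in suitable form gives a majorant integrable in
  \<eta>.\<close>

lemma norm_integral_cis_interval_le:
  "(norm (LINT x|lborel. indicator {\<alpha><..<\<beta>} x * cis (x * \<eta>)))\<^sup>2 \<le> ((\<beta> - \<alpha>)\<^sup>2 + 4) * (1 / (1 + \<eta>\<^sup>2))"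
proof (cases "\<alpha> < \<beta>")
  case False
  thus ?thesis by (simp add: add_nonneg_nonneg)
next
  case True
  let ?I = "LINT x|lborel. indicator {\<alpha><..<\<beta>} x * cis (x * \<eta>)"
  \<comment> \<open>The closed interval required by the fundamental theorem of calculus differs from
    the open one by two points.\<close>
  have I: "?I = (LINT x|lborel. indicat_real {\<alpha>..\<beta>} x *\<^sub>R cis (x * \<eta>))"
    using AE_lborel_singleton[of \<alpha>] AE_lborel_singleton[of \<beta>]
    by (intro integral_cong_AE) (auto simp: indicator_def)
  have "norm ?I \<le> (LINT x|lborel. norm (indicat_real {\<alpha>..\<beta>} x *\<^sub>R cis (x * \<eta>)))"
    unfolding I by (rule integral_norm_bound)
  also have "\<dots> = \<beta> - \<alpha>" using True by simp
  finally have 1: "(norm ?I)\<^sup>2 \<le> (\<beta> - \<alpha>)\<^sup>2" by (intro power_mono) auto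
  have 2: "\<eta>\<^sup>2 * (norm ?I)\<^sup>2 \<le> 4"
  proof (cases "\<eta> = 0")
    case False
    have "(LINT x|lborel. indicat_real {\<alpha>..\<beta>} x *\<^sub>R cis (x * \<eta>)) = cis (\<beta> * \<eta>) / (\<i> * \<eta>) - cis (\<alpha> * \<eta>) / (\<i> * \<eta>)"
    proof (rule integral_FTC_Icc)
      fix x assume "\<alpha> \<le> x" "x \<le> \<beta>"
      have "((\<lambda>w. exp (\<i> * (w * \<eta>)) / (\<i> * \<eta>)) has_field_derivative cis (x * \<eta>)) (at (complex_of_real x))"
        using False by (auto intro!: derivative_eq_intros simp: cis_conv_exp mult_ac)
      from has_vector_derivative_real_field[OF this]
      show "((\<lambda>x. cis (x * \<eta>) / (\<i> * \<eta>)) has_vector_derivative cis (x * \<eta>)) (at x within {\<alpha>..\<beta>})"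
        by (simp add: cis_conv_exp)
    qed (use True in \<open>auto intro!: continuous_intros simp: cis_conv_exp\<close>)
    hence "\<i> * \<eta> * ?I = cis (\<beta> * \<eta>) - cis (\<alpha> * \<eta>)" unfolding I using False by (simp add: field_simps)
    hence "norm (\<i> * \<eta> * ?I) \<le> 1 + 1" by (metis norm_triangle_le_diff norm_cis add_mono order_refl)
    hence "\<bar>\<eta>\<bar> * norm ?I \<le> 2" by (simp add: norm_mult)
    hence "(\<bar>\<eta>\<bar> * norm ?I)\<^sup>2 \<le> 2\<^sup>2" by (intro power_mono) auto
    thus ?thesis by (simp add: power_mult_distrib)
  qed auto
  have "(norm ?I)\<^sup>2 * (1 + \<eta>\<^sup>2) \<le> (\<beta> - \<alpha>)\<^sup>2 + 4" using 1 2 by (simp add: algebra_simps)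
  thus ?thesis by (simp add: pos_le_divide_eq add_pos_nonneg)
qed

section \<open>The mean as a convolution: bounds, continuity in time, duality\<close>

lemma schrodinger_L1_measurable:
  assumes "integrable lborel f"
  shows "schrodinger_L1 t f \<in> borel_measurable borel"
proof -
  have [measurable]: "f \<in> borel_measurable borel" using assms by (auto dest: borel_measurable_integrable)
  have "(\<lambda>x. LINT y|lborel. schrodinger_kernel t (x - y) * f y) \<in> borel_measurable lborel"
    by (rule lborel.borel_measurable_lebesgue_integral) measurable
  thus ?thesis by (simp add: schrodinger_L1_def[abs_def])
qed

lemma norm_schrodinger_L1_le:
  fixes f :: "'a::euclidean_space \<Rightarrow> complex"
  shows "norm (schrodinger_L1 t f x) \<le>
    pi powr (real DIM('a) / 2) * \<bar>t\<bar> powr (- real DIM('a) / 2) * (LINT y|lborel. norm (f y))"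
proof -
  have "norm (schrodinger_L1 t f x) \<le> (LINT y|lborel. norm (schrodinger_kernel t (x - y) * f y))"
    unfolding schrodinger_L1_def by (rule integral_norm_bound)
  thus ?thesis by (simp add: norm_mult norm_schrodinger_kernel)
qed

lemma isCont_schrodinger_L1:
  fixes f :: "'a::euclidean_space \<Rightarrow> complex"
  assumes f: "integrable lborel f" and t: "t \<noteq> 0"
  shows "isCont (\<lambda>t. schrodinger_L1 t f x) t"
  unfolding continuous_within tendsto_at_iff_sequentially
proof (intro allI impI)
  fix X :: "nat \<Rightarrow> real" assume "X \<longlonglongrightarrow> t"
  have [measurable]: "f \<in> borel_measurable borel" using f by (auto dest: borel_measurable_integrable)
  \<comment> \<open>The kernel blows up at time 0, so an initial segment is dropped to keep the
    times at distance at least |t| / 2 from it.\<close>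
  obtain N where N: "\<And>n. n \<ge> N \<Longrightarrow> norm (X n - t) < \<bar>t\<bar> / 2"
    using LIMSEQ_D[OF \<open>X \<longlonglongrightarrow> t\<close>, of "\<bar>t\<bar> / 2"] t by auto
  define Y where "Y = (\<lambda>n. X (n + N))"
  have Y: "\<bar>Y n\<bar> \<ge> \<bar>t\<bar> / 2" "Y n \<noteq> 0" for n
  proof -
    show "\<bar>Y n\<bar> \<ge> \<bar>t\<bar> / 2" using N[of "n + N"] unfolding Y_def real_norm_def by linarith
    thus "Y n \<noteq> 0" using t by auto
  qed
  have Y_lim: "Y \<longlonglongrightarrow> t" unfolding Y_def by (rule LIMSEQ_ignore_initial_segment[OF \<open>X \<longlonglongrightarrow> t\<close>])
  let ?B = "pi powr (real DIM('a) / 2) * (\<bar>t\<bar> / 2) powr (- real DIM('a) / 2)"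
  have "(\<lambda>n. LINT y|lborel. schrodinger_kernel (Y n) (x - y) * f y) \<longlonglongrightarrow> (LINT y|lborel. schrodinger_kernel t (x - y) * f y)"
  proof (rule integral_dominated_convergence[where w = "\<lambda>y. ?B * norm (f y)"])
    show "AE y in lborel. norm (schrodinger_kernel (Y n) (x - y) * f y) \<le> ?B * norm (f y)" for n
    proof (rule AE_I2)
      fix y
      have "norm (schrodinger_kernel (Y n) (x - y)) \<le> ?B"
        unfolding norm_schrodinger_kernel using Y[of n] t by (intro mult_left_mono powr_mono2') auto
      thus "norm (schrodinger_kernel (Y n) (x - y) * f y) \<le> ?B * norm (f y)"
        unfolding norm_mult by (rule mult_right_mono) simp
    qed
    show "AE y in lborel. (\<lambda>n. schrodinger_kernel (Y n) (x - y) * f y) \<longlonglongrightarrow> schrodinger_kernel t (x - y) * f y"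
    proof (intro AE_I2 tendsto_mult tendsto_const)
      fix y
      have t': "- \<i> * t \<notin> \<real>\<^sub>\<le>\<^sub>0" "- \<i> * t \<noteq> 0" using t by (auto simp: complex_nonpos_Reals_iff)
      have z_lim: "(\<lambda>n. - \<i> * complex_of_real (Y n)) \<longlonglongrightarrow> - \<i> * t" by (intro tendsto_intros Y_lim)
      have "(\<lambda>n. csqrt (- \<i> * Y n)) \<longlonglongrightarrow> csqrt (- \<i> * t)"
        by (rule isCont_tendsto_compose[OF continuous_at_csqrt[OF t'(1)] z_lim])
      thus "(\<lambda>n. schrodinger_kernel (Y n) (x - y)) \<longlonglongrightarrow> schrodinger_kernel t (x - y)"
        unfolding schrodinger_kernel_eq[OF t] schrodinger_kernel_eq[OF Y(2)]
        using t'(2) by (intro tendsto_intros z_lim Y_lim) auto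
    qed
  qed (use f in auto)
  hence "(\<lambda>n. schrodinger_L1 (X (n + N)) f x) \<longlonglongrightarrow> schrodinger_L1 t f x"
    by (simp add: schrodinger_L1_def Y_def)
  thus "((\<lambda>t. schrodinger_L1 t f x) \<circ> X) \<longlonglongrightarrow> schrodinger_L1 t f x"
    unfolding o_def by (rule LIMSEQ_offset)
qed

text \<open>The chirp \<open>cis ((norm x)\<^sup>2 / (4 * t))\<close> cancels the quadratic phase of the kernel, so the
  mean of the chirped indicator of a box is, up to a factor, a product of sinc functions.\<close>

lemma chirped_box_mean_le_decay:
  fixes a b :: "'a::euclidean_space"
  assumes t: "t \<noteq> 0"
  obtains C where "\<And>y. (norm (LINT x|lborel. schrodinger_kernel t (x - y) *
      (indicator (box a b) x * cis ((norm x)\<^sup>2 / (4 * t)))))\<^sup>2 \<le> C * decay y"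
proof -
  define k where "k = complex_of_real (pi powr (real DIM('a) / 2)) * cis (sgn t * pi * real DIM('a) / 4) *
     complex_of_real (\<bar>t\<bar> powr (- real DIM('a) / 2))"
  define C where "C = (\<Prod>i\<in>(Basis::'a set). (((b \<bullet> i - a \<bullet> i)\<^sup>2 + 4) * (1 + 4 * t\<^sup>2)))"
  have "(norm (LINT x|lborel. schrodinger_kernel t (x - y) *
      (indicator (box a b) x * cis ((norm x)\<^sup>2 / (4 * t)))))\<^sup>2 \<le> (norm k)\<^sup>2 * C * decay y" for y
  proof -
    \<comment> \<open>The frequency that remains in x once the chirp has cancelled the term
      quadratic in x.\<close>
    define \<eta> where "\<eta> = y /\<^sub>R (2 * t)"
    have phase: "cis (- ((norm (x - y))\<^sup>2 / (4 * t))) * cis ((norm x)\<^sup>2 / (4 * t)) =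
        cis (- ((norm y)\<^sup>2 / (4 * t))) * cis (x \<bullet> \<eta>)" for x
    proof -
      have "(norm (x - y))\<^sup>2 = (norm x)\<^sup>2 - 2 * (x \<bullet> y) + (norm y)\<^sup>2"
        by (simp add: power2_norm_eq_inner inner_diff inner_commute)
      hence "- ((norm (x - y))\<^sup>2 / (4 * t)) + (norm x)\<^sup>2 / (4 * t) = - ((norm y)\<^sup>2 / (4 * t)) + x \<bullet> \<eta>"
        using t by (simp add: \<eta>_def field_simps)
      thus ?thesis by (simp add: cis_mult)
    qed
    have ind: "indicator (box a b) x = (\<Prod>i\<in>Basis. indicator {a \<bullet> i<..<b \<bullet> i} (x \<bullet> i) :: complex)" for x
      by (auto simp: indicator_def box_def)
    have cs: "cis (x \<bullet> \<eta>) = (\<Prod>i\<in>Basis. cis ((x \<bullet> i) * (\<eta> \<bullet> i)))" for x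
      by (subst euclidean_inner) (simp add: cis_conv_exp exp_sum sum_distrib_left)
    have "(LINT x|lborel. schrodinger_kernel t (x - y) * (indicator (box a b) x * cis ((norm x)\<^sup>2 / (4 * t)))) =
        (LINT x|lborel. k * cis (- ((norm y)\<^sup>2 / (4 * t))) *
          (\<Prod>i\<in>Basis. indicator {a \<bullet> i<..<b \<bullet> i} (x \<bullet> i) * cis ((x \<bullet> i) * (\<eta> \<bullet> i))))"
    proof (rule Bochner_Integration.integral_cong[OF refl])
      fix x
      have "schrodinger_kernel t (x - y) * (indicator (box a b) x * cis ((norm x)\<^sup>2 / (4 * t))) =
        k * (cis (- ((norm (x - y))\<^sup>2 / (4 * t))) * cis ((norm x)\<^sup>2 / (4 * t))) * indicator (box a b) x"
        by (simp add: schrodinger_kernel_def k_def mult_ac)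
      thus "schrodinger_kernel t (x - y) * (indicator (box a b) x * cis ((norm x)\<^sup>2 / (4 * t))) =
        k * cis (- ((norm y)\<^sup>2 / (4 * t))) *
          (\<Prod>i\<in>Basis. indicator {a \<bullet> i<..<b \<bullet> i} (x \<bullet> i) * cis ((x \<bullet> i) * (\<eta> \<bullet> i)))"
        unfolding phase by (simp add: prod.distrib ind cs mult_ac)
    qed
    also have "\<dots> = k * cis (- ((norm y)\<^sup>2 / (4 * t))) *
        (\<Prod>i\<in>Basis. LINT x|lborel. indicator {a \<bullet> i<..<b \<bullet> i} x * cis (x * (\<eta> \<bullet> i)))"
    proof (subst integral_mult_right_zero, subst integral_prod_lborel)
      fix i :: 'a
      have "integrable lborel (indicat_real {a \<bullet> i<..<b \<bullet> i})"
        using emeasure_lborel_box_finite[of "a \<bullet> i" "b \<bullet> i"]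
        by (intro integrable_real_indicator) (auto simp: box_real)
      thus "integrable lborel (\<lambda>x. indicator {a \<bullet> i<..<b \<bullet> i} x * cis (x * (\<eta> \<bullet> i)))"
        by (rule Bochner_Integration.integrable_bound) (auto simp: norm_mult indicator_def)
    qed auto
    finally have "(norm (LINT x|lborel. schrodinger_kernel t (x - y) *
        (indicator (box a b) x * cis ((norm x)\<^sup>2 / (4 * t)))))\<^sup>2 =
      (norm k)\<^sup>2 * (\<Prod>i\<in>Basis. (norm (LINT x|lborel. indicator {a \<bullet> i<..<b \<bullet> i} x * cis (x * (\<eta> \<bullet> i))))\<^sup>2)"
      by (simp add: norm_mult prod_norm[symmetric] power_mult_distrib prod_power_distrib)
    also have "\<dots> \<le> (norm k)\<^sup>2 * (\<Prod>i\<in>Basis. (((b \<bullet> i - a \<bullet> i)\<^sup>2 + 4) * (1 + 4 * t\<^sup>2)) * (1 / (1 + (y \<bullet> i)\<^sup>2)))"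
    proof (intro mult_left_mono prod_mono conjI)
      fix i :: 'a
      \<comment> \<open>Passing from \<eta> back to y = 2 t \<eta> costs the factor 1 + 4 t^2 in
        each coordinate.\<close>
      have "1 / (1 + (\<eta> \<bullet> i)\<^sup>2) \<le> (1 + 4 * t\<^sup>2) * (1 / (1 + (y \<bullet> i)\<^sup>2))"
      proof -
        have "(y \<bullet> i)\<^sup>2 = 4 * t\<^sup>2 * (\<eta> \<bullet> i)\<^sup>2"
          using t by (simp add: \<eta>_def power_mult_distrib field_simps)
        hence "1 + (y \<bullet> i)\<^sup>2 \<le> (1 + 4 * t\<^sup>2) * (1 + (\<eta> \<bullet> i)\<^sup>2)" by (simp add: algebra_simps)
        thus ?thesis by (simp add: field_simps add_pos_nonneg)
      qed
      hence "((b \<bullet> i - a \<bullet> i)\<^sup>2 + 4) * (1 / (1 + (\<eta> \<bullet> i)\<^sup>2)) \<le> ((b \<bullet> i - a \<bullet> i)\<^sup>2 + 4) * ((1 + 4 * t\<^sup>2) * (1 / (1 + (y \<bullet> i)\<^sup>2)))"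
        by (intro mult_left_mono) auto
      thus "(norm (LINT x|lborel. indicator {a \<bullet> i<..<b \<bullet> i} x * cis (x * (\<eta> \<bullet> i))))\<^sup>2
          \<le> (((b \<bullet> i - a \<bullet> i)\<^sup>2 + 4) * (1 + 4 * t\<^sup>2)) * (1 / (1 + (y \<bullet> i)\<^sup>2))"
        using norm_integral_cis_interval_le[of "a \<bullet> i" "b \<bullet> i" "\<eta> \<bullet> i"] by (simp only: mult.assoc)
    qed auto
    also have "\<dots> = (norm k)\<^sup>2 * C * decay y"
      unfolding prod.distrib C_def decay_def by simp
    finally show ?thesis .
  qed
  thus ?thesis using that by blast
qed

lemma integrable_mult_of_square_integrable:
  fixes f g :: "'a \<Rightarrow> complex"
  assumes [measurable]: "f \<in> borel_measurable M" "g \<in> borel_measurable M"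
    and f: "integrable M (\<lambda>x. (norm (f x))\<^sup>2)" and g: "integrable M (\<lambda>x. (norm (g x))\<^sup>2)"
  shows "integrable M (\<lambda>x. f x * g x)"
proof (rule Bochner_Integration.integrable_bound)
  show "integrable M (\<lambda>x. (norm (f x))\<^sup>2 + (norm (g x))\<^sup>2)" by (intro Bochner_Integration.integrable_add f g)
  show "AE x in M. norm (f x * g x) \<le> norm ((norm (f x))\<^sup>2 + (norm (g x))\<^sup>2)"
  proof (rule AE_I2)
    fix x
    have "0 \<le> (norm (f x) - norm (g x))\<^sup>2" by simp
    hence "2 * (norm (f x) * norm (g x)) \<le> (norm (f x))\<^sup>2 + (norm (g x))\<^sup>2"
      unfolding power2_diff by simp
    moreover have "0 \<le> norm (f x) * norm (g x)" by simp
    ultimately have "norm (f x) * norm (g x) \<le> (norm (f x))\<^sup>2 + (norm (g x))\<^sup>2" by linarith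
    thus "norm (f x * g x) \<le> norm ((norm (f x))\<^sup>2 + (norm (g x))\<^sup>2)" by (simp add: norm_mult)
  qed
qed measurable

lemma integrable_bounded_mult:
  fixes f g :: "'a \<Rightarrow> complex"
  assumes "integrable M f" "g \<in> borel_measurable M" "\<And>x. norm (g x) \<le> B"
  shows "integrable M (\<lambda>x. g x * f x)" "integrable M (\<lambda>x. f x * g x)"
proof -
  show 1: "integrable M (\<lambda>x. g x * f x)"
  proof (rule Bochner_Integration.integrable_bound)
    show "integrable M (\<lambda>x. B * norm (f x))" using assms by auto
    show "(\<lambda>x. g x * f x) \<in> borel_measurable M" using assms by auto
    show "AE x in M. norm (g x * f x) \<le> norm (B * norm (f x))"
    proof (rule AE_I2)
      fix x
      have "norm (g x) \<le> \<bar>B\<bar>" using assms(3)[of x] by simp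
      thus "norm (g x * f x) \<le> norm (B * norm (f x))" by (simp add: norm_mult abs_mult mult_right_mono)
    qed
  qed
  thus "integrable M (\<lambda>x. f x * g x)" by (simp add: mult.commute)
qed

text \<open>Moves the mean onto the test function, where a chirped box makes it square
  integrable.\<close>

lemma schrodinger_L1_transpose:
  fixes f \<theta> :: "'a::euclidean_space \<Rightarrow> complex"
  assumes "integrable lborel f" "integrable lborel \<theta>"
  shows "(LINT x|lborel. schrodinger_L1 t f x * \<theta> x) =
    (LINT y|lborel. f y * (LINT x|lborel. schrodinger_kernel t (x - y) * \<theta> x))"
proof -
  have "(LINT x|lborel. LINT y|lborel. schrodinger_kernel t (x - y) * (f y * \<theta> x)) =
      (LINT y|lborel. LINT x|lborel. schrodinger_kernel t (x - y) * (f y * \<theta> x))"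
  proof (rule Fubini_bounded_kernel[OF assms])
    show "(\<lambda>(y, x). schrodinger_kernel t (x - y)) \<in> borel_measurable (borel :: ('a \<times> 'a) measure)"
      unfolding borel_prod[symmetric] by measurable
    show "norm (schrodinger_kernel t (x - y)) \<le> pi powr (real DIM('a) / 2) * \<bar>t\<bar> powr (- real DIM('a) / 2)" for x y :: 'a
      by (simp add: norm_schrodinger_kernel)
  qed
  moreover have "(LINT y|lborel. schrodinger_kernel t (x - y) * (f y * \<theta> x)) = schrodinger_L1 t f x * \<theta> x" for x
    by (simp add: schrodinger_L1_def mult.assoc flip: integral_mult_left_zero)
  moreover have "(LINT x|lborel. schrodinger_kernel t (x - y) * (f y * \<theta> x)) =
      f y * (LINT x|lborel. schrodinger_kernel t (x - y) * \<theta> x)" for y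
    by (simp add: mult.left_commute[of _ "f y"])
  ultimately show ?thesis by simp
qed

text \<open>Let \<theta> be a chirped box and \<Theta> its transposed mean. For the Schwartz
  approximants, pairing the mean with \<theta> equals pairing the function with \<Theta>. The left
  side converges through the \<open>L^2\<close> limit u, the right side through the
  \<open>L^2\<close> limit f; transposing back for the integrable f identifies u with the
  convolution.\<close>

theorem schrodinger_L2_eq_schrodinger_L1:
  fixes f u :: "'a::euclidean_space \<Rightarrow> complex"
  assumes u: "schrodinger_L2 t f u" and f: "integrable lborel f" and t: "t \<noteq> 0"
  shows "AE x in lborel. u x = schrodinger_L1 t f x"
proof -
  obtain \<phi> where \<phi>: "\<And>j. schwartz (\<phi> j)" "L2_tendsto \<phi> f" "L2_tendsto (\<lambda>j. schrodinger t (\<phi> j)) u"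
    using u by (auto simp: schrodinger_L2_def)
  have f2: "integrable lborel (\<lambda>x. (norm (f x))\<^sup>2)" and u2: "integrable lborel (\<lambda>x. (norm (u x))\<^sup>2)"
    and m [measurable]: "f \<in> borel_measurable borel" "u \<in> borel_measurable borel"
    using u by (auto simp: schrodinger_L2_def square_integrable_def)
  note [measurable] = schrodinger_L1_measurable[OF f]
  have S: "schrodinger t (\<phi> j) = schrodinger_L1 t (\<phi> j)" for j
    using schrodinger_eq_schrodinger_L1[OF schwartz_integrable fourier_schwartz_integrable t] \<phi>(1) by blast
  have m' [measurable]: "\<phi> j \<in> borel_measurable borel" "schrodinger t (\<phi> j) \<in> borel_measurable borel" for j
    using schwartz_measurable[OF \<phi>(1)] schrodinger_L1_measurable[OF schwartz_integrable[OF \<phi>(1)]] by (auto simp: S)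
  \<comment> \<open>The factor is unimodular: multiplying the difference by it loses nothing and
    turns integrals over plain boxes into tests against chirped ones.\<close>
  define e where "e = (\<lambda>x::'a. cis ((norm x)\<^sup>2 / (4 * t)))"
  have [measurable]: "e \<in> borel_measurable borel" unfolding e_def by measurable
  define w where "w = (\<lambda>x. (u x - schrodinger_L1 t f x) * e x)"
  have [measurable]: "w \<in> borel_measurable borel" unfolding w_def by measurable
  have box_i: "integrable lborel (indicat_real (box a b))" for a b :: 'a
    using emeasure_lborel_box_finite[of a b] by (intro integrable_real_indicator) auto
  have "AE x in lborel. w x = 0"
  proof (rule AE_eq_0_if_integral_box_eq_0)
    fix a b :: 'a
    define \<theta> where "\<theta> = (\<lambda>x. indicator (box a b) x * e x)"
    have [measurable]: "\<theta> \<in> borel_measurable borel" unfolding \<theta>_def by measurable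
    have \<theta>1: "norm (\<theta> x) \<le> 1" for x by (simp add: \<theta>_def e_def norm_mult indicator_def)
    have \<theta>i: "integrable lborel \<theta>"
      by (rule Bochner_Integration.integrable_bound[OF box_i[of a b]]) (auto simp: \<theta>_def e_def norm_mult indicator_def)
    have \<theta>2: "integrable lborel (\<lambda>x. (norm (\<theta> x))\<^sup>2)"
      by (rule Bochner_Integration.integrable_bound[OF box_i[of a b]]) (auto simp: \<theta>_def e_def norm_mult indicator_def)
    define \<Theta> where "\<Theta> = (\<lambda>y. LINT x|lborel. schrodinger_kernel t (x - y) * \<theta> x)"
    have [measurable]: "\<Theta> \<in> borel_measurable borel"
    proof -
      have "(\<lambda>y. LINT x|lborel. schrodinger_kernel t (x - y) * \<theta> x) \<in> borel_measurable lborel"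
        by (rule lborel.borel_measurable_lebesgue_integral) measurable
      thus ?thesis by (simp add: \<Theta>_def)
    qed
    obtain C where C: "\<And>y. (norm (\<Theta> y))\<^sup>2 \<le> C * decay y"
      unfolding \<Theta>_def \<theta>_def e_def by (rule chirped_box_mean_le_decay[OF t, of a b]) blast
    have \<Theta>2: "integrable lborel (\<lambda>y. (norm (\<Theta> y))\<^sup>2)"
      by (rule integrable_le_decay[of _ C]) (use C in auto)
    \<comment> \<open>Square integrability of \<Theta> does not by itself make its product with an
      integrable function integrable; boundedness does.\<close>
    have \<Theta>_bd: "norm (\<Theta> y) \<le> 1 + \<bar>C\<bar>" for y
    proof -
      have "(norm (\<Theta> y))\<^sup>2 \<le> \<bar>C\<bar> * 1"
        by (rule order_trans[OF C]) (intro mult_mono, auto intro: decay_le_1)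
      thus ?thesis using abs_le_1_plus_square[of "norm (\<Theta> y)"] by simp
    qed
    have 1: "(\<lambda>j. LINT y|lborel. \<phi> j y * \<Theta> y) \<longlonglongrightarrow> (LINT y|lborel. f y * \<Theta> y)"
      by (rule L2_tendsto_pairing[OF \<phi>(2) _ _ _ \<Theta>2])
        (auto intro!: integrable_bounded_mult[OF schwartz_integrable[OF \<phi>(1)] _ \<Theta>_bd] integrable_bounded_mult[OF f _ \<Theta>_bd])
    have Si: "integrable lborel (\<lambda>x. schrodinger_L1 t g x * \<theta> x)" if "integrable lborel g" for g
      using schrodinger_L1_measurable[OF that]
      by (intro integrable_bounded_mult(1)[OF \<theta>i _ norm_schrodinger_L1_le]) auto
    have ui: "integrable lborel (\<lambda>x. u x * \<theta> x)"
      by (rule integrable_mult_of_square_integrable) (use u2 \<theta>2 in auto)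
    have 2: "(\<lambda>j. LINT x|lborel. schrodinger t (\<phi> j) x * \<theta> x) \<longlonglongrightarrow> (LINT x|lborel. u x * \<theta> x)"
      by (rule L2_tendsto_pairing[OF \<phi>(3) _ _ _ \<theta>2])
        (use ui Si[OF schwartz_integrable[OF \<phi>(1)]] m' in \<open>auto simp: S\<close>)
    have "(LINT x|lborel. schrodinger t (\<phi> j) x * \<theta> x) = (LINT y|lborel. \<phi> j y * \<Theta> y)" for j
      unfolding S \<Theta>_def by (rule schrodinger_L1_transpose[OF schwartz_integrable[OF \<phi>(1)] \<theta>i])
    with 1 2 have "(LINT x|lborel. u x * \<theta> x) = (LINT y|lborel. f y * \<Theta> y)"
      using LIMSEQ_unique by simp
    also have "\<dots> = (LINT x|lborel. schrodinger_L1 t f x * \<theta> x)"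
      unfolding \<Theta>_def by (rule schrodinger_L1_transpose[OF f \<theta>i, symmetric])
    finally have eq: "(LINT x|lborel. u x * \<theta> x - schrodinger_L1 t f x * \<theta> x) = 0"
      using ui Si[OF f] by simp
    have w_eq: "indicat_real (box a b) x *\<^sub>R w x = u x * \<theta> x - schrodinger_L1 t f x * \<theta> x" for x
      by (simp add: w_def \<theta>_def indicator_def algebra_simps)
    show "integrable lborel (\<lambda>x. indicat_real (box a b) x *\<^sub>R w x)"
      unfolding w_eq by (intro Bochner_Integration.integrable_diff ui Si f)
    show "(LINT x|lborel. indicat_real (box a b) x *\<^sub>R w x) = 0"
      unfolding w_eq by (rule eq)
  qed
  thus ?thesis by eventually_elim (auto simp: w_def e_def)
qed

theorem localization_ae_imp_tendsto_schrodinger_L1: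
  fixes f :: "'a::euclidean_space \<Rightarrow> complex"
  assumes loc: "localization_ae TYPE('a) s" and f: "integrable lborel f"
    and f2: "square_integrable f" and fs: "distribution_of f \<in> sobolev s"
  shows "AE x in lborel. x \<notin> ess_supp f \<longrightarrow> ((\<lambda>t. schrodinger_L1 t f x) \<longlongrightarrow> 0) (at 0)"
proof -
  obtain u where u: "\<And>t. schrodinger_L2 t f (u t)"
    "AE x in lborel. x \<notin> ess_supp f \<longrightarrow> ((\<lambda>t. u t x) \<longlongrightarrow> 0) (at 0)"
    using loc f2 fs unfolding localization_ae_def by blast
  \<comment> \<open>Time 0 is left out since the kernel represents the mean at nonzero times
    only.\<close>
  have "AE x in lborel. q \<noteq> 0 \<longrightarrow> u (real_of_rat q) x = schrodinger_L1 (real_of_rat q) f x" for q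
    using schrodinger_L2_eq_schrodinger_L1[OF u(1) f, of "real_of_rat q"] by (cases "q = 0") auto
  hence "AE x in lborel. \<forall>q. q \<noteq> 0 \<longrightarrow> u (real_of_rat q) x = schrodinger_L1 (real_of_rat q) f x"
    unfolding AE_all_countable by blast
  with u(2) show ?thesis
  proof eventually_elim
    case (elim x)
    show ?case
    proof (intro impI tendstoI)
      fix e :: real assume x: "x \<notin> ess_supp f" and e: "e > 0"
      let ?S = "\<lambda>t. schrodinger_L1 t f x"
      have "\<forall>\<^sub>F t in at 0. dist (u t x) 0 < e / 2"
        using elim x e by (intro tendstoD) auto
      then obtain d where d: "d > 0" "\<And>t. t \<noteq> 0 \<Longrightarrow> \<bar>t\<bar> < d \<Longrightarrow> norm (u t x) < e / 2"
        by (auto simp: eventually_at)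
      have "norm (?S t) < e" if t: "t \<noteq> 0" "\<bar>t\<bar> < d" for t
      proof (rule ccontr)
        assume "\<not> norm (?S t) < e"
        \<comment> \<open>Lowering the level to e / 2 makes the inequality strict, hence open in
          time. It then holds at a nearby rational time, still nonzero and of size below d, where
          \<open>u\<close> is known to be small.\<close>
        hence "norm (?S t) > e / 2" using e by simp
        moreover have "isCont (\<lambda>t. norm (?S t)) t"
          by (intro continuous_intros isCont_schrodinger_L1 f t)
        ultimately have "\<forall>\<^sub>F r in nhds t. norm (?S r) > e / 2"
          using tendsto_at_iff_tendsto_nhds[of "\<lambda>t. norm (?S t)" t]
          by (intro order_tendstoD(1)) (auto simp: isCont_def)
        moreover have "\<forall>\<^sub>F r in nhds t. r \<in> {-d<..<d} - {0}"
          using t by (intro eventually_nhds_in_open) auto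
        ultimately have "\<forall>\<^sub>F r in nhds t. norm (?S r) > e / 2 \<and> r \<in> {-d<..<d} - {0}"
          by eventually_elim auto
        then obtain d' where d': "d' > 0" "\<And>r. dist r t < d' \<Longrightarrow> norm (?S r) > e / 2 \<and> r \<in> {-d<..<d} - {0}"
          unfolding eventually_nhds_metric by blast
        obtain q r where r: "r = real_of_rat q" and tr: "t < r" "r < t + d'"
          using of_rat_dense[of t "t + d'"] d'(1) by auto
        have S: "norm (?S r) > e / 2" "- d < r" "r < d" "r \<noteq> 0"
          using d'(2)[of r] tr by (auto simp: dist_real_def)
        have "u r x = ?S r" using elim(2) S(4) unfolding r by simp
        moreover have "norm (u r x) < e / 2" using S by (intro d(2)) auto
        ultimately show False using S(1) by simp
      qed
      thus "\<forall>\<^sub>F t in at 0. dist (?S t) 0 < e"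
        unfolding eventually_at using d(1) by auto
    qed
  qed
qed

text \<open>An integrable function acts on test functions as a distribution of order 0, and the
  multiplication formula (Fubini) shows that its distributional transform is the ordinary
  one.\<close>

theorem distribution_of_in_sobolev:
  fixes f :: "'a::euclidean_space \<Rightarrow> complex"
  assumes f: "integrable lborel f"
    and F: "integrable lborel (\<lambda>\<xi>. (1 + (norm \<xi>)\<^sup>2) powr s * (cmod (fourier f \<xi>))\<^sup>2)"
  shows "distribution_of f \<in> sobolev s"
proof -
  have mult: "integrable lborel (\<lambda>x. f x * \<phi> x)" if \<phi>: "schwartz \<phi>" for \<phi>
  proof -
    obtain B where B: "\<And>x. norm (\<phi> x) \<le> B * decay x" using schwartz_le_decay[OF \<phi>] by blast
    have "norm (\<phi> x) \<le> \<bar>B\<bar>" for x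
    proof -
      have "B * decay x \<le> \<bar>B\<bar> * 1" by (intro mult_mono) (auto intro: decay_le_1)
      thus ?thesis using B[of x] by simp
    qed
    thus ?thesis using schwartz_measurable[OF \<phi>] by (intro integrable_bounded_mult(2)[OF f]) auto
  qed
  have lin: "distribution_of f (\<lambda>x. a * \<phi> x + b * \<theta> x) = a * distribution_of f \<phi> + b * distribution_of f \<theta>"
    if "schwartz \<phi>" "schwartz \<theta>" for \<phi> \<theta> a b
  proof -
    have "(LINT x|lborel. f x * (a * \<phi> x + b * \<theta> x)) = (LINT x|lborel. a * (f x * \<phi> x) + b * (f x * \<theta> x))"
      by (simp add: algebra_simps)
    thus ?thesis using mult that by (simp add: distribution_of_def)
  qed
  \<comment> \<open>Continuity with N = 0: only the empty list of derivatives and the weight 1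
    occur, and the \<open>L^1\<close> norm of f is the constant.\<close>
  have cont: "cmod (distribution_of f \<phi>) \<le> (LINT x|lborel. norm (f x)) * B"
    if \<phi>: "schwartz \<phi>" and B: "\<And>bs x. set bs \<subseteq> Basis \<Longrightarrow> length bs \<le> 0 \<Longrightarrow>
      (1 + norm x) ^ 0 * cmod (partials bs \<phi> x) \<le> B" for \<phi> B
  proof -
    have "cmod (distribution_of f \<phi>) \<le> (LINT x|lborel. norm (f x * \<phi> x))"
      unfolding distribution_of_def by (rule integral_norm_bound)
    also have "\<dots> \<le> (LINT x|lborel. norm (f x) * B)"
    proof (rule integral_mono)
      show "norm (f x * \<phi> x) \<le> norm (f x) * B" for x
        using B[of "[]" x] by (simp add: norm_mult mult_left_mono)
    qed (use mult[OF \<phi>] f in auto)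
    finally show ?thesis by simp
  qed
  have "tempered_distribution (distribution_of f)"
    unfolding tempered_distribution_def using lin cont by blast
  moreover have "distribution_of f (fourier \<phi>) = distribution_of (fourier f) \<phi>" if \<phi>: "schwartz \<phi>" for \<phi>
  proof -
    have "distribution_of f (fourier \<phi>) = (LINT x|lborel. LINT y|lborel. cis (- (x \<bullet> y)) * (f x * \<phi> y))"
      unfolding distribution_of_def fourier_def
      by (intro Bochner_Integration.integral_cong refl, subst integral_mult_right_zero[symmetric]) (simp add: mult_ac)
    also have "\<dots> = (LINT y|lborel. LINT x|lborel. cis (- (x \<bullet> y)) * (f x * \<phi> y))"
      by (rule Fubini_bounded_kernel[OF f schwartz_integrable[OF \<phi>] fourier_kernel_measurable, where B = 1, symmetric]) simp
    also have "\<dots> = distribution_of (fourier f) \<phi>"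
      unfolding distribution_of_def fourier_def
      by (intro Bochner_Integration.integral_cong refl, subst integral_mult_left_zero[symmetric]) (simp add: mult_ac inner_commute)
    finally show ?thesis .
  qed
  ultimately show ?thesis
    unfolding sobolev_def using F fourier_measurable[OF f] by auto
qed

section \<open>Exponential sums with separated frequencies\<close>

text \<open>The differentiation rule is applied twice to 1 / (1 + x^2), whose derivatives
  \<open>F1\<close> and \<open>F2\<close> are again dominated by the weight; this bounds \<eta>^2
  times the transform.\<close>

lemma fourier_decay_le_decay:
  obtains C where "C > 0" "\<And>\<eta>::real. norm (fourier (\<lambda>x. complex_of_real (decay x)) \<eta>) \<le> C * decay \<eta>"
proof -
  define F1 where "F1 = (\<lambda>x::real. - 2 * x / (1 + x\<^sup>2)\<^sup>2)"
  define F2 where "F2 = (\<lambda>x::real. (6 * x\<^sup>2 - 2) / (1 + x\<^sup>2) ^ 3)"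
  have pos: "1 + x\<^sup>2 > 0" for x :: real by (simp add: add_pos_nonneg)
  hence nz: "1 + x\<^sup>2 \<noteq> 0" for x :: real by (metis less_irrefl)
  have d1: "((\<lambda>x::real. decay x) has_real_derivative F1 x) (at x)" for x
    unfolding decay_real F1_def by (rule derivative_eq_intros refl nz | simp add: nz power2_eq_square)+
  have d2: "(F1 has_real_derivative F2 x) (at x)" for x
  proof -
    have "(F1 has_real_derivative ((- 2) * (1 + x\<^sup>2)\<^sup>2 - (- 2 * x) * (2 * (1 + x\<^sup>2) * (2 * x))) / ((1 + x\<^sup>2)\<^sup>2 * (1 + x\<^sup>2)\<^sup>2)) (at x)"
      unfolding F1_def by (rule derivative_eq_intros refl | simp add: nz)+
    also have "((- 2) * (1 + x\<^sup>2)\<^sup>2 - (- 2 * x) * (2 * (1 + x\<^sup>2) * (2 * x))) = (1 + x\<^sup>2) * (6 * x\<^sup>2 - 2)"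
      by (simp add: power2_eq_square algebra_simps)
    also have "(1 + x\<^sup>2) * (6 * x\<^sup>2 - 2) / ((1 + x\<^sup>2)\<^sup>2 * (1 + x\<^sup>2)\<^sup>2) = F2 x"
      using nz[of x] by (simp add: F2_def eval_nat_numeral)
    finally show ?thesis .
  qed
  have sq: "1 + x\<^sup>2 \<le> (1 + x\<^sup>2)\<^sup>2" for x :: real by (rule self_le_power) auto
  have b1: "norm (complex_of_real (F1 x)) \<le> 1 * decay x" for x
  proof -
    have "0 \<le> (\<bar>x\<bar> - 1)\<^sup>2" by simp
    hence "2 * \<bar>x\<bar> \<le> 1 + x\<^sup>2" unfolding power2_diff by simp
    hence "2 * \<bar>x\<bar> / (1 + x\<^sup>2)\<^sup>2 \<le> (1 + x\<^sup>2) / (1 + x\<^sup>2)\<^sup>2" by (intro divide_right_mono) auto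
    also have "\<dots> = decay x" using nz[of x] by (simp add: decay_real power2_eq_square)
    finally show ?thesis unfolding norm_of_real by (simp add: F1_def abs_mult)
  qed
  have b2: "norm (complex_of_real (F2 x)) \<le> 6 * decay x" for x
  proof -
    have "\<bar>6 * x\<^sup>2 - 2\<bar> \<le> 6 * (1 + x\<^sup>2)" by (rule abs_leI) auto
    also have "\<dots> \<le> 6 * (1 + x\<^sup>2)\<^sup>2" using sq[of x] by simp
    finally have "\<bar>6 * x\<^sup>2 - 2\<bar> / (1 + x\<^sup>2) ^ 3 \<le> 6 * (1 + x\<^sup>2)\<^sup>2 / (1 + x\<^sup>2) ^ 3"
      using pos[of x] by (intro divide_right_mono) auto
    also have "\<dots> = 6 * decay x" using nz[of x] by (simp add: decay_real eval_nat_numeral)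
    finally show ?thesis using pos[of x] unfolding norm_of_real by (simp add: F2_def)
  qed
  have v: "((\<lambda>s. complex_of_real (f (x + s *\<^sub>R 1))) has_vector_derivative complex_of_real f') (at 0)"
    if "(f has_real_derivative f') (at x)" for f f' and x :: real
  proof -
    have "((\<lambda>s. complex_of_real (f s)) has_vector_derivative complex_of_real f') (at x)"
      using that unfolding has_real_derivative_iff_has_vector_derivative
      by (rule bounded_linear.has_vector_derivative[OF bounded_linear_of_real])
    thus ?thesis by (simp add: has_vector_derivative_iff_quotient)
  qed
  let ?F = "\<lambda>x::real. complex_of_real (decay x)" and ?F1 = "\<lambda>x. complex_of_real (F1 x)" and ?F2 = "\<lambda>x. complex_of_real (F2 x)"
  have f1: "fourier ?F1 \<eta> = \<i> * (\<eta> \<bullet> 1) * fourier ?F \<eta>" for \<eta>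
    by (rule fourier_deriv[where A = 1, OF _ _ _ v[OF d1] b1]) auto
  have [measurable]: "F1 \<in> borel_measurable borel" unfolding F1_def by measurable
  have f2: "fourier ?F2 \<eta> = \<i> * (\<eta> \<bullet> 1) * fourier ?F1 \<eta>" for \<eta>
    by (rule fourier_deriv[where A = 1, OF _ _ b1 v[OF d2] b2]) auto
  define C where "C = (LINT x|lborel. norm (?F x)) + (LINT x|lborel. norm (?F2 x)) + 1"
  have "norm (fourier ?F \<eta>) \<le> C * decay \<eta>" for \<eta>
  proof -
    have "\<eta>\<^sup>2 * norm (fourier ?F \<eta>) = norm (fourier ?F2 \<eta>)"
      unfolding f1 f2 by (simp add: norm_mult power2_eq_square abs_mult[symmetric] flip: mult.assoc)
    also have "\<dots> \<le> (LINT x|lborel. norm (?F2 x))" by (rule norm_fourier_le)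
    finally have "norm (fourier ?F \<eta>) * (1 + \<eta>\<^sup>2) \<le> C"
      using norm_fourier_le[of ?F \<eta>] unfolding C_def distrib_left by (simp add: mult.commute)
    thus ?thesis using pos[of \<eta>] by (simp add: decay_real field_simps)
  qed
  moreover have "C > 0" unfolding C_def by (intro add_nonneg_pos add_nonneg_nonneg Bochner_Integration.integral_nonneg) auto
  ultimately show ?thesis using that by blast
qed

lemma sum_inverse_squares_int_bounded:
  obtains S where "S > 0" "\<And>A::int set. finite A \<Longrightarrow> (\<Sum>k\<in>A. 1 / (1 + (real_of_int k)\<^sup>2)) \<le> S"
proof -
  let ?s = "\<lambda>n::nat. 1 / (1 + (real n)\<^sup>2)"
  have summable: "summable ?s"
  proof (rule summable_comparison_test')
    show "summable (\<lambda>n. 2 * inverse ((real (Suc n))\<^sup>2))"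
      using inverse_squares_sums by (intro summable_mult) (simp add: sums_iff inverse_eq_divide add_ac)
    fix n :: nat
    have "0 \<le> (real n - 1)\<^sup>2" by simp
    hence "(real (Suc n))\<^sup>2 \<le> 2 * (1 + (real n)\<^sup>2)" by (simp add: power2_eq_square algebra_simps)
    thus "norm (?s n) \<le> 2 * inverse ((real (Suc n))\<^sup>2)"
      by (simp add: field_simps add_pos_nonneg)
  qed
  have le: "(\<Sum>k\<in>B. 1 / (1 + (real_of_int k)\<^sup>2)) \<le> suminf ?s"
    if "finite B" "inj_on (\<lambda>k. nat \<bar>k\<bar>) B" for B
  proof -
    have "(\<Sum>k\<in>B. 1 / (1 + (real_of_int k)\<^sup>2)) = (\<Sum>k\<in>B. ?s (nat \<bar>k\<bar>))"
      by (intro sum.cong) auto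
    also have "\<dots> = sum ?s ((\<lambda>k. nat \<bar>k\<bar>) ` B)" using that(2) by (simp add: sum.reindex)
    also have "\<dots> \<le> suminf ?s" using that(1) by (intro sum_le_suminf summable) auto
    finally show ?thesis .
  qed
  have "(\<Sum>k\<in>A. 1 / (1 + (real_of_int k)\<^sup>2)) \<le> 2 * suminf ?s + 1" if A: "finite A" for A
  proof -
    have "(\<Sum>k\<in>A. 1 / (1 + (real_of_int k)\<^sup>2)) = (\<Sum>k\<in>A \<inter> {0..}. 1 / (1 + (real_of_int k)\<^sup>2)) + (\<Sum>k\<in>A - {0..}. 1 / (1 + (real_of_int k)\<^sup>2))"
      using A by (rule sum.Int_Diff)
    also have "\<dots> \<le> suminf ?s + suminf ?s"
      using A by (intro add_mono le) (auto simp: inj_on_def)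
    finally show ?thesis by simp
  qed
  moreover have "2 * suminf ?s + 1 > 0" using suminf_nonneg[OF summable] by (simp add: add_nonneg_pos)
  ultimately show ?thesis using that by blast
qed

definition exp_sum_freq :: "real \<Rightarrow> int set \<Rightarrow> real \<Rightarrow> complex" where
  "exp_sum_freq D L x = (\<Sum>l\<in>L. cis (D * of_int l * x))"

lemma exp_sum_freq_measurable [measurable]: "exp_sum_freq D L \<in> borel_measurable borel"
  unfolding exp_sum_freq_def by measurable

lemma norm_exp_sum_freq_le: "norm (exp_sum_freq D L x) \<le> real (card L)"
  unfolding exp_sum_freq_def using norm_sum[of "\<lambda>l. cis (D * of_int l * x)" L] by simp

lemma integrable_exp_sum_freq_decay:
  "integrable lborel (\<lambda>x. decay x * norm (exp_sum_freq D L x) ^ k)"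
proof (rule Bochner_Integration.integrable_bound[of _ "\<lambda>x::real. decay x * real (card L) ^ k"])
  show "AE x in lborel. norm (decay x * norm (exp_sum_freq D L x) ^ k) \<le> norm (decay x * real (card L) ^ k)"
    by (intro AE_I2) (simp add: abs_mult mult_left_mono power_mono norm_exp_sum_freq_le)
qed auto

text \<open>The frequencies are 1-separated, so the Fourier transform of the weight makes them almost
  orthogonal.\<close>

lemma exp_sum_freq_weighted_L2:
  obtains C where "C > 0"
    "\<And>D L. D \<ge> 1 \<Longrightarrow> finite L \<Longrightarrow> (LINT x|lborel. decay x * (norm (exp_sum_freq D L x))\<^sup>2) \<le> C * real (card L)"
proof -
  obtain C1 where C1: "C1 > 0" "\<And>\<eta>::real. norm (fourier (\<lambda>x. complex_of_real (decay x)) \<eta>) \<le> C1 * decay \<eta>"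
    using fourier_decay_le_decay by blast
  obtain S where S: "S > 0" "\<And>A::int set. finite A \<Longrightarrow> (\<Sum>k\<in>A. 1 / (1 + (real_of_int k)\<^sup>2)) \<le> S"
    using sum_inverse_squares_int_bounded by blast
  have "(LINT x|lborel. decay x * (norm (exp_sum_freq D L x))\<^sup>2) \<le> C1 * S * real (card L)"
    if D: "D \<ge> 1" and L: "finite L" for D L
  proof -
    let ?w = "\<lambda>x::real. complex_of_real (decay x)"
    have wi: "integrable lborel (\<lambda>x. cis (- (\<eta> \<bullet> x)) * ?w x)" for \<eta>
      by (rule integrable_le_decay[where B = 1]) (auto simp: norm_mult)
    \<comment> \<open>Expanding the square produces, after integration, the transform of the weight
      at the frequency differences D (l - m), up to sign.\<close>
    have eq: "complex_of_real (decay x * (norm (exp_sum_freq D L x))\<^sup>2) =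
        (\<Sum>l\<in>L. \<Sum>m\<in>L. cis (- ((- (D * of_int (l - m))) \<bullet> x)) * ?w x)" for x
    proof -
      have "complex_of_real (decay x * (norm (exp_sum_freq D L x))\<^sup>2) = exp_sum_freq D L x * cnj (exp_sum_freq D L x) * ?w x"
        by (simp only: of_real_mult complex_norm_square mult_ac)
      also have "\<dots> = (\<Sum>l\<in>L. \<Sum>m\<in>L. cis (D * of_int l * x) * cis (- (D * of_int m * x))) * ?w x"
        by (simp only: exp_sum_freq_def cnj_sum cis_cnj sum_product)
      also have "\<dots> = (\<Sum>l\<in>L. \<Sum>m\<in>L. cis (- ((- (D * of_int (l - m))) \<bullet> x)) * ?w x)"
        unfolding sum_distrib_right by (intro sum.cong refl) (simp add: cis_mult algebra_simps)
      finally show ?thesis .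
    qed
    have "complex_of_real (LINT x|lborel. decay x * (norm (exp_sum_freq D L x))\<^sup>2) =
        (\<Sum>l\<in>L. \<Sum>m\<in>L. fourier ?w (- (D * of_int (l - m))))"
      unfolding integral_complex_of_real[symmetric] eq fourier_def
      by (subst Bochner_Integration.integral_sum, intro Bochner_Integration.integrable_sum wi)+
        (intro sum.cong refl Bochner_Integration.integral_sum wi)
    note I = this
    have "(LINT x|lborel. decay x * (norm (exp_sum_freq D L x))\<^sup>2) \<le>
        norm (complex_of_real (LINT x|lborel. decay x * (norm (exp_sum_freq D L x))\<^sup>2))"
      unfolding norm_of_real by (rule abs_ge_self)
    also have "\<dots> = norm (\<Sum>l\<in>L. \<Sum>m\<in>L. fourier ?w (- (D * of_int (l - m))))"
      by (simp only: I)
    also have "\<dots> \<le> (\<Sum>l\<in>L. \<Sum>m\<in>L. C1 * (1 / (1 + (real_of_int (l - m))\<^sup>2)))"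
    proof (intro order_trans[OF norm_sum] sum_mono order_trans[OF norm_sum])
      fix l m
      have "(real_of_int (l - m))\<^sup>2 = 1 * (real_of_int (l - m))\<^sup>2" by simp
      also have "\<dots> \<le> D\<^sup>2 * (real_of_int (l - m))\<^sup>2" using D by (intro mult_right_mono) auto
      finally have "1 + (real_of_int (l - m))\<^sup>2 \<le> 1 + (D * of_int (l - m))\<^sup>2" by (simp add: power_mult_distrib)
      hence "decay (- (D * of_int (l - m))) \<le> 1 / (1 + (real_of_int (l - m))\<^sup>2)"
        unfolding decay_real by (intro divide_left_mono mult_pos_pos) (auto simp: add_pos_nonneg)
      hence "C1 * decay (- (D * of_int (l - m))) \<le> C1 * (1 / (1 + (real_of_int (l - m))\<^sup>2))"
        using C1(1) by (intro mult_left_mono) auto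
      thus "norm (fourier ?w (- (D * of_int (l - m)))) \<le> C1 * (1 / (1 + (real_of_int (l - m))\<^sup>2))"
        by (rule order_trans[OF C1(2)])
    qed
    \<comment> \<open>For fixed l the differences l - m are distinct integers, so every row sum is
      bounded by S and only the number of rows remains.\<close>
    also have "\<dots> \<le> (\<Sum>l\<in>L. C1 * S)"
    proof (rule sum_mono)
      fix l
      have "(\<Sum>m\<in>L. 1 / (1 + (real_of_int (l - m))\<^sup>2)) = (\<Sum>k\<in>(\<lambda>m. l - m) ` L. 1 / (1 + (real_of_int k)\<^sup>2))"
        by (subst sum.reindex) (auto simp: inj_on_def)
      also have "\<dots> \<le> S" using L by (intro S(2)) auto
      finally have "C1 * (\<Sum>m\<in>L. 1 / (1 + (real_of_int (l - m))\<^sup>2)) \<le> C1 * S" using C1(1) by simp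
      thus "(\<Sum>m\<in>L. C1 * (1 / (1 + (real_of_int (l - m))\<^sup>2))) \<le> C1 * S" by (simp only: sum_distrib_left)
    qed
    also have "\<dots> = C1 * S * real (card L)" by simp
    finally show ?thesis .
  qed
  thus ?thesis using that[of "C1 * S"] C1(1) S(1) by simp
qed

text \<open>With N the square root of the number of frequencies, the pointwise inequality P <= N +
  P^2 / N balances its two terms after integration; this is Cauchy-Schwarz with the parameter
  already chosen.\<close>

lemma exp_sum_freq_weighted_L1:
  obtains C where "C > 0"
    "\<And>D L. D \<ge> 1 \<Longrightarrow> finite L \<Longrightarrow> (LINT x|lborel. decay x * norm (exp_sum_freq D L x)) \<le> C * sqrt (card L)"
proof -
  obtain C where C: "C > 0" "\<And>D L. D \<ge> 1 \<Longrightarrow> finite L \<Longrightarrow>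
      (LINT x|lborel. decay x * (norm (exp_sum_freq D L x))\<^sup>2) \<le> C * real (card L)"
    using exp_sum_freq_weighted_L2 by blast
  let ?I = "LINT x|lborel. decay (x::real)"
  have I: "?I \<ge> 0" by (rule Bochner_Integration.integral_nonneg) simp
  have "(LINT x|lborel. decay x * norm (exp_sum_freq D L x)) \<le> (?I + C) * sqrt (card L)"
    if D: "D \<ge> 1" and L: "finite L" for D L
  proof (cases "L = {}")
    case True
    thus ?thesis by (simp add: exp_sum_freq_def)
  next
    case False
    define N where "N = sqrt (real (card L))"
    have N: "N > 0" "N * N = card L" using False L by (auto simp: N_def card_gt_0_iff)
    let ?P = "\<lambda>x. norm (exp_sum_freq D L x)"
    have "(LINT x|lborel. decay x * ?P x) \<le> (LINT x|lborel. N * decay x + (1 / N) * (decay x * (?P x)\<^sup>2))"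
    proof (rule integral_mono)
      show "integrable lborel (\<lambda>x. decay x * ?P x)" using integrable_exp_sum_freq_decay[of D L 1] by simp
      show "integrable lborel (\<lambda>x. N * decay x + (1 / N) * (decay x * (?P x)\<^sup>2))"
        using integrable_exp_sum_freq_decay[of D L 2] by simp
      fix x
      have "0 \<le> (?P x - N)\<^sup>2" by simp
      hence "2 * (?P x * N) \<le> (?P x)\<^sup>2 + N\<^sup>2" unfolding power2_diff by simp
      moreover have "0 \<le> ?P x * N" using N by simp
      ultimately have "?P x * N \<le> (?P x)\<^sup>2 + N * N" by (simp add: power2_eq_square)
      hence "?P x \<le> N + (1 / N) * (?P x)\<^sup>2" using N(1) by (simp add: field_simps)
      hence "decay x * ?P x \<le> decay x * (N + (1 / N) * (?P x)\<^sup>2)" by (intro mult_left_mono) auto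
      thus "decay x * ?P x \<le> N * decay x + (1 / N) * (decay x * (?P x)\<^sup>2)" by (simp add: algebra_simps)
    qed
    also have "\<dots> = N * ?I + (1 / N) * (LINT x|lborel. decay x * (?P x)\<^sup>2)"
      using integrable_exp_sum_freq_decay[of D L 2] by simp
    also have "\<dots> \<le> N * ?I + (1 / N) * (C * (N * N))"
      using C(2)[OF D L] N by (intro add_left_mono mult_left_mono) auto
    also have "\<dots> = (?I + C) * N" using N(1) by (simp add: field_simps)
    finally show ?thesis by (simp add: N_def)
  qed
  thus ?thesis using that[of "?I + C"] I C(1) by simp
qed

section \<open>Wave packets: one Schwartz profile modulated at many frequencies\<close>

definition packet :: "(real \<Rightarrow> complex) \<Rightarrow> real \<Rightarrow> int set \<Rightarrow> real \<Rightarrow> complex" where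
  "packet \<psi> D L x = \<psi> x * exp_sum_freq D L x"

lemma fourier_packet:
  assumes "integrable lborel \<psi>"
  shows "fourier (packet \<psi> D L) \<eta> = (\<Sum>l\<in>L. fourier \<psi> (- (D * of_int l) + \<eta>))"
proof -
  have i: "integrable lborel (\<lambda>x. cis (- (y \<bullet> x)) * \<psi> x)" for y
    by (intro integrable_bounded_mult(1)[OF assms, where B = 1]) auto
  have eq: "cis (- (\<eta> \<bullet> x)) * packet \<psi> D L x = (\<Sum>l\<in>L. cis (- ((- (D * of_int l) + \<eta>) \<bullet> x)) * \<psi> x)" for x
  proof -
    have "cis (- ((- (D * of_int l) + \<eta>) \<bullet> x)) = cis (- (\<eta> \<bullet> x)) * cis (D * of_int l * x)" for l
      unfolding cis_mult by (simp add: algebra_simps)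
    thus ?thesis
      unfolding packet_def exp_sum_freq_def sum_distrib_left by (simp add: mult_ac)
  qed
  show ?thesis unfolding fourier_def eq by (rule Bochner_Integration.integral_sum[OF i])
qed

text \<open>The points D l have spacing at least 1. Hence at any frequency at most two of the
  unit-radius bumps in the transform of a packet can be nonzero.\<close>

lemma card_near_lattice_points_le_2:
  fixes D \<eta> :: real
  assumes "D \<ge> 1"
  shows "finite {l::int. \<bar>\<eta> - D * of_int l\<bar> < 1}" "card {l::int. \<bar>\<eta> - D * of_int l\<bar> < 1} \<le> 2"
proof -
  have sub: "{l::int. \<bar>\<eta> - D * of_int l\<bar> < 1} \<subseteq> {\<lfloor>\<eta> / D\<rfloor>, \<lfloor>\<eta> / D\<rfloor> + 1}"
  proof
    fix l :: int assume "l \<in> {l. \<bar>\<eta> - D * of_int l\<bar> < 1}"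
    hence "\<bar>\<eta> - D * of_int l\<bar> < D" using assms by simp
    hence "\<eta> < (of_int l + 1) * D" "(of_int l - 1) * D < \<eta>" by (auto simp: algebra_simps abs_less_iff)
    hence "\<eta> / D < of_int l + 1" "of_int l - 1 < \<eta> / D"
      using assms by (auto simp: pos_divide_less_eq pos_less_divide_eq)
    thus "l \<in> {\<lfloor>\<eta> / D\<rfloor>, \<lfloor>\<eta> / D\<rfloor> + 1}" by simp linarith
  qed
  thus "finite {l::int. \<bar>\<eta> - D * of_int l\<bar> < 1}" by (rule finite_subset) simp
  show "card {l::int. \<bar>\<eta> - D * of_int l\<bar> < 1} \<le> 2"
    using card_mono[OF _ sub] by (simp add: card_insert_if split: if_splits)
qed

text \<open>On the physical side almost orthogonality replaces the trivial count by its square root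
  in \<open>L^1\<close>. On the frequency side bounded overlap makes the transform bounded, so its
  squared \<open>L^2\<close> norm is controlled by its \<open>L^1\<close> norm, which is linear in
  the number of frequencies.\<close>

lemma packet_bounds:
  assumes \<psi>: "schwartz \<psi>" and supp: "\<And>\<eta>. fourier \<psi> \<eta> \<noteq> 0 \<Longrightarrow> \<bar>\<eta>\<bar> < 1"
  obtains A where "A \<ge> 1"
    "\<And>D L. D \<ge> 1 \<Longrightarrow> finite L \<Longrightarrow> integrable lborel (packet \<psi> D L)"
    "\<And>D L. D \<ge> 1 \<Longrightarrow> finite L \<Longrightarrow> (LINT x|lborel. norm (packet \<psi> D L x)) \<le> A * sqrt (card L)"
    "\<And>D L. D \<ge> 1 \<Longrightarrow> finite L \<Longrightarrow> integrable lborel (\<lambda>x. (norm (packet \<psi> D L x))\<^sup>2)"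
    "\<And>D L. D \<ge> 1 \<Longrightarrow> finite L \<Longrightarrow> (LINT x|lborel. (norm (packet \<psi> D L x))\<^sup>2) \<le> A * real (card L)"
    "\<And>D L. D \<ge> 1 \<Longrightarrow> finite L \<Longrightarrow> integrable lborel (fourier (packet \<psi> D L))"
    "\<And>D L. D \<ge> 1 \<Longrightarrow> finite L \<Longrightarrow> (LINT x|lborel. norm (fourier (packet \<psi> D L) x)) \<le> A * real (card L)"
    "\<And>D L. D \<ge> 1 \<Longrightarrow> finite L \<Longrightarrow> integrable lborel (\<lambda>x. (norm (fourier (packet \<psi> D L) x))\<^sup>2)"
    "\<And>D L. D \<ge> 1 \<Longrightarrow> finite L \<Longrightarrow> (LINT x|lborel. (norm (fourier (packet \<psi> D L) x))\<^sup>2) \<le> A * real (card L)"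
proof -
  obtain B0 where B0: "\<And>x. norm (\<psi> x) \<le> B0 * decay x" using schwartz_le_decay[OF \<psi>] by blast
  define B where "B = \<bar>B0\<bar>"
  have B: "B \<ge> 0" "norm (\<psi> x) \<le> B * decay x" for x
    unfolding B_def by (simp, rule order_trans[OF B0 mult_right_mono]) auto
  obtain E0 where E0: "\<And>x. norm (fourier \<psi> x) \<le> E0 * decay x" using fourier_schwartz_le_decay[OF \<psi>] by blast
  define E where "E = \<bar>E0\<bar>"
  have E: "E \<ge> 0" "norm (fourier \<psi> x) \<le> E" for x
  proof -
    have "E0 * decay x \<le> \<bar>E0\<bar> * 1" by (intro mult_mono) (auto intro: decay_le_1)
    thus "norm (fourier \<psi> x) \<le> E" using E0[of x] by (simp add: E_def)
  qed (simp add: E_def)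
  obtain C1 where C1: "C1 > 0" "\<And>D L. D \<ge> 1 \<Longrightarrow> finite L \<Longrightarrow>
      (LINT x|lborel. decay x * norm (exp_sum_freq D L x)) \<le> C1 * sqrt (card L)"
    using exp_sum_freq_weighted_L1 by blast
  obtain C2 where C2: "C2 > 0" "\<And>D L. D \<ge> 1 \<Longrightarrow> finite L \<Longrightarrow>
      (LINT x|lborel. decay x * (norm (exp_sum_freq D L x))\<^sup>2) \<le> C2 * real (card L)"
    using exp_sum_freq_weighted_L2 by blast
  define F where "F = (LINT x|lborel. norm (fourier \<psi> x))"
  have F: "F \<ge> 0" unfolding F_def by (rule Bochner_Integration.integral_nonneg) simp
  note [measurable] = schwartz_measurable[OF \<psi>]
  define A where "A = 1 + B * C1 + B\<^sup>2 * C2 + F + 2 * E * F"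
  have nn: "B * C1 \<ge> 0" "B\<^sup>2 * C2 \<ge> 0" "2 * E * F \<ge> 0" using B C1(1) C2(1) E F by auto
  have A: "A \<ge> 1" "B * C1 \<le> A" "B\<^sup>2 * C2 \<le> A" "F \<le> A" "2 * E * F \<le> A"
    using nn F unfolding A_def by linarith+
  have m [measurable]: "packet \<psi> D L \<in> borel_measurable borel" for D L
    unfolding packet_def by measurable
  have p1: "norm (packet \<psi> D L x) \<le> B * (decay x * norm (exp_sum_freq D L x) ^ 1)" for D L x
    unfolding packet_def norm_mult using mult_right_mono[OF B(2) norm_ge_zero] by (simp add: mult.assoc)
  have p2: "(norm (packet \<psi> D L x))\<^sup>2 \<le> B\<^sup>2 * (decay x * (norm (exp_sum_freq D L x))\<^sup>2)" for D L x
  proof -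
    have "(norm (packet \<psi> D L x))\<^sup>2 \<le> (B * (decay x * norm (exp_sum_freq D L x) ^ 1))\<^sup>2"
      by (intro power_mono p1) simp
    also have "\<dots> = B\<^sup>2 * ((decay x * decay x) * (norm (exp_sum_freq D L x))\<^sup>2)"
      by (simp add: power2_eq_square)
    also have "\<dots> \<le> B\<^sup>2 * ((decay x * 1) * (norm (exp_sum_freq D L x))\<^sup>2)"
      by (intro mult_left_mono mult_right_mono decay_le_1) auto
    finally show ?thesis by simp
  qed
  have i1: "integrable lborel (packet \<psi> D L)" for D L
  proof (rule Bochner_Integration.integrable_bound)
    show "integrable lborel (\<lambda>x. B * (decay x * norm (exp_sum_freq D L x) ^ 1))"
      by (intro integrable_mult_right integrable_exp_sum_freq_decay)
  qed (use p1 B in \<open>auto simp: abs_mult\<close>)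
  have i2: "integrable lborel (\<lambda>x. (norm (packet \<psi> D L x))\<^sup>2)" for D L
  proof (rule Bochner_Integration.integrable_bound)
    show "integrable lborel (\<lambda>x. B\<^sup>2 * (decay x * (norm (exp_sum_freq D L x))\<^sup>2))"
      by (intro integrable_mult_right integrable_exp_sum_freq_decay)
  qed (use p2 in \<open>auto simp: abs_mult\<close>)
  have Fi: "integrable lborel (\<lambda>x. fourier \<psi> (a + x))" for a
    using fourier_schwartz_integrable[OF \<psi>] integral_shift_lborel(2)[of "fourier \<psi>" a]
    by (auto dest: borel_measurable_integrable)
  have Fs: "(LINT x|lborel. norm (fourier \<psi> (a + x))) = F" for a
    unfolding F_def by (rule integral_shift_lborel) (use fourier_schwartz_integrable[OF \<psi>] in \<open>auto dest: borel_measurable_integrable\<close>)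
  have fp: "fourier (packet \<psi> D L) = (\<lambda>\<eta>. \<Sum>l\<in>L. fourier \<psi> (- (D * of_int l) + \<eta>))" for D L
    using fourier_packet[OF schwartz_integrable[OF \<psi>]] by auto
  have i3: "integrable lborel (fourier (packet \<psi> D L))" for D L
    unfolding fp by (intro Bochner_Integration.integrable_sum Fi)
  have l3: "(LINT x|lborel. norm (fourier (packet \<psi> D L) x)) \<le> F * real (card L)" for D L
  proof -
    have "(LINT x|lborel. norm (fourier (packet \<psi> D L) x)) \<le> (LINT x|lborel. (\<Sum>l\<in>L. norm (fourier \<psi> (- (D * of_int l) + x))))"
      by (intro integral_mono Bochner_Integration.integrable_sum integrable_norm Fi i3)
        (auto simp: fp intro: norm_sum)
    also have "\<dots> = (\<Sum>l\<in>L. F)"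
      by (subst Bochner_Integration.integral_sum) (rule integrable_norm[OF Fi], simp only: Fs)
    finally show ?thesis by (simp add: mult.commute)
  qed
  have sup: "norm (fourier (packet \<psi> D L) \<eta>) \<le> 2 * E" if D: "D \<ge> 1" and L: "finite L" for D L \<eta>
  proof -
    let ?N = "{l::int. \<bar>\<eta> - D * of_int l\<bar> < 1}"
    have "norm (fourier (packet \<psi> D L) \<eta>) \<le> (\<Sum>l\<in>L. norm (fourier \<psi> (- (D * of_int l) + \<eta>)))"
      unfolding fp by (rule norm_sum)
    also have "\<dots> = (\<Sum>l\<in>L \<inter> ?N. norm (fourier \<psi> (- (D * of_int l) + \<eta>)))"
      using L supp by (intro sum.mono_neutral_right) (auto simp: algebra_simps)
    also have "\<dots> \<le> (\<Sum>l\<in>L \<inter> ?N. E)" by (intro sum_mono E)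
    also have "\<dots> = real (card (L \<inter> ?N)) * E" by simp
    also have "\<dots> \<le> 2 * E"
    proof (intro mult_right_mono E(1))
      have "card (L \<inter> ?N) \<le> card ?N" using card_near_lattice_points_le_2[OF D, of \<eta>] by (intro card_mono) auto
      thus "real (card (L \<inter> ?N)) \<le> 2" using card_near_lattice_points_le_2(2)[OF D, of \<eta>] by linarith
    qed
    finally show ?thesis .
  qed
  have le4: "(norm (fourier (packet \<psi> D L) \<eta>))\<^sup>2 \<le> 2 * E * norm (fourier (packet \<psi> D L) \<eta>)"
    if "D \<ge> 1" "finite L" for D L \<eta>
    unfolding power2_eq_square using sup[OF that] by (intro mult_right_mono) auto
  have i4: "integrable lborel (\<lambda>x. (norm (fourier (packet \<psi> D L) x))\<^sup>2)" if "D \<ge> 1" "finite L" for D L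
  proof (rule Bochner_Integration.integrable_bound)
    show "integrable lborel (\<lambda>x. 2 * E * norm (fourier (packet \<psi> D L) x))"
      by (intro integrable_mult_right integrable_norm i3)
    show "AE x in lborel. norm ((norm (fourier (packet \<psi> D L) x))\<^sup>2) \<le> norm (2 * E * norm (fourier (packet \<psi> D L) x))"
      using le4[OF that] E(1) by (auto simp: abs_mult)
  qed (use i3[of D L] in \<open>auto dest: borel_measurable_integrable\<close>)
  show ?thesis
  proof (rule that[OF A(1) i1 _ i2 _ i3 _ i4])
    fix D :: real and L :: "int set" assume DL: "D \<ge> 1" "finite L"
    have "(LINT x|lborel. norm (packet \<psi> D L x)) \<le> (LINT x|lborel. B * (decay x * norm (exp_sum_freq D L x) ^ 1))"
      by (intro integral_mono p1 integrable_norm i1 integrable_mult_right integrable_exp_sum_freq_decay)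
    also have "\<dots> = B * (LINT x|lborel. decay x * norm (exp_sum_freq D L x))" by simp
    also have "\<dots> \<le> B * (C1 * sqrt (card L))" by (intro mult_left_mono C1 DL B)
    also have "\<dots> \<le> A * sqrt (card L)" unfolding mult.assoc[symmetric] by (intro mult_right_mono A) auto
    finally show "(LINT x|lborel. norm (packet \<psi> D L x)) \<le> A * sqrt (card L)" .
    have "(LINT x|lborel. (norm (packet \<psi> D L x))\<^sup>2) \<le> (LINT x|lborel. B\<^sup>2 * (decay x * (norm (exp_sum_freq D L x))\<^sup>2))"
      by (intro integral_mono p2 i2 integrable_mult_right integrable_exp_sum_freq_decay)
    also have "\<dots> = B\<^sup>2 * (LINT x|lborel. decay x * (norm (exp_sum_freq D L x))\<^sup>2)" by simp
    also have "\<dots> \<le> B\<^sup>2 * (C2 * real (card L))" by (intro mult_left_mono C2 DL) simp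
    also have "\<dots> \<le> A * real (card L)" unfolding mult.assoc[symmetric] by (intro mult_right_mono A) auto
    finally show "(LINT x|lborel. (norm (packet \<psi> D L x))\<^sup>2) \<le> A * real (card L)" .
    show "(LINT x|lborel. norm (fourier (packet \<psi> D L) x)) \<le> A * real (card L)"
      by (rule order_trans[OF l3]) (intro mult_right_mono A, simp)
    have "(LINT x|lborel. (norm (fourier (packet \<psi> D L) x))\<^sup>2) \<le> (LINT x|lborel. 2 * E * norm (fourier (packet \<psi> D L) x))"
      by (intro integral_mono le4 i4 DL integrable_mult_right integrable_norm i3)
    also have "\<dots> = 2 * E * (LINT x|lborel. norm (fourier (packet \<psi> D L) x))" by simp
    also have "\<dots> \<le> 2 * E * (F * real (card L))" using E(1) by (intro mult_left_mono l3) auto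
    also have "\<dots> \<le> A * real (card L)" unfolding mult.assoc[symmetric] by (intro mult_right_mono A) auto
    finally show "(LINT x|lborel. (norm (fourier (packet \<psi> D L) x))\<^sup>2) \<le> A * real (card L)" .
  qed
qed

section \<open>Product functions of several variables\<close>

lemma prod_Basis_vec:
  fixes x :: "real ^ 'm"
  shows "(\<Prod>b\<in>Basis. f b (x \<bullet> b)) = (\<Prod>j\<in>UNIV. f (axis j 1) (x $ j))"
proof -
  have B: "(Basis :: (real ^ 'm) set) = (\<lambda>j. axis j 1) ` UNIV" by (auto simp: Basis_vec_def)
  have "inj (\<lambda>j::'m. axis j (1::real))" by (auto simp: inj_on_def axis_eq_axis)
  thus ?thesis unfolding B by (subst prod.reindex) (auto simp: inner_axis)
qed

lemma
  fixes p :: "real \<Rightarrow> 'b::{real_normed_field,banach,second_countable_topology}"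
  assumes p: "integrable lborel p"
  shows integrable_prod_vec: "integrable lborel (\<lambda>x::real ^ 'm. \<Prod>j\<in>UNIV. p (x $ j))"
    and integral_prod_vec: "(LINT x|lborel. (\<Prod>j\<in>UNIV. p ((x::real ^ 'm) $ j))) = (LINT x|lborel. p x) ^ CARD('m)"
proof -
  have eq: "(\<Prod>j\<in>UNIV. p (x $ j)) = (\<Prod>b\<in>Basis. p (x \<bullet> b))" for x :: "real ^ 'm"
    using prod_Basis_vec[of "\<lambda>_. p" x] by simp
  show "integrable lborel (\<lambda>x::real ^ 'm. \<Prod>j\<in>UNIV. p (x $ j))"
    unfolding eq by (intro integrable_prod_lborel p)
  show "(LINT x|lborel. (\<Prod>j\<in>UNIV. p ((x::real ^ 'm) $ j))) = (LINT x|lborel. p x) ^ CARD('m)"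
    unfolding eq by (subst integral_prod_lborel) (auto simp: p)
qed

lemma fourier_prod_vec:
  fixes p :: "real \<Rightarrow> complex"
  assumes p: "integrable lborel p"
  shows "fourier (\<lambda>x::real ^ 'm. \<Prod>j\<in>UNIV. p (x $ j)) \<xi> = (\<Prod>j\<in>UNIV. fourier p (\<xi> $ j))"
proof -
  have i: "integrable lborel (\<lambda>x. cis (- (y \<bullet> x)) * p x)" for y
    by (intro integrable_bounded_mult(1)[OF p, where B = 1]) auto
  have "cis (- (\<xi> \<bullet> x)) * (\<Prod>j\<in>UNIV. p (x $ j)) = (\<Prod>b\<in>Basis. cis (- ((\<xi> \<bullet> b) \<bullet> (x \<bullet> b))) * p (x \<bullet> b))" for x
  proof -
    have "cis (- (\<xi> \<bullet> x)) = (\<Prod>j\<in>UNIV. cis (- ((\<xi> $ j) * (x $ j))))"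
      by (simp add: inner_vec_def cis_conv_exp exp_sum[symmetric] sum_distrib_left sum_negf)
    moreover have "(\<Prod>b\<in>Basis. cis (- ((\<xi> \<bullet> b) \<bullet> (x \<bullet> b))) * p (x \<bullet> b)) = (\<Prod>j\<in>UNIV. cis (- ((\<xi> $ j) * (x $ j))) * p (x $ j))"
      using prod_Basis_vec[of "\<lambda>b y. cis (- ((\<xi> \<bullet> b) \<bullet> y)) * p y" x] by (simp add: inner_axis)
    ultimately show ?thesis by (simp add: prod.distrib)
  qed
  hence "fourier (\<lambda>x::real ^ 'm. \<Prod>j\<in>UNIV. p (x $ j)) \<xi> = (\<Prod>b\<in>Basis. fourier p (\<xi> \<bullet> b))"
    unfolding fourier_def using integral_prod_lborel[of "\<lambda>b x. cis (- ((\<xi> \<bullet> b) \<bullet> x)) * p x", OF i] by simp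
  thus ?thesis using prod_Basis_vec[of "\<lambda>_. fourier p" \<xi>] by simp
qed

section \<open>The building blocks\<close>

lemma
  fixes f :: "'a::euclidean_space \<Rightarrow> 'c::{real_normed_field,banach,second_countable_topology}"
    and g :: "'b::euclidean_space \<Rightarrow> 'c"
  assumes f: "integrable lborel f" and g: "integrable lborel g"
  shows integrable_tensor: "integrable lborel (\<lambda>x. f (fst x) * g (snd x))" (is "integrable lborel ?h")
    and integral_tensor: "(LINT x|lborel. f (fst x) * g (snd x)) = (LINT x|lborel. f x) * (LINT x|lborel. g x)"
proof -
  have [measurable]: "f \<in> borel_measurable borel" "g \<in> borel_measurable borel"
    using f g by (auto dest: borel_measurable_integrable)
  have i: "integrable (lborel \<Otimes>\<^sub>M lborel) ?h"
  proof (rule lborel_pair.Fubini_integrable)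
    show "integrable lborel (\<lambda>x. LINT y|lborel. norm (f (fst (x, y)) * g (snd (x, y))))"
      using f by (simp add: norm_mult)
    show "AE x in lborel. integrable lborel (\<lambda>y. f (fst (x, y)) * g (snd (x, y)))"
      using g by simp
  qed measurable
  thus "integrable lborel ?h" by (simp add: lborel_prod)
  have "(LINT x|lborel. f (fst x) * g (snd x)) = (LINT x|lborel. LINT y|lborel. f x * g y)"
    using lborel_pair.integral_fst'[OF i] by (simp add: lborel_prod)
  thus "(LINT x|lborel. f (fst x) * g (snd x)) = (LINT x|lborel. f x) * (LINT x|lborel. g x)" by simp
qed

lemma fourier_tensor:
  fixes f :: "'a::euclidean_space \<Rightarrow> complex" and g :: "'b::euclidean_space \<Rightarrow> complex"
  assumes f: "integrable lborel f" and g: "integrable lborel g"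
  shows "fourier (\<lambda>x. f (fst x) * g (snd x)) \<xi> = fourier f (fst \<xi>) * fourier g (snd \<xi>)"
proof -
  have "cis (- (\<xi> \<bullet> x)) * (f (fst x) * g (snd x)) =
      (cis (- (fst \<xi> \<bullet> fst x)) * f (fst x)) * (cis (- (snd \<xi> \<bullet> snd x)) * g (snd x))" for x
  proof -
    have "cis (- (\<xi> \<bullet> x)) = cis (- (fst \<xi> \<bullet> fst x)) * cis (- (snd \<xi> \<bullet> snd x))"
      by (simp add: inner_prod_def cis_mult)
    thus ?thesis by (simp add: mult_ac)
  qed
  note e = this
  show ?thesis unfolding fourier_def e
    by (rule integral_tensor[of "\<lambda>x. cis (- (fst \<xi> \<bullet> x)) * f x" "\<lambda>x. cis (- (snd \<xi> \<bullet> x)) * g x"];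
        rule integrable_bounded_mult(1)[where B = 1]; simp add: f g)
qed

lemma schrodinger_tensor:
  fixes f :: "'a::euclidean_space \<Rightarrow> complex" and g :: "'b::euclidean_space \<Rightarrow> complex"
  assumes f: "integrable lborel f" "integrable lborel (fourier f)"
    and g: "integrable lborel g" "integrable lborel (fourier g)"
  shows "schrodinger t (\<lambda>x. f (fst x) * g (snd x)) x = schrodinger t f (fst x) * schrodinger t g (snd x)"
proof -
  let ?F = "\<lambda>\<xi>. cis (\<xi> \<bullet> fst x) * cis (t * (norm \<xi>)\<^sup>2) * fourier f \<xi>"
  let ?G = "\<lambda>\<xi>. cis (\<xi> \<bullet> snd x) * cis (t * (norm \<xi>)\<^sup>2) * fourier g \<xi>"
  have "cis (\<xi> \<bullet> x) * cis (t * (norm \<xi>)\<^sup>2) * fourier (\<lambda>x. f (fst x) * g (snd x)) \<xi> = ?F (fst \<xi>) * ?G (snd \<xi>)" for \<xi>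
  proof -
    have "cis (\<xi> \<bullet> x) = cis (fst \<xi> \<bullet> fst x) * cis (snd \<xi> \<bullet> snd x)"
      by (simp add: inner_prod_def cis_mult)
    moreover have "cis (t * (norm \<xi>)\<^sup>2) = cis (t * (norm (fst \<xi>))\<^sup>2) * cis (t * (norm (snd \<xi>))\<^sup>2)"
      by (simp add: norm_prod_def cis_mult distrib_left)
    ultimately show ?thesis unfolding fourier_tensor[OF f(1) g(1)] by (simp add: mult_ac)
  qed
  moreover have "integrable lborel ?F" "integrable lborel ?G"
    by (intro integrable_bounded_mult(1)[where B = 1] f g; simp add: norm_mult)+
  ultimately show ?thesis unfolding schrodinger_def using integral_tensor[of ?F ?G] by simp
qed

lemma norm_schrodinger_le: "norm (schrodinger t f x) \<le> (LINT \<xi>|lborel. norm (fourier f \<xi>))"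
proof -
  have "norm (schrodinger t f x) \<le> (LINT \<xi>|lborel. norm (cis (\<xi> \<bullet> x) * cis (t * (norm \<xi>)\<^sup>2) * fourier f \<xi>))"
    unfolding schrodinger_def by (rule integral_norm_bound)
  thus ?thesis by (simp add: norm_mult)
qed

lemma norm_cis_minus_1_le: "norm (cis a - 1) \<le> \<bar>a\<bar>"
  using iexp_approx1[of a 0] by (simp add: cis_conv_exp)

section \<open>The factor in the first variable\<close>

lemma integral_real_affine_pos:
  fixes F :: "real \<Rightarrow> real"
  assumes "v > 0"
  shows "(LINT x|lborel. F (a + v * x)) = (LINT x|lborel. F x) / v"
  using assms lborel_integral_real_affine[of v F a] by (simp add: field_simps)

text \<open>The weight (1 + |y|)^2 dominates the square of the rescaled frequency, which occurs in
  the short-time estimate and in the Sobolev weight.\<close>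

lemma schwartz_moments:
  fixes g :: "real \<Rightarrow> complex"
  assumes g: "schwartz g"
  shows "integrable lborel (\<lambda>y. (1 + \<bar>y\<bar>)\<^sup>2 * norm (g y))"
    and "integrable lborel (\<lambda>y. (1 + \<bar>y\<bar>)\<^sup>2 * (norm (g y))\<^sup>2)"
proof -
  note [measurable] = schwartz_measurable[OF g]
  \<comment> \<open>Four powers: two for the weight and two to produce the one-dimensional
    \<open>decay\<close>.\<close>
  obtain B where "\<And>x. (1 + norm x) ^ 4 * cmod (partials [] g x) \<le> B"
    using g unfolding schwartz_def by (metis empty_subsetI list.set(1))
  hence B: "(1 + \<bar>x\<bar>) ^ 4 * norm (g x) \<le> B" for x by simp
  have d: "(1 + \<bar>y\<bar>)\<^sup>2 * norm (g y) \<le> B * decay y" for y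
  proof -
    have "1 \<le> decay y * (1 + norm y) ^ (2 * DIM(real))" by (rule decay_inverse_le)
    hence 1: "1 \<le> decay y * (1 + \<bar>y\<bar>)\<^sup>2" by simp
    have "(1 + \<bar>y\<bar>)\<^sup>2 * norm (g y) * 1 \<le> (1 + \<bar>y\<bar>)\<^sup>2 * norm (g y) * (decay y * (1 + \<bar>y\<bar>)\<^sup>2)"
      by (intro mult_left_mono 1) auto
    also have "\<dots> = ((1 + \<bar>y\<bar>) ^ 4 * norm (g y)) * decay y" by (simp add: eval_nat_numeral)
    also have "\<dots> \<le> B * decay y" by (intro mult_right_mono B) auto
    finally show ?thesis by simp
  qed
  show 1: "integrable lborel (\<lambda>y. (1 + \<bar>y\<bar>)\<^sup>2 * norm (g y))"
    by (rule integrable_le_decay[where B = B]) (use d in auto)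
  have bd: "norm (g y) \<le> B" for y
  proof -
    have "1 * norm (g y) \<le> (1 + \<bar>y\<bar>) ^ 4 * norm (g y)" by (intro mult_right_mono) auto
    thus ?thesis using B[of y] by simp
  qed
  show "integrable lborel (\<lambda>y. (1 + \<bar>y\<bar>)\<^sup>2 * (norm (g y))\<^sup>2)"
  proof (rule Bochner_Integration.integrable_bound)
    show "integrable lborel (\<lambda>y. B * ((1 + \<bar>y\<bar>)\<^sup>2 * norm (g y)))" using 1 by simp
    have "(1 + \<bar>y\<bar>)\<^sup>2 * (norm (g y))\<^sup>2 \<le> B * ((1 + \<bar>y\<bar>)\<^sup>2 * norm (g y))" for y
      using mult_right_mono[OF bd[of y], of "(1 + \<bar>y\<bar>)\<^sup>2 * norm (g y)"] by (simp add: power2_eq_square mult_ac)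
    note le = this
    show "AE y in lborel. norm ((1 + \<bar>y\<bar>)\<^sup>2 * (norm (g y))\<^sup>2) \<le> norm (B * ((1 + \<bar>y\<bar>)\<^sup>2 * norm (g y)))"
    proof (rule AE_I2)
      fix y
      have "norm ((1 + \<bar>y\<bar>)\<^sup>2 * (norm (g y))\<^sup>2) = (1 + \<bar>y\<bar>)\<^sup>2 * (norm (g y))\<^sup>2" by simp
      also have "\<dots> \<le> norm (B * ((1 + \<bar>y\<bar>)\<^sup>2 * norm (g y)))"
        unfolding real_norm_def by (rule order_trans[OF le abs_ge_self])
      finally show "norm ((1 + \<bar>y\<bar>)\<^sup>2 * (norm (g y))\<^sup>2) \<le> norm (B * ((1 + \<bar>y\<bar>)\<^sup>2 * norm (g y)))" .
    qed
  qed measurable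
qed

text \<open>1 / v + v \<xi> is the point at which g is evaluated in the transform of
  \<open>f_part\<close>. Measured in units of 1 / v^2, frequencies are thus controlled by moments of
  g.\<close>

lemma abs_frequency_le:
  fixes v \<xi> :: real
  assumes "0 < v" "v < 1"
  shows "\<bar>\<xi>\<bar> * v\<^sup>2 \<le> 1 + \<bar>1 / v + v * \<xi>\<bar>"
proof -
  define y where "y = 1 / v + v * \<xi>"
  have "\<xi> * v\<^sup>2 = v * y - 1" using assms by (simp add: y_def field_simps power2_eq_square)
  moreover have "\<bar>\<xi>\<bar> * v\<^sup>2 = \<bar>\<xi> * v\<^sup>2\<bar>" by (simp add: abs_mult)
  ultimately have "\<bar>\<xi>\<bar> * v\<^sup>2 = \<bar>v * y - 1\<bar>" by simp
  also have "\<dots> \<le> \<bar>v * y\<bar> + 1" by simp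
  also have "\<dots> \<le> 1 + \<bar>y\<bar>" using assms by (simp add: abs_mult mult_left_le_one_le)
  finally show ?thesis by (simp add: y_def)
qed

text \<open>Rescaling by v turns the modulation frequency -1 / v^2 into the shift 1 / v of the
  argument.\<close>

lemma fourier_f_part:
  assumes "v > 0" "integrable lborel (inv_fourier g)" "fourier (inv_fourier g) = g"
  shows "fourier (f_part g v) \<xi> = of_real v * g (1 / v + v * \<xi>)"
proof -
  have "fourier (f_part g v) \<xi> = \<bar>v\<bar> *\<^sub>R (LINT y|lborel. cis (- (\<xi> \<bullet> (0 + v * y))) * f_part g v (0 + v * y))"
    unfolding fourier_def using assms(1) by (intro lborel_integral_real_affine) auto
  also have "(\<lambda>y. cis (- (\<xi> \<bullet> (0 + v * y))) * f_part g v (0 + v * y)) = (\<lambda>y. cis (- ((1 / v + v * \<xi>) \<bullet> y)) * inv_fourier g y)"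
  proof
    fix y
    have "cis (- (\<xi> \<bullet> (0 + v * y))) * cis (- ((0 + v * y) / v\<^sup>2)) = cis (- ((1 / v + v * \<xi>) \<bullet> y))"
      unfolding cis_mult using assms(1) by (intro arg_cong[of _ _ cis]) (simp add: field_simps power2_eq_square)
    thus "cis (- (\<xi> \<bullet> (0 + v * y))) * f_part g v (0 + v * y) = cis (- ((1 / v + v * \<xi>) \<bullet> y)) * inv_fourier g y"
      using assms(1) unfolding f_part_def by (simp add: mult.assoc[symmetric])
  qed
  also have "(LINT y|lborel. cis (- ((1 / v + v * \<xi>) \<bullet> y)) * inv_fourier g y) = g (1 / v + v * \<xi>)"
    using fun_cong[OF assms(3), of "1 / v + v * \<xi>"] unfolding fourier_def .
  finally show ?thesis using assms(1) by (simp add: scaleR_conv_of_real)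
qed

lemma inv_fourier_eq_fourier: "inv_fourier g x = complex_of_real ((2 * pi) powr (- real DIM('a))) * fourier g (- x)"
  for g :: "'a::euclidean_space \<Rightarrow> complex"
  by (simp add: inv_fourier_def fourier_def inner_commute)

text \<open>By inversion the mean at time 0 vanishes off the support, and the difference of the means at
  the times t and 0 is controlled by the second moment of the Fourier transform.\<close>

lemma norm_schrodinger_f_part_le:
  assumes v: "0 < v" "v < 1" and g: "schwartz g" and x: "inv_fourier g (x / v) = 0"
    and F: "\<And>\<xi>. fourier (f_part g v) \<xi> = of_real v * g (1 / v + v * \<xi>)"
  shows "norm (schrodinger t (f_part g v) x) \<le> \<bar>t\<bar> * (LINT y|lborel. (1 + \<bar>y\<bar>)\<^sup>2 * norm (g y)) / v ^ 4"
proof -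
  note gi = schwartz_integrable[OF g]
  note [measurable] = schwartz_measurable[OF g]
  have Fi: "integrable lborel (\<lambda>\<xi>. of_real v * g (1 / v + v * \<xi>))"
    using lborel_integrable_real_affine[OF gi, of v "1 / v"] v by simp
  have 0: "(LINT \<xi>|lborel. cis (\<xi> * x) * (of_real v * g (1 / v + v * \<xi>))) = 0"
  proof -
    have "0 = (LINT y|lborel. cis (y * (x / v)) * g y)"
      using x by (simp add: inv_fourier_def)
    also have "\<dots> = \<bar>v\<bar> *\<^sub>R (LINT \<xi>|lborel. cis ((1 / v + v * \<xi>) * (x / v)) * g (1 / v + v * \<xi>))"
      using v by (intro lborel_integral_real_affine) auto
    also have "\<dots> = cis (x / v\<^sup>2) * (LINT \<xi>|lborel. cis (\<xi> * x) * (of_real v * g (1 / v + v * \<xi>)))"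
    proof -
      have "cis ((1 / v + v * \<xi>) * (x / v)) = cis (x / v\<^sup>2) * cis (\<xi> * x)" for \<xi>
        unfolding cis_mult using v by (intro arg_cong[of _ _ cis]) (simp add: field_simps power2_eq_square)
      hence e: "(\<lambda>\<xi>. cis ((1 / v + v * \<xi>) * (x / v)) * g (1 / v + v * \<xi>)) =
          (\<lambda>\<xi>. cis (x / v\<^sup>2) * (cis (\<xi> * x) * g (1 / v + v * \<xi>)))"
        by (simp add: mult.assoc)
      have e': "(\<lambda>\<xi>. cis (\<xi> * x) * (of_real v * g (1 / v + v * \<xi>))) =
          (\<lambda>\<xi>. of_real v * (cis (\<xi> * x) * g (1 / v + v * \<xi>)))"
        by (simp add: mult_ac)
      show ?thesis unfolding e e' integral_mult_right_zero using v by (simp add: scaleR_conv_of_real)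
    qed
    finally show ?thesis by simp
  qed
  have i1: "integrable lborel (\<lambda>\<xi>. cis (\<xi> * x) * cis (t * \<xi>\<^sup>2) * (of_real v * g (1 / v + v * \<xi>)))"
    by (rule integrable_bounded_mult(1)[OF Fi, where B = 1]) (auto simp: norm_mult)
  have i2: "integrable lborel (\<lambda>\<xi>. cis (\<xi> * x) * (of_real v * g (1 / v + v * \<xi>)))"
    by (rule integrable_bounded_mult(1)[OF Fi, where B = 1]) auto
  have e: "cis (\<xi> * x) * (cis (t * \<xi>\<^sup>2) - 1) * (of_real v * g (1 / v + v * \<xi>)) =
      cis (\<xi> * x) * cis (t * \<xi>\<^sup>2) * (of_real v * g (1 / v + v * \<xi>)) - cis (\<xi> * x) * (of_real v * g (1 / v + v * \<xi>))" for \<xi>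
    by (simp add: left_diff_distrib right_diff_distrib)
  have "schrodinger t (f_part g v) x = (LINT \<xi>|lborel. cis (\<xi> * x) * cis (t * \<xi>\<^sup>2) * (of_real v * g (1 / v + v * \<xi>)))
      - (LINT \<xi>|lborel. cis (\<xi> * x) * (of_real v * g (1 / v + v * \<xi>)))"
    unfolding 0 by (simp add: schrodinger_def F)
  also have "\<dots> = (LINT \<xi>|lborel. cis (\<xi> * x) * (cis (t * \<xi>\<^sup>2) - 1) * (of_real v * g (1 / v + v * \<xi>)))"
    unfolding e by (rule Bochner_Integration.integral_diff[OF i1 i2, symmetric])
  finally have S: "schrodinger t (f_part g v) x =
      (LINT \<xi>|lborel. cis (\<xi> * x) * (cis (t * \<xi>\<^sup>2) - 1) * (of_real v * g (1 / v + v * \<xi>)))" .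
  have "norm (schrodinger t (f_part g v) x) \<le> (LINT \<xi>|lborel. norm (cis (\<xi> * x) * (cis (t * \<xi>\<^sup>2) - 1) * (of_real v * g (1 / v + v * \<xi>))))"
    unfolding S by (rule integral_norm_bound)
  also have "\<dots> \<le> (LINT \<xi>|lborel. \<bar>t\<bar> / v ^ 3 * ((1 + \<bar>1 / v + v * \<xi>\<bar>)\<^sup>2 * norm (g (1 / v + v * \<xi>))))"
  proof (rule integral_mono)
    show "integrable lborel (\<lambda>\<xi>. norm (cis (\<xi> * x) * (cis (t * \<xi>\<^sup>2) - 1) * (of_real v * g (1 / v + v * \<xi>))))"
      unfolding e by (rule integrable_norm[OF Bochner_Integration.integrable_diff[OF i1 i2]])
    show "integrable lborel (\<lambda>\<xi>. \<bar>t\<bar> / v ^ 3 * ((1 + \<bar>1 / v + v * \<xi>\<bar>)\<^sup>2 * norm (g (1 / v + v * \<xi>))))"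
      using lborel_integrable_real_affine[OF schwartz_moments(1)[OF g], of v "1 / v"] v by (intro integrable_mult_right) simp
    fix \<xi> :: real
    define y where "y = 1 / v + v * \<xi>"
    have "(\<bar>\<xi>\<bar> * v\<^sup>2)\<^sup>2 \<le> (1 + \<bar>y\<bar>)\<^sup>2"
      unfolding y_def by (intro power_mono abs_frequency_le v) auto
    hence "\<xi>\<^sup>2 * v ^ 4 \<le> (1 + \<bar>y\<bar>)\<^sup>2" by (simp add: power_mult_distrib flip: power_mult)
    hence "\<xi>\<^sup>2 * v \<le> (1 + \<bar>y\<bar>)\<^sup>2 / v ^ 3" using v by (simp add: pos_le_divide_eq mult.assoc flip: power_Suc)
    hence a: "\<bar>t\<bar> * (\<xi>\<^sup>2 * v) \<le> \<bar>t\<bar> * ((1 + \<bar>y\<bar>)\<^sup>2 / v ^ 3)" by (intro mult_left_mono) auto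
    have "norm (cis (\<xi> * x) * (cis (t * \<xi>\<^sup>2) - 1) * (of_real v * g y)) \<le> \<bar>t * \<xi>\<^sup>2\<bar> * (v * norm (g y))"
      using v norm_cis_minus_1_le[of "t * \<xi>\<^sup>2"] by (simp add: norm_mult mult_right_mono)
    also have "\<dots> = \<bar>t\<bar> * (\<xi>\<^sup>2 * v) * norm (g y)" by (simp add: abs_mult)
    also have "\<dots> \<le> \<bar>t\<bar> * ((1 + \<bar>y\<bar>)\<^sup>2 / v ^ 3) * norm (g y)" by (rule mult_right_mono[OF a]) simp
    finally show "norm (cis (\<xi> * x) * (cis (t * \<xi>\<^sup>2) - 1) * (of_real v * g (1 / v + v * \<xi>))) \<le>
        \<bar>t\<bar> / v ^ 3 * ((1 + \<bar>1 / v + v * \<xi>\<bar>)\<^sup>2 * norm (g (1 / v + v * \<xi>)))"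
      by (simp add: y_def)
  qed
  \<comment> \<open>Three powers of v come from the pointwise bound; the change of variables
    contributes the fourth.\<close>
  also have "\<dots> = \<bar>t\<bar> / v ^ 3 * ((LINT y|lborel. (1 + \<bar>y\<bar>)\<^sup>2 * norm (g y)) / v)"
    using integral_real_affine_pos[OF v(1), of "\<lambda>y. (1 + \<bar>y\<bar>)\<^sup>2 * norm (g y)" "1 / v"] by simp
  also have "\<dots> = \<bar>t\<bar> * (LINT y|lborel. (1 + \<bar>y\<bar>)\<^sup>2 * norm (g y)) / v ^ 4"
    using v by (simp add: eval_nat_numeral)
  finally show ?thesis .
qed

text \<open>\<open>inv_fourier g\<close> is continuous and vanishes off the unit interval, hence is
  integrable, so inversion returns g as its transform. The estimates are then rescalings of fixed
  integrals.\<close>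

lemma f_part_bounds:
  assumes g: "schwartz g" and supp: "closure {x. inv_fourier g x \<noteq> 0} \<subseteq> {-1<..<1}"
  obtains A where "A \<ge> 1"
    "\<And>v x. 0 < v \<Longrightarrow> v \<le> \<bar>x\<bar> \<Longrightarrow> f_part g v x = 0"
    "\<And>v. 0 < v \<Longrightarrow> integrable lborel (f_part g v)"
    "\<And>v. 0 < v \<Longrightarrow> (LINT x|lborel. norm (f_part g v x)) \<le> A * v"
    "\<And>v. 0 < v \<Longrightarrow> integrable lborel (\<lambda>x. (norm (f_part g v x))\<^sup>2)"
    "\<And>v. 0 < v \<Longrightarrow> (LINT x|lborel. (norm (f_part g v x))\<^sup>2) \<le> A * v"
    "\<And>v \<xi>. 0 < v \<Longrightarrow> fourier (f_part g v) \<xi> = of_real v * g (1 / v + v * \<xi>)"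
    "\<And>v t x. 0 < v \<Longrightarrow> v < 1 \<Longrightarrow> v \<le> \<bar>x\<bar> \<Longrightarrow> norm (schrodinger t (f_part g v) x) \<le> A * \<bar>t\<bar> / v ^ 4"
proof -
  let ?\<chi> = "inv_fourier g"
  note gi = schwartz_integrable[OF g]
  have \<chi>0: "?\<chi> x = 0" if "1 \<le> \<bar>x\<bar>" for x
  proof (rule ccontr)
    assume "?\<chi> x \<noteq> 0"
    hence "x \<in> closure {x. ?\<chi> x \<noteq> 0}" using closure_subset[of "{x. ?\<chi> x \<noteq> 0}"] by auto
    hence "x \<in> {-1<..<1}" using supp by (rule rev_subsetD)
    hence "\<bar>x\<bar> < 1" by (simp add: abs_less_iff)
    thus False using that by simp
  qed
  have \<chi>_cont: "continuous_on UNIV ?\<chi>"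
    unfolding inv_fourier_eq_fourier[abs_def]
    by (intro continuous_intros continuous_on_compose2[OF continuous_on_fourier[OF gi]]) auto
  have [measurable]: "?\<chi> \<in> borel_measurable borel" by (rule borel_measurable_continuous_onI[OF \<chi>_cont])
  define M where "M = (LINT x|lborel. norm (g x)) + 1"
  have M: "M \<ge> 1" unfolding M_def by (simp add: Bochner_Integration.integral_nonneg)
  have \<chi>_bd: "norm (?\<chi> x) \<le> M" for x
  proof -
    have c: "\<bar>(2 * pi) powr (- real DIM(real))\<bar> \<le> 1" using pi_ge_two by (simp add: powr_minus_divide)
    hence "norm (?\<chi> x) \<le> 1 * norm (fourier g (- x))"
      unfolding inv_fourier_eq_fourier norm_mult norm_of_real by (rule mult_right_mono) simp
    also have "\<dots> \<le> M" using norm_fourier_le[of g "- x"] by (simp add: M_def)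
    finally show ?thesis .
  qed
  have half: "1 \<le> 2 * decay x" if "\<bar>x\<bar> < 1" for x :: real
  proof -
    have "x\<^sup>2 \<le> 1" using that by (simp add: abs_square_le_1)
    thus ?thesis by (simp add: decay_real field_simps add_pos_nonneg)
  qed
  have \<chi>_le: "norm (?\<chi> x) \<le> 2 * M * decay x" for x
  proof (cases "\<bar>x\<bar> < 1")
    case True
    have "M * 1 \<le> M * (2 * decay x)" using M by (intro mult_left_mono half True) auto
    thus ?thesis using \<chi>_bd[of x] by simp
  next
    case False thus ?thesis using \<chi>0[of x] M by simp
  qed
  have \<chi>i: "integrable lborel ?\<chi>" by (rule integrable_le_decay[OF _ \<chi>_le]) measurable
  have \<chi>2_le: "(norm (?\<chi> x))\<^sup>2 \<le> M * norm (?\<chi> x)" for x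
    unfolding power2_eq_square by (intro mult_right_mono \<chi>_bd) auto
  have \<chi>2i: "integrable lborel (\<lambda>x. (norm (?\<chi> x))\<^sup>2)"
  proof (rule Bochner_Integration.integrable_bound)
    show "integrable lborel (\<lambda>x. M * norm (?\<chi> x))" using \<chi>i by simp
    show "AE x in lborel. norm ((norm (?\<chi> x))\<^sup>2) \<le> norm (M * norm (?\<chi> x))"
      using \<chi>2_le M by (intro AE_I2) (simp add: abs_mult)
  qed measurable
  have bounded_g: "norm (g x) \<le> Bg * decay x \<Longrightarrow> norm (g x) \<le> \<bar>Bg\<bar>" for x Bg
  proof -
    assume "norm (g x) \<le> Bg * decay x"
    moreover have "Bg * decay x \<le> \<bar>Bg\<bar> * 1" by (intro mult_mono) (auto intro: decay_le_1)
    ultimately show ?thesis by simp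
  qed
  obtain Bg where Bg: "\<And>x. norm (g x) \<le> Bg * decay x" using schwartz_le_decay[OF g] by blast
  have inv: "fourier ?\<chi> = g"
    using fourier_inv_fourier[OF gi schwartz_continuous[OF g] bounded_g[OF Bg] \<chi>i] by auto
  have Ff: "fourier (f_part g v) \<xi> = of_real v * g (1 / v + v * \<xi>)" if "0 < v" for v \<xi>
    using fourier_f_part[OF that \<chi>i inv] .
  define J0 where "J0 = (LINT y|lborel. (1 + \<bar>y\<bar>)\<^sup>2 * norm (g y))"
  define I1 where "I1 = (LINT x|lborel. norm (?\<chi> x))"
  define I2 where "I2 = (LINT x|lborel. (norm (?\<chi> x))\<^sup>2)"
  have nn: "J0 \<ge> 0" "I1 \<ge> 0" "I2 \<ge> 0"
    unfolding J0_def I1_def I2_def by (rule Bochner_Integration.integral_nonneg; simp)+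
  define A where "A = 1 + J0 + I1 + I2"
  have A: "A \<ge> 1" "J0 \<le> A" "I1 \<le> A" "I2 \<le> A" using nn by (auto simp: A_def)
  have nf: "norm (f_part g v x) = norm (?\<chi> (x / v))" for v x by (simp add: f_part_def norm_mult)
  show ?thesis
  proof (rule that[OF A(1) _ _ _ _ _ Ff])
    fix v :: real assume v: "0 < v"
    show "f_part g v x = 0" if "v \<le> \<bar>x\<bar>" for x
      using \<chi>0[of "x / v"] v that by (simp add: f_part_def)
    have "integrable lborel (\<lambda>x. ?\<chi> (0 + (1 / v) * x))"
      using v by (intro lborel_integrable_real_affine \<chi>i) auto
    thus i: "integrable lborel (f_part g v)"
      unfolding f_part_def[abs_def] by (intro integrable_bounded_mult(1)[where B = 1]) auto
    have "(LINT x|lborel. norm (f_part g v x)) = I1 / (1 / v)"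
      unfolding nf I1_def using integral_real_affine_pos[of "1 / v" "\<lambda>x. norm (?\<chi> x)" 0] v by simp
    thus "(LINT x|lborel. norm (f_part g v x)) \<le> A * v" using A v by (simp add: mult_right_mono)
    show "integrable lborel (\<lambda>x. (norm (f_part g v x))\<^sup>2)"
      unfolding nf using lborel_integrable_real_affine[OF \<chi>2i, of "1 / v" 0] v by simp
    have "(LINT x|lborel. (norm (f_part g v x))\<^sup>2) = I2 / (1 / v)"
      unfolding nf I2_def using integral_real_affine_pos[of "1 / v" "\<lambda>x. (norm (?\<chi> x))\<^sup>2" 0] v by simp
    thus "(LINT x|lborel. (norm (f_part g v x))\<^sup>2) \<le> A * v" using A v by (simp add: mult_right_mono)
    show "norm (schrodinger t (f_part g v) x) \<le> A * \<bar>t\<bar> / v ^ 4" if "v < 1" "v \<le> \<bar>x\<bar>" for t x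
    proof -
      have "?\<chi> (x / v) = 0" using v that by (intro \<chi>0) simp
      hence "norm (schrodinger t (f_part g v) x) \<le> \<bar>t\<bar> * J0 / v ^ 4"
        unfolding J0_def using Ff[OF v] by (intro norm_schrodinger_f_part_le v that g)
      also have "\<dots> \<le> \<bar>t\<bar> * A / v ^ 4" using A v by (intro divide_right_mono mult_left_mono) auto
      finally show ?thesis by (simp add: mult.commute)
    qed
  qed
qed

section \<open>The factor in the remaining variables\<close>

lemma card_frequencies_le:
  fixes R D :: real
  assumes "R > 0" "D > 0"
  shows "finite {l::int. R / (2 * D) < of_int l \<and> of_int l < R / D}"
    and "real (card {l::int. R / (2 * D) < of_int l \<and> of_int l < R / D}) \<le> R / D"
proof -
  have sub: "{l::int. R / (2 * D) < of_int l \<and> of_int l < R / D} \<subseteq> {1..\<lfloor>R / D\<rfloor>}"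
  proof
    fix l :: int assume l: "l \<in> {l. R / (2 * D) < of_int l \<and> of_int l < R / D}"
    have "0 < R / (2 * D)" using assms by simp
    with l have "(0::real) < of_int l" by (simp del: of_int_0_less_iff)
    with l show "l \<in> {1..\<lfloor>R / D\<rfloor>}" by (auto simp: le_floor_iff)
  qed
  show "finite {l::int. R / (2 * D) < of_int l \<and> of_int l < R / D}" by (rule finite_subset[OF sub]) simp
  have "card {l::int. R / (2 * D) < of_int l \<and> of_int l < R / D} \<le> nat \<lfloor>R / D\<rfloor>"
    using card_mono[OF _ sub] by simp
  moreover have "real (nat \<lfloor>R / D\<rfloor>) \<le> R / D" using assms by (simp add: of_nat_nat)
  ultimately show "real (card {l::int. R / (2 * D) < of_int l \<and> of_int l < R / D}) \<le> R / D" by linarith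
qed

text \<open>The exponent \<open>- (d + 1) / (d + 2)\<close> is that of \<open>R / D\<close> as a power of \<open>v\<close>, with
  \<open>R = 1 / v\<^sup>2\<close> and \<open>n = d + 1\<close>.\<close>

lemma G_part_eq_prod_packet:
  fixes \<Phi> :: "real ^ 'm \<Rightarrow> complex"
  assumes \<Phi>: "\<And>x'. \<Phi> x' = (\<Prod>j\<in>UNIV. \<psi> (x' $ j))" and v: "0 < v" "v < 1"
  defines "d \<equiv> real CARD('m)"
  obtains D L where "D \<ge> 1" "finite L" "real (card L) \<le> v powr (- (d + 1) / (d + 2))"
    "\<And>l. l \<in> L \<Longrightarrow> 0 < D * of_int l \<and> D * of_int l < 1 / v\<^sup>2"
    "G_part \<Phi> v = (\<lambda>x. of_real (v powr (d / 2)) * (\<Prod>j\<in>UNIV. packet \<psi> D L (x $ j)))"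
proof -
  define R where "R = 1 / v\<^sup>2"
  have Rv: "R = v powr (- 2)" using v by (simp add: R_def powr_minus_divide)
  define D where "D = R powr ((d + 1 + 2) / (2 * (d + 1 + 1)))"
  define L where "L = {l::int. R / (2 * D) < of_int l \<and> of_int l < R / D}"
  have d: "d \<ge> 0" by (simp add: d_def)
  have R: "R > 1" using v by (simp add: R_def power_less_one_iff)
  have D: "D \<ge> 1" unfolding D_def using R d by (intro ge_one_powr_ge_zero) auto
  have "R / D = R powr (1 - (d + 1 + 2) / (2 * (d + 1 + 1)))"
    using R by (simp add: D_def powr_diff)
  also have "\<dots> = v powr (- 2 * (1 - (d + 1 + 2) / (2 * (d + 1 + 1))))"
    unfolding Rv powr_powr ..
  also have "- 2 * (1 - (d + 1 + 2) / (2 * (d + 1 + 1))) = - (d + 1) / (d + 2)"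
    using d by (simp add: field_simps)
  finally have RD: "R / D = v powr (- (d + 1) / (d + 2))" .
  show ?thesis
  proof (rule that[OF D])
    show "finite L" unfolding L_def using R D by (intro card_frequencies_le) auto
    show "real (card L) \<le> v powr (- (d + 1) / (d + 2))"
      unfolding RD[symmetric] L_def using R D by (intro card_frequencies_le) auto
    show "0 < D * of_int l \<and> D * of_int l < 1 / v\<^sup>2" if "l \<in> L" for l
    proof -
      have l: "R / (2 * D) < of_int l" "of_int l < R / D" using that by (auto simp: L_def)
      moreover have "0 < R / (2 * D)" using R D by simp
      ultimately have "(0::real) < of_int l" by linarith
      moreover have "D * of_int l < R" using l(2) D by (simp add: pos_less_divide_eq mult.commute)
      ultimately show ?thesis using D by (simp add: R_def)
    qed
    have n: "real DIM(real \<times> (real ^ 'm)) = d + 1" by (simp add: d_def)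
    have "R powr (- (d + 1 - 1) / 4) = v powr (d / 2)" unfolding Rv powr_powr by simp
    thus "G_part \<Phi> v = (\<lambda>x. of_real (v powr (d / 2)) * (\<Prod>j\<in>UNIV. packet \<psi> D L (x $ j)))"
      unfolding G_part_def Let_def n R_def[symmetric] D_def[symmetric] L_def[symmetric]
      by (simp add: \<Phi> packet_def exp_sum_freq_def prod.distrib mult.assoc)
  qed
qed

text \<open>Each bound is the d-th power of the corresponding packet bound times the normalising
  factor v^(d/2) or its square. The exact count of frequencies matters for the transform in
  \<open>L^2\<close>: it leaves the positive power d - d (d + 1) / (d + 2) = d / (d + 2) of v, the
  source of the Sobolev threshold.\<close>

lemma G_part_bounds:
  fixes \<Phi> :: "real ^ 'm \<Rightarrow> complex"
  assumes \<psi>: "schwartz \<psi>" and \<Phi>: "\<And>x'. \<Phi> x' = (\<Prod>j\<in>UNIV. \<psi> (x' $ j))"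
    and supp: "closure {\<xi>. fourier \<Phi> \<xi> \<noteq> 0} \<subseteq> ball 0 1"
  defines "d \<equiv> real CARD('m)"
  obtains A where "A \<ge> 1"
    "\<And>v. 0 < v \<Longrightarrow> v < 1 \<Longrightarrow> integrable lborel (G_part \<Phi> v)"
    "\<And>v. 0 < v \<Longrightarrow> v < 1 \<Longrightarrow> (LINT x|lborel. norm (G_part \<Phi> v x)) \<le> A"
    "\<And>v. 0 < v \<Longrightarrow> v < 1 \<Longrightarrow> integrable lborel (\<lambda>x. (norm (G_part \<Phi> v x))\<^sup>2)"
    "\<And>v. 0 < v \<Longrightarrow> v < 1 \<Longrightarrow> (LINT x|lborel. (norm (G_part \<Phi> v x))\<^sup>2) \<le> A"
    "\<And>v. 0 < v \<Longrightarrow> v < 1 \<Longrightarrow> integrable lborel (fourier (G_part \<Phi> v))"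
    "\<And>v. 0 < v \<Longrightarrow> v < 1 \<Longrightarrow> (LINT x|lborel. norm (fourier (G_part \<Phi> v) x)) \<le> A * v powr (- d / 2)"
    "\<And>v. 0 < v \<Longrightarrow> v < 1 \<Longrightarrow> integrable lborel (\<lambda>x. (norm (fourier (G_part \<Phi> v) x))\<^sup>2)"
    "\<And>v. 0 < v \<Longrightarrow> v < 1 \<Longrightarrow> (LINT x|lborel. (norm (fourier (G_part \<Phi> v) x))\<^sup>2) \<le> A * v powr (d / (d + 2))"
    "\<And>v \<xi>. 0 < v \<Longrightarrow> v < 1 \<Longrightarrow> fourier (G_part \<Phi> v) \<xi> \<noteq> 0 \<Longrightarrow> (norm \<xi>)\<^sup>2 \<le> d * (1 / v\<^sup>2 + 1)\<^sup>2"
proof -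
  have \<Phi>': "\<Phi> = (\<lambda>x. \<Prod>j\<in>UNIV. \<psi> (x $ j))" using \<Phi> by auto
  \<comment> \<open>On the diagonal the transform of \<Phi> is a power of that of \<psi>, and the
    norm of a diagonal point dominates its entries; so the support condition descends to one
    variable.\<close>
  have \<psi>supp: "\<bar>\<eta>\<bar> < 1" if "fourier \<psi> \<eta> \<noteq> 0" for \<eta>
  proof -
    define \<xi> :: "real ^ 'm" where "\<xi> = (\<chi> j. \<eta>)"
    have "fourier \<Phi> \<xi> = fourier \<psi> \<eta> ^ CARD('m)"
      unfolding \<Phi>' fourier_prod_vec[OF schwartz_integrable[OF \<psi>]] by (simp add: \<xi>_def)
    hence "\<xi> \<in> {\<xi>. fourier \<Phi> \<xi> \<noteq> 0}" using that by simp
    hence "\<xi> \<in> ball 0 1" by (intro subsetD[OF supp] subsetD[OF closure_subset])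
    moreover have "\<bar>\<eta>\<bar> \<le> norm \<xi>" using component_le_norm_cart[of \<xi>] by (simp add: \<xi>_def)
    ultimately show ?thesis by simp
  qed
  obtain A where A: "A \<ge> 1"
    "\<And>D L. D \<ge> 1 \<Longrightarrow> finite L \<Longrightarrow> integrable lborel (packet \<psi> D L)"
    "\<And>D L. D \<ge> 1 \<Longrightarrow> finite L \<Longrightarrow> (LINT x|lborel. norm (packet \<psi> D L x)) \<le> A * sqrt (card L)"
    "\<And>D L. D \<ge> 1 \<Longrightarrow> finite L \<Longrightarrow> integrable lborel (\<lambda>x. (norm (packet \<psi> D L x))\<^sup>2)"
    "\<And>D L. D \<ge> 1 \<Longrightarrow> finite L \<Longrightarrow> (LINT x|lborel. (norm (packet \<psi> D L x))\<^sup>2) \<le> A * real (card L)"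
    "\<And>D L. D \<ge> 1 \<Longrightarrow> finite L \<Longrightarrow> integrable lborel (fourier (packet \<psi> D L))"
    "\<And>D L. D \<ge> 1 \<Longrightarrow> finite L \<Longrightarrow> (LINT x|lborel. norm (fourier (packet \<psi> D L) x)) \<le> A * real (card L)"
    "\<And>D L. D \<ge> 1 \<Longrightarrow> finite L \<Longrightarrow> integrable lborel (\<lambda>x. (norm (fourier (packet \<psi> D L) x))\<^sup>2)"
    "\<And>D L. D \<ge> 1 \<Longrightarrow> finite L \<Longrightarrow> (LINT x|lborel. (norm (fourier (packet \<psi> D L) x))\<^sup>2) \<le> A * real (card L)"
    by (rule packet_bounds[OF \<psi>], erule \<psi>supp) (rule that)
  have d: "d \<ge> 0" by (simp add: d_def)
  have main: "integrable lborel (G_part \<Phi> v) \<and> (LINT x|lborel. norm (G_part \<Phi> v x)) \<le> A ^ CARD('m) \<and>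
      integrable lborel (\<lambda>x. (norm (G_part \<Phi> v x))\<^sup>2) \<and> (LINT x|lborel. (norm (G_part \<Phi> v x))\<^sup>2) \<le> A ^ CARD('m) \<and>
      integrable lborel (fourier (G_part \<Phi> v)) \<and>
      (LINT x|lborel. norm (fourier (G_part \<Phi> v) x)) \<le> A ^ CARD('m) * v powr (- d / 2) \<and>
      integrable lborel (\<lambda>x. (norm (fourier (G_part \<Phi> v) x))\<^sup>2) \<and>
      (LINT x|lborel. (norm (fourier (G_part \<Phi> v) x))\<^sup>2) \<le> A ^ CARD('m) * v powr (d / (d + 2)) \<and>
      (\<forall>\<xi>. fourier (G_part \<Phi> v) \<xi> \<noteq> 0 \<longrightarrow> (norm \<xi>)\<^sup>2 \<le> d * (1 / v\<^sup>2 + 1)\<^sup>2)"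
    if v: "0 < v" "v < 1" for v
  proof -
    obtain D L where DL: "D \<ge> 1" "finite L" and card: "real (card L) \<le> v powr (- (d + 1) / (d + 2))"
      and freq: "\<And>l. l \<in> L \<Longrightarrow> 0 < D * of_int l \<and> D * of_int l < 1 / v\<^sup>2"
      and G: "G_part \<Phi> v = (\<lambda>x. of_real (v powr (d / 2)) * (\<Prod>j\<in>UNIV. packet \<psi> D L (x $ j)))"
      by (rule G_part_eq_prod_packet[OF \<Phi> v, folded d_def]) (rule that)
    let ?p = "packet \<psi> D L" and ?a = "v powr (d / 2)"
    note A = A(1) A(2-)[OF DL]
    have pw: "(v powr e) ^ CARD('m) = v powr (d * e)" for e
      using v by (simp add: d_def powr_realpow[symmetric] powr_powr mult.commute)
    \<comment> \<open>A cruder count, convenient because the normalising factor v^(d/2) exactly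
      cancels d square roots of v^(-1), and its square cancels d factors v^(-1).\<close>
    have card1: "real (card L) \<le> v powr (- 1)"
    proof -
      have "v powr (- (d + 1) / (d + 2)) \<le> v powr (- 1)"
        using v d by (intro powr_mono') (auto simp: field_simps)
      thus ?thesis using card by simp
    qed
    hence "sqrt (card L) \<le> sqrt (v powr (- 1))" by simp
    also have "sqrt (v powr (- 1)) = (v powr (- 1)) powr (1 / 2)"
      by (rule powr_half_sqrt[symmetric]) (rule powr_ge_zero)
    also have "\<dots> = v powr (- 1 / 2)" by (subst powr_powr) simp
    finally have card2: "sqrt (card L) \<le> v powr (- 1 / 2)" .
    have a2: "?a\<^sup>2 = v powr d" using v by (simp add: power2_eq_square powr_add[symmetric])
    have FG: "fourier (G_part \<Phi> v) \<xi> = of_real ?a * (\<Prod>j\<in>UNIV. fourier ?p (\<xi> $ j))" for \<xi>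
    proof -
      have "fourier (G_part \<Phi> v) \<xi> = of_real ?a * fourier (\<lambda>x. \<Prod>j\<in>UNIV. ?p (x $ j)) \<xi>"
        unfolding G fourier_def by (simp only: mult.left_commute[of _ "of_real ?a"] integral_mult_right_zero)
      thus ?thesis by (simp only: fourier_prod_vec[OF A(2)])
    qed
    have bound: "c * I ^ CARD('m) \<le> A ^ CARD('m) * (c * (v powr e) ^ CARD('m))"
      if "I \<le> A * N" "0 \<le> I" "N \<le> v powr e" "0 \<le> c" for c I N e
    proof -
      have "A * N \<le> A * v powr e" using that(3) A(1) by (intro mult_left_mono) auto
      hence "I ^ CARD('m) \<le> (A * v powr e) ^ CARD('m)" using that(1,2) by (intro power_mono) auto
      hence "c * I ^ CARD('m) \<le> c * (A * v powr e) ^ CARD('m)" using that(4) by (intro mult_left_mono)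
      thus ?thesis by (simp add: power_mult_distrib mult_ac)
    qed
    have nG: "norm (G_part \<Phi> v x) = ?a * (\<Prod>j\<in>UNIV. norm (?p (x $ j)))" for x
      using v by (simp add: G norm_mult prod_norm)
    have nG2: "(norm (G_part \<Phi> v x))\<^sup>2 = v powr d * (\<Prod>j\<in>UNIV. (norm (?p (x $ j)))\<^sup>2)" for x
      unfolding nG power_mult_distrib a2 prod_power_distrib ..
    have nF: "norm (fourier (G_part \<Phi> v) x) = ?a * (\<Prod>j\<in>UNIV. norm (fourier ?p (x $ j)))" for x
      using v by (simp add: FG norm_mult prod_norm)
    have nF2: "(norm (fourier (G_part \<Phi> v) x))\<^sup>2 = v powr d * (\<Prod>j\<in>UNIV. (norm (fourier ?p (x $ j)))\<^sup>2)" for x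
      unfolding nF power_mult_distrib a2 prod_power_distrib ..
    have 1: "integrable lborel (G_part \<Phi> v)"
      unfolding G by (intro integrable_mult_right integrable_prod_vec A)
    have "(LINT x|lborel. norm (G_part \<Phi> v x)) = ?a * (LINT x|lborel. norm (?p x)) ^ CARD('m)"
      unfolding nG integral_mult_right_zero by (subst integral_prod_vec) (use A in auto)
    also have "\<dots> \<le> A ^ CARD('m) * (?a * (v powr (- 1 / 2)) ^ CARD('m))"
      by (rule bound[OF A(3) _ card2]) (auto intro: Bochner_Integration.integral_nonneg)
    also have "?a * (v powr (- 1 / 2)) ^ CARD('m) = 1"
      unfolding pw using v by (simp add: powr_add[symmetric])
    finally have 2: "(LINT x|lborel. norm (G_part \<Phi> v x)) \<le> A ^ CARD('m)" by simp
    have 3: "integrable lborel (\<lambda>x. (norm (G_part \<Phi> v x))\<^sup>2)"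
      unfolding nG2 by (intro integrable_mult_right integrable_prod_vec A)
    have "(LINT x|lborel. (norm (G_part \<Phi> v x))\<^sup>2) = v powr d * (LINT x|lborel. (norm (?p x))\<^sup>2) ^ CARD('m)"
      unfolding nG2 integral_mult_right_zero by (subst integral_prod_vec) (use A in auto)
    also have "\<dots> \<le> A ^ CARD('m) * (v powr d * (v powr (- 1)) ^ CARD('m))"
      by (rule bound[OF A(5) _ card1]) (auto intro: Bochner_Integration.integral_nonneg)
    also have "v powr d * (v powr (- 1)) ^ CARD('m) = 1"
      unfolding pw using v by (simp add: powr_add[symmetric])
    finally have 4: "(LINT x|lborel. (norm (G_part \<Phi> v x))\<^sup>2) \<le> A ^ CARD('m)" by simp
    have 5: "integrable lborel (fourier (G_part \<Phi> v))"
      unfolding FG[abs_def] by (intro integrable_mult_right integrable_prod_vec A)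
    have "(LINT x|lborel. norm (fourier (G_part \<Phi> v) x)) = ?a * (LINT x|lborel. norm (fourier ?p x)) ^ CARD('m)"
      unfolding nF integral_mult_right_zero by (subst integral_prod_vec) (use A in auto)
    also have "\<dots> \<le> A ^ CARD('m) * (?a * (v powr (- 1)) ^ CARD('m))"
      by (rule bound[OF A(7) _ card1]) (auto intro: Bochner_Integration.integral_nonneg)
    also have "?a * (v powr (- 1)) ^ CARD('m) = v powr (- d / 2)"
      unfolding pw using v by (simp add: powr_add[symmetric] field_simps)
    finally have 6: "(LINT x|lborel. norm (fourier (G_part \<Phi> v) x)) \<le> A ^ CARD('m) * v powr (- d / 2)" .
    have 7: "integrable lborel (\<lambda>x. (norm (fourier (G_part \<Phi> v) x))\<^sup>2)"
      unfolding nF2 by (intro integrable_mult_right integrable_prod_vec A)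
    have "(LINT x|lborel. (norm (fourier (G_part \<Phi> v) x))\<^sup>2) = v powr d * (LINT x|lborel. (norm (fourier ?p x))\<^sup>2) ^ CARD('m)"
      unfolding nF2 integral_mult_right_zero by (subst integral_prod_vec) (use A in auto)
    also have "\<dots> \<le> A ^ CARD('m) * (v powr d * (v powr (- (d + 1) / (d + 2))) ^ CARD('m))"
      by (rule bound[OF A(9) _ card]) (auto intro: Bochner_Integration.integral_nonneg)
    also have "v powr d * (v powr (- (d + 1) / (d + 2))) ^ CARD('m) = v powr (d + d * (- (d + 1) / (d + 2)))"
      unfolding pw using v by (simp add: powr_add)
    also have "d + d * (- (d + 1) / (d + 2)) = d / (d + 2)"
      using d by (simp add: field_simps)
    finally have 8: "(LINT x|lborel. (norm (fourier (G_part \<Phi> v) x))\<^sup>2) \<le> A ^ CARD('m) * v powr (d / (d + 2))" .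
    \<comment> \<open>A nonzero transform forces every coordinate to lie within 1 of some frequency
      D l, and those lie between 0 and 1 / v^2.\<close>
    have 9: "(norm \<xi>)\<^sup>2 \<le> d * (1 / v\<^sup>2 + 1)\<^sup>2" if "fourier (G_part \<Phi> v) \<xi> \<noteq> 0" for \<xi>
    proof -
      have "\<bar>\<xi> $ j\<bar> \<le> 1 / v\<^sup>2 + 1" for j
      proof -
        have "fourier ?p (\<xi> $ j) \<noteq> 0" using that by (simp add: FG)
        then obtain l where l: "l \<in> L" "fourier \<psi> (- (D * of_int l) + \<xi> $ j) \<noteq> 0"
          unfolding fourier_packet[OF schwartz_integrable[OF \<psi>]] by (meson sum.neutral)
        from \<psi>supp[OF l(2)] freq[OF l(1)] show ?thesis by linarith
      qed
      hence "(\<xi> $ j)\<^sup>2 \<le> (1 / v\<^sup>2 + 1)\<^sup>2" for j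
        by (simp add: abs_le_square_iff[symmetric] abs_of_nonneg)
      hence "(\<Sum>j\<in>UNIV. (\<xi> $ j)\<^sup>2) \<le> (\<Sum>j\<in>(UNIV::'m set). (1 / v\<^sup>2 + 1)\<^sup>2)" by (intro sum_mono)
      thus ?thesis by (simp add: norm_vec_def L2_set_def sum_nonneg d_def)
    qed
    show ?thesis using 1 2 3 4 5 6 7 8 9 by blast
  qed
  show ?thesis
    by (rule that[of "A ^ CARD('m)"]) (use A(1) main in auto)
qed

text \<open>After multiplication by v^4 both parts of the squared frequency are bounded by a
  multiple of Y^2: the first by \<open>abs_frequency_le\<close>, the rest by the frequency
  localisation of \<open>G_part\<close>. Taking the power s gives v^(-4 s).\<close>

lemma sobolev_weight_le:
  fixes a d :: real and \<xi> :: "real \<times> 'b::euclidean_space"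
  assumes v: "0 < v" "v < 1" and d: "d \<ge> 0" and s: "0 \<le> s" "s \<le> 1"
    and \<xi>2: "(norm (snd \<xi>))\<^sup>2 \<le> d * (1 / v\<^sup>2 + 1)\<^sup>2"
  defines "Y \<equiv> 1 + \<bar>1 / v + v * fst \<xi>\<bar>"
  shows "(1 + (norm \<xi>)\<^sup>2) powr s \<le> (4 * d + 2) * v powr (- 4 * s) * Y\<^sup>2"
proof -
  have Y: "Y \<ge> 1" by (simp add: Y_def)
  have v4: "0 < v ^ 4" "v ^ 4 \<le> 1" using v by (auto intro: power_le_one)
  have "\<bar>fst \<xi>\<bar> * v\<^sup>2 \<le> Y" unfolding Y_def by (rule abs_frequency_le[OF v])
  hence "(\<bar>fst \<xi>\<bar> * v\<^sup>2)\<^sup>2 \<le> Y\<^sup>2" by (intro power_mono) auto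
  hence 1: "(fst \<xi>)\<^sup>2 * v ^ 4 \<le> Y\<^sup>2" by (simp add: power_mult_distrib flip: power_mult)
  have 2: "(norm (snd \<xi>))\<^sup>2 * v ^ 4 \<le> 4 * d"
  proof -
    have "1 / v\<^sup>2 + 1 \<le> 2 / v\<^sup>2" using v by (simp add: field_simps power_le_one)
    hence "(1 / v\<^sup>2 + 1)\<^sup>2 \<le> (2 / v\<^sup>2)\<^sup>2" by (intro power_mono) auto
    hence "d * (1 / v\<^sup>2 + 1)\<^sup>2 \<le> d * (4 / v ^ 4)"
      using d by (intro mult_left_mono) (auto simp: power_divide simp flip: power_mult)
    hence "(norm (snd \<xi>))\<^sup>2 \<le> 4 * d / v ^ 4" using \<xi>2 by (simp add: mult.commute)
    thus ?thesis using v4 by (simp add: pos_le_divide_eq)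
  qed
  have "(norm \<xi>)\<^sup>2 = (fst \<xi>)\<^sup>2 + (norm (snd \<xi>))\<^sup>2" by (simp add: norm_prod_def)
  hence "(1 + (norm \<xi>)\<^sup>2) * v ^ 4 = v ^ 4 + (fst \<xi>)\<^sup>2 * v ^ 4 + (norm (snd \<xi>))\<^sup>2 * v ^ 4"
    by (simp add: algebra_simps)
  also have "\<dots> \<le> 1 + Y\<^sup>2 + 4 * d" using 1 2 v4 by linarith
  also have "\<dots> \<le> (4 * d + 2) * Y\<^sup>2"
  proof -
    have "1 \<le> Y\<^sup>2" using Y by simp
    hence "(1 + 4 * d) * 1 \<le> (1 + 4 * d) * Y\<^sup>2" using d by (intro mult_left_mono) auto
    thus ?thesis by (simp add: algebra_simps)
  qed
  finally have "1 + (norm \<xi>)\<^sup>2 \<le> ((4 * d + 2) * Y\<^sup>2) * (1 / v ^ 4)" using v4 by (simp add: pos_le_divide_eq)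
  hence "(1 + (norm \<xi>)\<^sup>2) powr s \<le> (((4 * d + 2) * Y\<^sup>2) * (1 / v ^ 4)) powr s"
    using s by (intro powr_mono2) (auto intro: add_nonneg_nonneg)
  also have "\<dots> = ((4 * d + 2) * Y\<^sup>2) powr s * (1 / v ^ 4) powr s"
    by (rule powr_mult)
  also have "(1 / v ^ 4) powr s = v powr (- 4 * s)"
  proof -
    have "1 / v ^ 4 = v powr (- 4)" using v by (simp add: powr_minus_divide)
    thus ?thesis by (simp add: powr_powr)
  qed
  \<comment> \<open>The base is at least 1 and s at most 1, so the power may be raised to 1; second
    moments of g then suffice for all s in this range.\<close>
  also have "((4 * d + 2) * Y\<^sup>2) powr s \<le> ((4 * d + 2) * Y\<^sup>2) powr 1"
  proof (rule powr_mono[OF s(2)])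
    have "1 * 1 \<le> (4 * d + 2) * Y\<^sup>2" using d Y by (intro mult_mono) auto
    thus "1 \<le> (4 * d + 2) * Y\<^sup>2" by simp
  qed
  also have "((4 * d + 2) * Y\<^sup>2) powr 1 = (4 * d + 2) * Y\<^sup>2" using d by (intro powr_one) auto
  finally show ?thesis by (simp add: mult_ac mult_right_mono)
qed

text \<open>The tensor structure multiplies the estimates of the two factors. In the short-time
  bound the power -4 comes from the first variable and -d/2 from the \<open>L^1\<close> norm of the
  transform in the others.\<close>

lemma h_part_bounds:
  fixes \<Phi> :: "real ^ 'm \<Rightarrow> complex"
  assumes g: "schwartz g" "closure {x. inv_fourier g x \<noteq> 0} \<subseteq> {-1<..<1}"
    and \<psi>: "schwartz \<psi>" and \<Phi>: "\<And>x'. \<Phi> x' = (\<Prod>j\<in>UNIV. \<psi> (x' $ j))"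
    and supp: "closure {\<xi>. fourier \<Phi> \<xi> \<noteq> 0} \<subseteq> ball 0 1"
  defines "d \<equiv> real CARD('m)"
  obtains A where "A \<ge> 1"
    "\<And>v x. 0 < v \<Longrightarrow> v \<le> \<bar>fst x\<bar> \<Longrightarrow> h_part g \<Phi> v x = 0"
    "\<And>v. 0 < v \<Longrightarrow> v < 1 \<Longrightarrow> integrable lborel (h_part g \<Phi> v)"
    "\<And>v. 0 < v \<Longrightarrow> v < 1 \<Longrightarrow> (LINT x|lborel. norm (h_part g \<Phi> v x)) \<le> A * v"
    "\<And>v. 0 < v \<Longrightarrow> v < 1 \<Longrightarrow> integrable lborel (\<lambda>x. (norm (h_part g \<Phi> v x))\<^sup>2)"
    "\<And>v. 0 < v \<Longrightarrow> v < 1 \<Longrightarrow> (LINT x|lborel. (norm (h_part g \<Phi> v x))\<^sup>2) \<le> A * v"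
    "\<And>v t x. 0 < v \<Longrightarrow> v < 1 \<Longrightarrow> t \<noteq> 0 \<Longrightarrow> schrodinger_L1 t (h_part g \<Phi> v) x =
        schrodinger t (f_part g v) (fst x) * schrodinger t (G_part \<Phi> v) (snd x)"
    "\<And>v t x. 0 < v \<Longrightarrow> v < 1 \<Longrightarrow> t \<noteq> 0 \<Longrightarrow> v \<le> \<bar>fst x\<bar> \<Longrightarrow>
        norm (schrodinger_L1 t (h_part g \<Phi> v) x) \<le> A * \<bar>t\<bar> * v powr (- 4 - d / 2)"
    "\<And>v s. 0 < v \<Longrightarrow> v < 1 \<Longrightarrow> 0 \<le> s \<Longrightarrow> s \<le> 1 \<Longrightarrow>
        integrable lborel (\<lambda>\<xi>. (1 + (norm \<xi>)\<^sup>2) powr s * (norm (fourier (h_part g \<Phi> v) \<xi>))\<^sup>2)"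
    "\<And>v s. 0 < v \<Longrightarrow> v < 1 \<Longrightarrow> 0 \<le> s \<Longrightarrow> s \<le> 1 \<Longrightarrow>
        (LINT \<xi>|lborel. (1 + (norm \<xi>)\<^sup>2) powr s * (norm (fourier (h_part g \<Phi> v) \<xi>))\<^sup>2)
          \<le> A * v powr (4 * ((d + 1) / (2 * (d + 2)) - s))"
proof -
  obtain A1 where A1: "A1 \<ge> 1"
    "\<And>v x. 0 < v \<Longrightarrow> v \<le> \<bar>x\<bar> \<Longrightarrow> f_part g v x = 0"
    "\<And>v. 0 < v \<Longrightarrow> integrable lborel (f_part g v)"
    "\<And>v. 0 < v \<Longrightarrow> (LINT x|lborel. norm (f_part g v x)) \<le> A1 * v"
    "\<And>v. 0 < v \<Longrightarrow> integrable lborel (\<lambda>x. (norm (f_part g v x))\<^sup>2)"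
    "\<And>v. 0 < v \<Longrightarrow> (LINT x|lborel. (norm (f_part g v x))\<^sup>2) \<le> A1 * v"
    "\<And>v \<xi>. 0 < v \<Longrightarrow> fourier (f_part g v) \<xi> = of_real v * g (1 / v + v * \<xi>)"
    "\<And>v t x. 0 < v \<Longrightarrow> v < 1 \<Longrightarrow> v \<le> \<bar>x\<bar> \<Longrightarrow> norm (schrodinger t (f_part g v) x) \<le> A1 * \<bar>t\<bar> / v ^ 4"
    by (rule f_part_bounds[OF g]) (rule that)
  obtain A2 where A2: "A2 \<ge> 1"
    "\<And>v. 0 < v \<Longrightarrow> v < 1 \<Longrightarrow> integrable lborel (G_part \<Phi> v)"
    "\<And>v. 0 < v \<Longrightarrow> v < 1 \<Longrightarrow> (LINT x|lborel. norm (G_part \<Phi> v x)) \<le> A2"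
    "\<And>v. 0 < v \<Longrightarrow> v < 1 \<Longrightarrow> integrable lborel (\<lambda>x. (norm (G_part \<Phi> v x))\<^sup>2)"
    "\<And>v. 0 < v \<Longrightarrow> v < 1 \<Longrightarrow> (LINT x|lborel. (norm (G_part \<Phi> v x))\<^sup>2) \<le> A2"
    "\<And>v. 0 < v \<Longrightarrow> v < 1 \<Longrightarrow> integrable lborel (fourier (G_part \<Phi> v))"
    "\<And>v. 0 < v \<Longrightarrow> v < 1 \<Longrightarrow> (LINT x|lborel. norm (fourier (G_part \<Phi> v) x)) \<le> A2 * v powr (- d / 2)"
    "\<And>v. 0 < v \<Longrightarrow> v < 1 \<Longrightarrow> integrable lborel (\<lambda>x. (norm (fourier (G_part \<Phi> v) x))\<^sup>2)"
    "\<And>v. 0 < v \<Longrightarrow> v < 1 \<Longrightarrow> (LINT x|lborel. (norm (fourier (G_part \<Phi> v) x))\<^sup>2) \<le> A2 * v powr (d / (d + 2))"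
    "\<And>v \<xi>. 0 < v \<Longrightarrow> v < 1 \<Longrightarrow> fourier (G_part \<Phi> v) \<xi> \<noteq> 0 \<Longrightarrow> (norm \<xi>)\<^sup>2 \<le> d * (1 / v\<^sup>2 + 1)\<^sup>2"
    by (rule G_part_bounds[OF \<psi> \<Phi> supp, folded d_def]) (rule that)
  have d: "d \<ge> 0" by (simp add: d_def)
  note gi = schwartz_integrable[OF g(1)]
  note [measurable] = schwartz_measurable[OF g(1)]
  define J where "J = (LINT y|lborel. (1 + \<bar>y\<bar>)\<^sup>2 * (norm (g y))\<^sup>2)"
  have J: "J \<ge> 0" unfolding J_def by (rule Bochner_Integration.integral_nonneg) simp
  define A where "A = A1 * A2 + (4 * d + 2) * J * A2"
  have "0 \<le> (4 * d + 2) * J * A2" using d J A2(1) by simp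
  moreover have "1 * 1 \<le> A1 * A2" using A1(1) A2(1) by (intro mult_mono) auto
  ultimately have A: "A \<ge> 1" "A1 * A2 \<le> A" "(4 * d + 2) * J * A2 \<le> A" by (auto simp: A_def)
  have h: "h_part g \<Phi> v = (\<lambda>x. f_part g v (fst x) * G_part \<Phi> v (snd x))" for v
    by (auto simp: h_part_def)
  have Ff: "integrable lborel (fourier (f_part g v))" if "0 < v" for v
  proof -
    have "fourier (f_part g v) = (\<lambda>\<xi>. of_real v * g (1 / v + v * \<xi>))" using A1(7)[OF that] by auto
    thus ?thesis using lborel_integrable_real_affine[OF gi, of v "1 / v"] that by simp
  qed
  have S: "schrodinger_L1 t (h_part g \<Phi> v) x =
      schrodinger t (f_part g v) (fst x) * schrodinger t (G_part \<Phi> v) (snd x)"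
    if v: "0 < v" "v < 1" and t: "t \<noteq> 0" for v t x
  proof -
    have "fourier (h_part g \<Phi> v) = (\<lambda>\<xi>. fourier (f_part g v) (fst \<xi>) * fourier (G_part \<Phi> v) (snd \<xi>))"
      unfolding h using fourier_tensor[OF A1(3)[OF v(1)] A2(2)[OF v]] by auto
    hence "integrable lborel (fourier (h_part g \<Phi> v))"
      using integrable_tensor[OF Ff[OF v(1)] A2(6)[OF v]] by simp
    moreover have "integrable lborel (h_part g \<Phi> v)"
      unfolding h by (rule integrable_tensor[OF A1(3)[OF v(1)] A2(2)[OF v]])
    ultimately have "schrodinger_L1 t (h_part g \<Phi> v) x = schrodinger t (h_part g \<Phi> v) x"
      by (intro schrodinger_eq_schrodinger_L1[symmetric] t)
    also have "\<dots> = schrodinger t (f_part g v) (fst x) * schrodinger t (G_part \<Phi> v) (snd x)"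
      unfolding h by (rule schrodinger_tensor[OF A1(3)[OF v(1)] Ff[OF v(1)] A2(2)[OF v] A2(6)[OF v]])
    finally show ?thesis .
  qed
  have sob: "integrable lborel (\<lambda>\<xi>. (1 + (norm \<xi>)\<^sup>2) powr s * (norm (fourier (h_part g \<Phi> v) \<xi>))\<^sup>2) \<and>
      (LINT \<xi>|lborel. (1 + (norm \<xi>)\<^sup>2) powr s * (norm (fourier (h_part g \<Phi> v) \<xi>))\<^sup>2)
          \<le> A * v powr (4 * ((d + 1) / (2 * (d + 2)) - s))"
    if v: "0 < v" "v < 1" and s: "0 \<le> s" "s \<le> 1" for v s
  proof -
    let ?q = "\<lambda>y. (1 + \<bar>y\<bar>)\<^sup>2 * (norm (g y))\<^sup>2"
    let ?Q = "\<lambda>\<xi>. ?q (1 / v + v * \<xi>)"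
    let ?H = "\<lambda>\<xi>. (1 + (norm \<xi>)\<^sup>2) powr s * (norm (fourier (h_part g \<Phi> v) \<xi>))\<^sup>2"
    let ?k = "(4 * d + 2) * v powr (- 4 * s) * v\<^sup>2"
    have F: "fourier (h_part g \<Phi> v) \<xi> = of_real v * g (1 / v + v * fst \<xi>) * fourier (G_part \<Phi> v) (snd \<xi>)" for \<xi>
      unfolding h using fourier_tensor[OF A1(3)[OF v(1)] A2(2)[OF v]] A1(7)[OF v(1)] by simp
    have hi: "integrable lborel (h_part g \<Phi> v)"
      unfolding h by (rule integrable_tensor[OF A1(3)[OF v(1)] A2(2)[OF v]])
    note [measurable] = fourier_measurable[OF hi]
    have le: "?H \<xi> \<le> ?k * (?Q (fst \<xi>) * (norm (fourier (G_part \<Phi> v) (snd \<xi>)))\<^sup>2)" for \<xi>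
    proof (cases "fourier (G_part \<Phi> v) (snd \<xi>) = 0")
      case False
      have "?H \<xi> \<le> ((4 * d + 2) * v powr (- 4 * s) * (1 + \<bar>1 / v + v * fst \<xi>\<bar>)\<^sup>2) * (norm (fourier (h_part g \<Phi> v) \<xi>))\<^sup>2"
        by (intro mult_right_mono sobolev_weight_le v d s A2(10)[OF v False]) simp
      also have "\<dots> = ?k * (?Q (fst \<xi>) * (norm (fourier (G_part \<Phi> v) (snd \<xi>)))\<^sup>2)"
        unfolding F by (simp add: norm_mult power_mult_distrib mult_ac)
      finally show ?thesis .
    qed (simp add: F)
    have Qi: "integrable lborel ?Q"
      using lborel_integrable_real_affine[OF schwartz_moments(2)[OF g(1)], of v "1 / v"] v by simp
    have i: "integrable lborel (\<lambda>\<xi>. ?k * (?Q (fst \<xi>) * (norm (fourier (G_part \<Phi> v) (snd \<xi>)))\<^sup>2))"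
      by (intro integrable_mult_right integrable_tensor[OF Qi A2(8)[OF v]])
    have Hi: "integrable lborel ?H"
    proof (rule Bochner_Integration.integrable_bound[OF i])
      show "AE \<xi> in lborel. norm (?H \<xi>) \<le> norm (?k * (?Q (fst \<xi>) * (norm (fourier (G_part \<Phi> v) (snd \<xi>)))\<^sup>2))"
      proof (rule AE_I2)
        fix \<xi>
        have "norm (?H \<xi>) = ?H \<xi>" by simp
        also have "\<dots> \<le> norm (?k * (?Q (fst \<xi>) * (norm (fourier (G_part \<Phi> v) (snd \<xi>)))\<^sup>2))"
          unfolding real_norm_def by (rule order_trans[OF le abs_ge_self])
        finally show "norm (?H \<xi>) \<le> norm (?k * (?Q (fst \<xi>) * (norm (fourier (G_part \<Phi> v) (snd \<xi>)))\<^sup>2))" .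
      qed
    qed measurable
    have "integral\<^sup>L lborel ?H \<le> (LINT \<xi>|lborel. ?k * (?Q (fst \<xi>) * (norm (fourier (G_part \<Phi> v) (snd \<xi>)))\<^sup>2))"
      by (rule integral_mono[OF Hi i le])
    also have "\<dots> = ?k * ((LINT \<xi>|lborel. ?Q \<xi>) * (LINT \<xi>|lborel. (norm (fourier (G_part \<Phi> v) \<xi>))\<^sup>2))"
      unfolding integral_mult_right_zero integral_tensor[OF Qi A2(8)[OF v]] ..
    also have "(LINT \<xi>|lborel. ?Q \<xi>) = J / v"
      unfolding J_def by (rule integral_real_affine_pos[OF v(1)])
    also have "?k * (J / v * (LINT \<xi>|lborel. (norm (fourier (G_part \<Phi> v) \<xi>))\<^sup>2)) \<le> ?k * (J / v * (A2 * v powr (d / (d + 2))))"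
      using v d J by (intro mult_left_mono A2(9)) auto
    also have "\<dots> = ((4 * d + 2) * J * A2) * (v powr (- 4 * s) * v * v powr (d / (d + 2)))"
      using v by (simp add: field_simps power2_eq_square)
    also have "v powr (- 4 * s) * v * v powr (d / (d + 2)) = v powr (- 4 * s + 1 + d / (d + 2))"
      unfolding powr_add using v by simp
    \<comment> \<open>The power -4 s comes from the weight, 2 - 1 from the rescaling in the first
      variable, d / (d + 2) from the rest. With d = n - 1 the critical value (d + 1) / (2 (d + 2))
      is n / (2 (n + 1)).\<close>
    also have "- 4 * s + 1 + d / (d + 2) = 4 * ((d + 1) / (2 * (d + 2)) - s)"
      using d by (simp add: field_simps)
    also have "((4 * d + 2) * J * A2) * v powr (4 * ((d + 1) / (2 * (d + 2)) - s)) \<le> A * v powr (4 * ((d + 1) / (2 * (d + 2)) - s))"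
      by (intro mult_right_mono A) auto
    finally show ?thesis using Hi by blast
  qed
  show ?thesis
  proof (rule that[OF A(1) _ _ _ _ _ S])
    fix v :: real assume v: "0 < v"
    show "h_part g \<Phi> v x = 0" if "v \<le> \<bar>fst x\<bar>" for x
      using A1(2)[OF v that] by (simp add: h)
    assume v': "v < 1"
    have mono: "A1 * v * A2 \<le> A * v" using mult_right_mono[OF A(2), of v] v by (simp add: mult_ac)
    show "integrable lborel (h_part g \<Phi> v)"
      unfolding h by (rule integrable_tensor[OF A1(3)[OF v] A2(2)[OF v v']])
    have "(LINT x|lborel. norm (h_part g \<Phi> v x)) = (LINT x|lborel. norm (f_part g v x)) * (LINT x|lborel. norm (G_part \<Phi> v x))"
      unfolding h norm_mult by (rule integral_tensor) (use A1(3)[OF v] A2(2)[OF v v'] in auto)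
    also have "\<dots> \<le> A1 * v * A2"
      using v A1(1) by (intro mult_mono A1 A2 v v' Bochner_Integration.integral_nonneg) auto
    finally show "(LINT x|lborel. norm (h_part g \<Phi> v x)) \<le> A * v" using mono by simp
    show "integrable lborel (\<lambda>x. (norm (h_part g \<Phi> v x))\<^sup>2)"
      unfolding h norm_mult power_mult_distrib by (rule integrable_tensor[OF A1(5)[OF v] A2(4)[OF v v']])
    have "(LINT x|lborel. (norm (h_part g \<Phi> v x))\<^sup>2) = (LINT x|lborel. (norm (f_part g v x))\<^sup>2) * (LINT x|lborel. (norm (G_part \<Phi> v x))\<^sup>2)"
      unfolding h norm_mult power_mult_distrib by (rule integral_tensor[OF A1(5)[OF v] A2(4)[OF v v']])
    also have "\<dots> \<le> A1 * v * A2"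
      using v A1(1) by (intro mult_mono A1 A2 v v' Bochner_Integration.integral_nonneg) auto
    finally show "(LINT x|lborel. (norm (h_part g \<Phi> v x))\<^sup>2) \<le> A * v" using mono by simp
    show "norm (schrodinger_L1 t (h_part g \<Phi> v) x) \<le> A * \<bar>t\<bar> * v powr (- 4 - d / 2)"
      if t: "t \<noteq> 0" and x: "v \<le> \<bar>fst x\<bar>" for t x
    proof -
      have "norm (schrodinger_L1 t (h_part g \<Phi> v) x) =
          norm (schrodinger t (f_part g v) (fst x)) * norm (schrodinger t (G_part \<Phi> v) (snd x))"
        unfolding S[OF v v' t] norm_mult ..
      also have "\<dots> \<le> (A1 * \<bar>t\<bar> / v ^ 4) * (A2 * v powr (- d / 2))"
        using A1(1) v by (intro mult_mono A1 v v' x order_trans[OF norm_schrodinger_le A2(7)]) auto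
      also have "\<dots> = (A1 * A2) * (\<bar>t\<bar> * (v powr (- 4) * v powr (- d / 2)))"
        using v by (simp add: powr_minus_divide)
      also have "v powr (- 4) * v powr (- d / 2) = v powr (- 4 - d / 2)"
        by (simp flip: powr_add)
      also have "(A1 * A2) * (\<bar>t\<bar> * v powr (- 4 - d / 2)) \<le> A * (\<bar>t\<bar> * v powr (- 4 - d / 2))"
        by (intro mult_right_mono A) auto
      finally show ?thesis by (simp add: mult.assoc)
    qed
  qed (use sob in auto)
qed

section \<open>Sums of rapidly concentrating blocks\<close>

text \<open>Cauchy-Schwarz with geometric weights bounds the square of a sum by squares of the
  individual terms, uniformly in their number, at the price of the factors q^(-j).\<close>

lemma norm_sum_square_le_geometric:
  fixes a :: "nat \<Rightarrow> complex"
  assumes q: "0 < q" "q < 1"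
  shows "(norm (\<Sum>j<n. a j))\<^sup>2 \<le> (\<Sum>j<n. (norm (a j))\<^sup>2 / (q ^ j * (1 - q)))"
proof -
  have "norm (\<Sum>j<n. a j) \<le> (\<Sum>j<n. norm (a j))" by (rule norm_sum)
  also have "\<dots> = (\<Sum>j<n. sqrt (q ^ j) * (norm (a j) / sqrt (q ^ j)))"
    using q by (intro sum.cong) auto
  finally have "(norm (\<Sum>j<n. a j))\<^sup>2 \<le> (\<Sum>j<n. sqrt (q ^ j) * (norm (a j) / sqrt (q ^ j)))\<^sup>2"
    by (intro power_mono) auto
  also have "\<dots> \<le> (\<Sum>j<n. (sqrt (q ^ j))\<^sup>2) * (\<Sum>j<n. (norm (a j) / sqrt (q ^ j))\<^sup>2)"
    by (rule Cauchy_Schwarz_ineq_sum)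
  also have "\<dots> = (\<Sum>j<n. q ^ j) * (\<Sum>j<n. (norm (a j))\<^sup>2 / q ^ j)"
    using q by (simp add: power_divide)
  also have "\<dots> \<le> 1 / (1 - q) * (\<Sum>j<n. (norm (a j))\<^sup>2 / q ^ j)"
  proof (intro mult_right_mono sum_nonneg)
    have "(\<Sum>j<n. q ^ j) = (1 - q ^ n) / (1 - q)" using q by (simp add: sum_gp_strict)
    also have "\<dots> \<le> 1 / (1 - q)" using q by (intro divide_right_mono) auto
    finally show "(\<Sum>j<n. q ^ j) \<le> 1 / (1 - q)" .
  qed (use q in auto)
  also have "\<dots> = (\<Sum>j<n. (norm (a j))\<^sup>2 / (q ^ j * (1 - q)))"
    by (simp add: sum_distrib_left mult.commute)
  finally show ?thesis .
qed

text \<open>The squared norms decay with ratio q^2: one factor q pays for the weights q^(-j) of the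
  splitting, the other makes the resulting series converge.\<close>

lemma integrable_weighted_square_sums:
  fixes u :: "nat \<Rightarrow> 'a \<Rightarrow> complex" and w :: "'a \<Rightarrow> real"
  assumes [measurable]: "w \<in> borel_measurable M" "\<And>j. u j \<in> borel_measurable M" "h \<in> borel_measurable M"
    and w: "\<And>x. w x \<ge> 0"
    and int: "\<And>j. integrable M (\<lambda>x. w x * (norm (u j x))\<^sup>2)"
    and le: "\<And>j. (LINT x|M. w x * (norm (u j x))\<^sup>2) \<le> C * (q * q) ^ j"
    and q: "0 < q" "q < 1"
    and sums: "AE x in M. (\<lambda>j. u j x) sums h x"
  shows "integrable M (\<lambda>x. w x * (norm (h x))\<^sup>2)"
proof (rule integrableI_bounded)
  let ?f = "\<lambda>j x. ennreal (w x * (norm (u j x))\<^sup>2 / (q ^ j * (1 - q)))"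
  \<comment> \<open>The right-hand side bounds every partial sum, so it also bounds the almost
    everywhere limit.\<close>
  have "AE x in M. ennreal (norm (w x * (norm (h x))\<^sup>2)) \<le> (\<Sum>j. ?f j x)"
    using sums
  proof eventually_elim
    case (elim x)
    have "(\<lambda>n. w x * (norm (\<Sum>j<n. u j x))\<^sup>2) \<longlonglongrightarrow> w x * (norm (h x))\<^sup>2"
      using elim unfolding sums_def by (intro tendsto_intros)
    hence lim: "(\<lambda>n. ennreal (w x * (norm (\<Sum>j<n. u j x))\<^sup>2)) \<longlonglongrightarrow> ennreal (w x * (norm (h x))\<^sup>2)"
      by (rule tendsto_ennrealI)
    have "ennreal (w x * (norm (\<Sum>j<n. u j x))\<^sup>2) \<le> (\<Sum>j. ?f j x)" for n
    proof -
      have "w x * (norm (\<Sum>j<n. u j x))\<^sup>2 \<le> w x * (\<Sum>j<n. (norm (u j x))\<^sup>2 / (q ^ j * (1 - q)))"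
        by (intro mult_left_mono norm_sum_square_le_geometric q w)
      also have "\<dots> = (\<Sum>j<n. w x * (norm (u j x))\<^sup>2 / (q ^ j * (1 - q)))"
        by (simp add: sum_distrib_left)
      finally have "ennreal (w x * (norm (\<Sum>j<n. u j x))\<^sup>2) \<le> ennreal (\<Sum>j<n. w x * (norm (u j x))\<^sup>2 / (q ^ j * (1 - q)))"
        by (rule ennreal_leI)
      also have "\<dots> = (\<Sum>j<n. ?f j x)"
        using w q by (intro sum_ennreal[symmetric]) (auto intro!: divide_nonneg_nonneg mult_nonneg_nonneg)
      also have "\<dots> \<le> (\<Sum>j. ?f j x)" by (intro sum_le_suminf summableI) auto
      finally show ?thesis .
    qed
    thus ?case using w by (intro LIMSEQ_le_const2[OF _ exI[of _ 0]]) (auto intro: lim simp: abs_mult)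
  qed
  hence "(\<integral>\<^sup>+x. ennreal (norm (w x * (norm (h x))\<^sup>2)) \<partial>M) \<le> (\<integral>\<^sup>+x. (\<Sum>j. ?f j x) \<partial>M)"
    by (rule nn_integral_mono_AE)
  also have "\<dots> = (\<Sum>j. \<integral>\<^sup>+x. ?f j x \<partial>M)" by (rule nn_integral_suminf) measurable
  also have "\<dots> \<le> (\<Sum>j. ennreal (C / (1 - q) * q ^ j))"
  proof (intro suminf_le summableI)
    fix j
    have "(\<integral>\<^sup>+x. ?f j x \<partial>M) = ennreal (LINT x|M. w x * (norm (u j x))\<^sup>2 / (q ^ j * (1 - q)))"
      using w q int[of j] by (intro nn_integral_eq_integral AE_I2 divide_nonneg_nonneg mult_nonneg_nonneg) auto
    also have "(LINT x|M. w x * (norm (u j x))\<^sup>2 / (q ^ j * (1 - q))) = (LINT x|M. w x * (norm (u j x))\<^sup>2) / (q ^ j * (1 - q))"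
      by simp
    also have "\<dots> \<le> C * (q * q) ^ j / (q ^ j * (1 - q))" using q by (intro divide_right_mono le) auto
    also have "\<dots> = C / (1 - q) * q ^ j" using q by (simp add: power_mult_distrib)
    finally show "(\<integral>\<^sup>+x. ?f j x \<partial>M) \<le> ennreal (C / (1 - q) * q ^ j)" by (simp add: ennreal_leI)
  qed
  also have "\<dots> = ennreal (\<Sum>j. C / (1 - q) * q ^ j)"
  proof (rule suminf_ennreal2)
    have "0 \<le> (LINT x|M. w x * (norm (u 0 x))\<^sup>2)" by (rule Bochner_Integration.integral_nonneg) (simp add: w)
    also have "\<dots> \<le> C" using le[of 0] by simp
    finally show "0 \<le> C / (1 - q) * q ^ j" for j using q by simp
    show "summable (\<lambda>j. C / (1 - q) * q ^ j)" using q by (intro summable_mult summable_geometric) simp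
  qed
  also have "\<dots> < \<infinity>" by simp
  finally show "(\<integral>\<^sup>+x. ennreal (norm (w x * (norm (h x))\<^sup>2)) \<partial>M) < \<infinity>" .
qed measurable

text \<open>Used with the Schroedinger kernel and with the Fourier character as multiplier, so that
  both operations may be taken block by block.\<close>

lemma sums_integral_bounded_mult:
  fixes u :: "nat \<Rightarrow> 'a \<Rightarrow> complex"
  assumes int: "\<And>k. integrable M (u k)" and sm: "AE x in M. summable (\<lambda>k. norm (u k x))"
    and sI: "summable (\<lambda>k. LINT x|M. norm (u k x))"
    and m: "m \<in> borel_measurable M" "\<And>x. norm (m x) \<le> B"
  shows "(\<lambda>k. LINT x|M. m x * u k x) sums (LINT x|M. m x * (\<Sum>k. u k x))"
proof -
  have B: "norm (m x * u k x) \<le> \<bar>B\<bar> * norm (u k x)" for x k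
  proof -
    have "norm (m x) \<le> \<bar>B\<bar>" using m(2)[of x] by simp
    thus ?thesis unfolding norm_mult by (rule mult_right_mono) simp
  qed
  have i: "integrable M (\<lambda>x. m x * u k x)" for k
    by (rule integrable_bounded_mult(1)[OF int m])
  have "(\<lambda>k. LINT x|M. m x * u k x) sums (LINT x|M. (\<Sum>k. m x * u k x))"
  proof (rule sums_integral[OF i])
    show "AE x in M. summable (\<lambda>k. norm (m x * u k x))"
      using sm by eventually_elim (rule summable_comparison_test'[OF summable_mult[of _ "\<bar>B\<bar>"]], auto simp: B)
    show "summable (\<lambda>k. LINT x|M. norm (m x * u k x))"
    proof (rule summable_comparison_test'[OF summable_mult[OF sI, of "\<bar>B\<bar>"]])
      fix k
      have "(LINT x|M. norm (m x * u k x)) \<le> (LINT x|M. \<bar>B\<bar> * norm (u k x))"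
        using i int by (intro integral_mono B) auto
      moreover have "0 \<le> (LINT x|M. norm (m x * u k x))" by (rule Bochner_Integration.integral_nonneg) simp
      ultimately show "norm (LINT x|M. norm (m x * u k x)) \<le> \<bar>B\<bar> * (LINT x|M. norm (u k x))" by simp
    qed
  qed
  also have "(LINT x|M. (\<Sum>k. m x * u k x)) = (LINT x|M. m x * (\<Sum>k. u k x))"
  proof (rule integral_cong_AE)
    have [measurable]: "u k \<in> borel_measurable M" for k using int by (rule borel_measurable_integrable)
    note [measurable] = m(1)
    show "(\<lambda>x. \<Sum>k. m x * u k x) \<in> borel_measurable M" by measurable
    show "(\<lambda>x. m x * (\<Sum>k. u k x)) \<in> borel_measurable M" by measurable
    show "AE x in M. (\<Sum>k. m x * u k x) = m x * (\<Sum>k. u k x)"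
      using sm
    proof eventually_elim
      case (elim x)
      hence "summable (\<lambda>k. u k x)" by (rule summable_norm_cancel)
      thus ?case by (rule suminf_mult)
    qed
  qed
  finally show ?thesis .
qed

text \<open>Off this hyperplane the series of blocks is a finite sum.\<close>

lemma AE_fst_nonzero: "AE x :: real \<times> 'b::euclidean_space in lborel. fst x \<noteq> 0"
proof -
  have "{x :: real \<times> 'b. fst x = 0} = {0} \<times> UNIV" by auto
  hence "emeasure lborel {x :: real \<times> 'b. fst x = 0} = emeasure (lborel \<Otimes>\<^sub>M lborel) ({0 :: real} \<times> (UNIV :: 'b set))"
    by (simp add: lborel_prod)
  also have "\<dots> = 0" by (subst lborel.emeasure_pair_measure_Times) auto
  finally have e: "emeasure lborel {x :: real \<times> 'b. fst x = 0} = 0" .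
  have "closed {x :: real \<times> 'b. fst x = 0}" by (intro closed_Collect_eq continuous_intros)
  hence "{x :: real \<times> 'b. fst x = 0} \<in> null_sets lborel" using e by (intro null_setsI) auto
  from AE_not_in[OF this] show ?thesis by simp
qed

text \<open>Convergence and Sobolev regularity of the sum rest on the geometric bound
  \<open>geo\<close>; the recursion with exponent \<mu> enters in the pointwise lower bound.\<close>

context
  fixes g \<psi> :: "real \<Rightarrow> complex" and \<Phi> :: "real ^ 'm \<Rightarrow> complex" and v :: "nat \<Rightarrow> real" and K :: nat
  assumes g: "schwartz g" "closure {x. inv_fourier g x \<noteq> 0} \<subseteq> {-1<..<1}"
    and \<psi>: "schwartz \<psi>" and \<Phi>: "\<And>x'. \<Phi> x' = (\<Prod>j\<in>UNIV. \<psi> (x' $ j))"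
    and supp: "closure {\<xi>. fourier \<Phi> \<xi> \<noteq> 0} \<subseteq> ball 0 1"
    and pos: "\<And>k. 0 < v (K + k)" and lt1: "\<And>k. v (K + k) < 1" and geo: "\<And>k. v (K + k) \<le> (1 / 2) ^ k"
begin

lemma h_part_eventually_0:
  assumes "fst x \<noteq> 0"
  obtains N where "\<And>k. k \<ge> N \<Longrightarrow> h_part g \<Phi> (v (K + k)) x = 0"
proof -
  obtain A where A: "\<And>v x. 0 < v \<Longrightarrow> v \<le> \<bar>fst x\<bar> \<Longrightarrow> h_part g \<Phi> v x = 0"
    by (rule h_part_bounds[OF g \<psi> \<Phi> supp]) blast
  have "(\<lambda>k. (1 / 2 :: real) ^ k) \<longlonglongrightarrow> 0" by (intro LIMSEQ_realpow_zero) auto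
  from LIMSEQ_D[OF this, of "\<bar>fst x\<bar>"] assms obtain N where "\<And>k. k \<ge> N \<Longrightarrow> (1 / 2) ^ k < \<bar>fst x\<bar>" by auto
  hence "h_part g \<Phi> (v (K + k)) x = 0" if "k \<ge> N" for k
    using that geo[of k] by (intro A pos) (meson less_imp_le order_trans)
  thus ?thesis using that by blast
qed

lemma h_part_summable:
  assumes "fst x \<noteq> 0"
  shows "summable (\<lambda>k. norm (h_part g \<Phi> (v (K + k)) x))"
    and "(\<lambda>k. h_part g \<Phi> (v (K + k)) x) sums h_sum g \<Phi> v K x"
proof -
  obtain N where N: "\<And>k. k \<ge> N \<Longrightarrow> h_part g \<Phi> (v (K + k)) x = 0" using h_part_eventually_0[OF assms] by blast
  show s: "summable (\<lambda>k. norm (h_part g \<Phi> (v (K + k)) x))"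
    by (rule summable_finite[of "{..<N}"]) (use N in \<open>auto simp: not_less\<close>)
  show "(\<lambda>k. h_part g \<Phi> (v (K + k)) x) sums h_sum g \<Phi> v K x"
    unfolding h_sum_def by (rule summable_sums[OF summable_norm_cancel[OF s]])
qed

lemma
  shows h_sum_integrable: "integrable lborel (h_sum g \<Phi> v K)"
    and h_sum_sums_integral: "\<And>m B. m \<in> borel_measurable borel \<Longrightarrow> (\<And>x. norm (m x) \<le> B) \<Longrightarrow>
      (\<lambda>k. LINT x|lborel. m x * h_part g \<Phi> (v (K + k)) x) sums (LINT x|lborel. m x * h_sum g \<Phi> v K x)"
    and h_sum_square_integrable: "square_integrable (h_sum g \<Phi> v K)"
proof -
  obtain A where A: "A \<ge> 1"
    "\<And>v. 0 < v \<Longrightarrow> v < 1 \<Longrightarrow> integrable lborel (h_part g \<Phi> v)"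
    "\<And>v. 0 < v \<Longrightarrow> v < 1 \<Longrightarrow> (LINT x|lborel. norm (h_part g \<Phi> v x)) \<le> A * v"
    "\<And>v. 0 < v \<Longrightarrow> v < 1 \<Longrightarrow> integrable lborel (\<lambda>x. (norm (h_part g \<Phi> v x))\<^sup>2)"
    "\<And>v. 0 < v \<Longrightarrow> v < 1 \<Longrightarrow> (LINT x|lborel. (norm (h_part g \<Phi> v x))\<^sup>2) \<le> A * v"
    by (rule h_part_bounds[OF g \<psi> \<Phi> supp]) (rule that)
  let ?u = "\<lambda>k. h_part g \<Phi> (v (K + k))"
  have ui: "integrable lborel (?u k)" for k by (intro A pos lt1)
  have uA: "A * v (K + k) \<le> A * (1 / 2) ^ k" for k using A(1) by (intro mult_left_mono geo) auto
  have sm: "AE x in lborel. summable (\<lambda>k. norm (?u k x))"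
    using AE_fst_nonzero by eventually_elim (rule h_part_summable)
  have sI: "summable (\<lambda>k. LINT x|lborel. norm (?u k x))"
  proof (rule summable_comparison_test')
    show "summable (\<lambda>k. A * (1 / 2 :: real) ^ k)" by (intro summable_mult summable_geometric) auto
    fix k
    have "0 \<le> (LINT x|lborel. norm (?u k x))" by (rule Bochner_Integration.integral_nonneg) simp
    thus "norm (LINT x|lborel. norm (?u k x)) \<le> A * (1 / 2) ^ k"
      using order_trans[OF A(3)[OF pos lt1] uA[of k]] by simp
  qed
  show hi: "integrable lborel (h_sum g \<Phi> v K)"
    unfolding h_sum_def by (rule integrable_suminf[OF ui sm sI])
  show "(\<lambda>k. LINT x|lborel. m x * ?u k x) sums (LINT x|lborel. m x * h_sum g \<Phi> v K x)"
    if "m \<in> borel_measurable borel" "\<And>x. norm (m x) \<le> B" for m B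
    unfolding h_sum_def using that by (intro sums_integral_bounded_mult[OF ui sm sI]) auto
  have [measurable]: "?u k \<in> borel_measurable borel" "h_sum g \<Phi> v K \<in> borel_measurable borel" for k
    using ui[of k] hi by (auto dest: borel_measurable_integrable)
  have "integrable lborel (\<lambda>x. 1 * (norm (h_sum g \<Phi> v K x))\<^sup>2)"
  \<comment> \<open>The squared norms of the blocks decay like (1/2)^k, which is the square of the
    ratio q; the weight 1 gives the plain \<open>L^2\<close> norm.\<close>
  proof (rule integrable_weighted_square_sums[where u = ?u and C = A and q = "sqrt (1 / 2)"])
    show "integrable lborel (\<lambda>x. 1 * (norm (?u k x))\<^sup>2)" for k using A(4)[OF pos lt1] by simp
    show "(LINT x|lborel. 1 * (norm (?u k x))\<^sup>2) \<le> A * (sqrt (1 / 2) * sqrt (1 / 2)) ^ k" for k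
      using order_trans[OF A(5)[OF pos lt1] uA[of k]] by simp
    show "AE x in lborel. (\<lambda>k. ?u k x) sums h_sum g \<Phi> v K x"
      using AE_fst_nonzero by eventually_elim (rule h_part_summable)
  qed auto
  thus "square_integrable (h_sum g \<Phi> v K)" unfolding square_integrable_def by simp
qed

lemma h_sum_schrodinger_L1_sums:
  "(\<lambda>k. schrodinger_L1 t (h_part g \<Phi> (v (K + k))) x) sums schrodinger_L1 t (h_sum g \<Phi> v K) x"
  unfolding schrodinger_L1_def
  by (rule h_sum_sums_integral) (measurable, rule eq_refl, rule norm_schrodinger_kernel)

lemma h_sum_fourier_sums:
  "(\<lambda>k. fourier (h_part g \<Phi> (v (K + k))) \<xi>) sums fourier (h_sum g \<Phi> v K) \<xi>"
  unfolding fourier_def by (rule h_sum_sums_integral[where B = 1]) auto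

lemma h_sum_in_sobolev:
  assumes s: "s < (real CARD('m) + 1) / (2 * (real CARD('m) + 2))"
  shows "distribution_of (h_sum g \<Phi> v K) \<in> sobolev s"
proof -
  define d where "d = real CARD('m)"
  \<comment> \<open>The block estimate is for exponents between 0 and 1. A negative s is reduced to
    0, since 1 + |\<xi>|^2 is at least 1 and the weight therefore increases with the
    exponent.\<close>
  define s' where "s' = max s 0"
  define \<kappa> where "\<kappa> = (d + 1) / (2 * (d + 2)) - s'"
  have d: "d \<ge> 0" by (simp add: d_def)
  have "0 < (d + 1) / (2 * (d + 2))" using d by simp
  hence \<kappa>: "\<kappa> > 0" using s by (auto simp: \<kappa>_def s'_def d_def)
  have "(d + 1) / (2 * (d + 2)) \<le> 1" using d by (simp add: divide_le_eq)
  hence s': "0 \<le> s'" "s' \<le> 1" "s \<le> s'" using \<kappa> by (auto simp: \<kappa>_def s'_def)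
  obtain A where A: "A \<ge> 1"
    "\<And>v. 0 < v \<Longrightarrow> v < 1 \<Longrightarrow> integrable lborel (h_part g \<Phi> v)"
    "\<And>v s. 0 < v \<Longrightarrow> v < 1 \<Longrightarrow> 0 \<le> s \<Longrightarrow> s \<le> 1 \<Longrightarrow>
        integrable lborel (\<lambda>\<xi>. (1 + (norm \<xi>)\<^sup>2) powr s * (norm (fourier (h_part g \<Phi> v) \<xi>))\<^sup>2)"
    "\<And>v s. 0 < v \<Longrightarrow> v < 1 \<Longrightarrow> 0 \<le> s \<Longrightarrow> s \<le> 1 \<Longrightarrow>
        (LINT \<xi>|lborel. (1 + (norm \<xi>)\<^sup>2) powr s * (norm (fourier (h_part g \<Phi> v) \<xi>))\<^sup>2)
          \<le> A * v powr (4 * ((d + 1) / (2 * (d + 2)) - s))"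
    by (rule h_part_bounds[OF g \<psi> \<Phi> supp, folded d_def]) (rule that)
  let ?u = "\<lambda>k. h_part g \<Phi> (v (K + k))"
  \<comment> \<open>Its square is (1/2)^(4 \<kappa>), the ratio in the block estimates at regularity
    s'; it is below 1 because \<kappa> is positive.\<close>
  let ?q = "(1 / 2) powr (2 * \<kappa>) :: real"
  note [measurable] = fourier_measurable[OF A(2)[OF pos lt1]] fourier_measurable[OF h_sum_integrable]
  have i: "integrable lborel (\<lambda>\<xi>. (1 + (norm \<xi>)\<^sup>2) powr s' * (norm (fourier (h_sum g \<Phi> v K) \<xi>))\<^sup>2)"
  proof (rule integrable_weighted_square_sums[where u = "\<lambda>k. fourier (?u k)" and C = A and q = ?q])
    show "integrable lborel (\<lambda>\<xi>. (1 + (norm \<xi>)\<^sup>2) powr s' * (norm (fourier (?u k) \<xi>))\<^sup>2)" for k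
      by (intro A pos lt1 s')
    show "(LINT \<xi>|lborel. (1 + (norm \<xi>)\<^sup>2) powr s' * (norm (fourier (?u k) \<xi>))\<^sup>2) \<le> A * (?q * ?q) ^ k" for k
    proof -
      have "(LINT \<xi>|lborel. (1 + (norm \<xi>)\<^sup>2) powr s' * (norm (fourier (?u k) \<xi>))\<^sup>2) \<le> A * v (K + k) powr (4 * \<kappa>)"
        unfolding \<kappa>_def by (intro A pos lt1 s')
      also have "\<dots> \<le> A * ((1 / 2) ^ k) powr (4 * \<kappa>)"
        using A(1) \<kappa> geo[of k] pos[of k] by (intro mult_left_mono powr_mono2) auto
      also have "((1 / 2 :: real) ^ k) powr (4 * \<kappa>) = (?q * ?q) ^ k"
        by (simp add: powr_realpow[symmetric] powr_powr powr_add[symmetric] mult_ac)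
      finally show ?thesis .
    qed
    show "?q < 1" using powr_less_mono2[of "2 * \<kappa>" "1 / 2" 1] \<kappa> by simp
    show "AE \<xi> in lborel. (\<lambda>k. fourier (?u k) \<xi>) sums fourier (h_sum g \<Phi> v K) \<xi>"
      by (intro AE_I2 h_sum_fourier_sums)
  qed auto
  show ?thesis
  proof (rule distribution_of_in_sobolev[OF h_sum_integrable], rule Bochner_Integration.integrable_bound[OF i])
    show "AE \<xi> in lborel. norm ((1 + (norm \<xi>)\<^sup>2) powr s * (cmod (fourier (h_sum g \<Phi> v K) \<xi>))\<^sup>2)
        \<le> norm ((1 + (norm \<xi>)\<^sup>2) powr s' * (norm (fourier (h_sum g \<Phi> v K) \<xi>))\<^sup>2)"
      using s'(3) by (intro AE_I2) (auto simp: abs_mult intro!: mult_right_mono powr_mono)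
  qed measurable
qed

end

section \<open>The counterexample\<close>

text \<open>Subtracting the main term leaves a series dominated by the full geometric one; the
  reverse triangle inequality then isolates the main term.\<close>

lemma norm_sums_ge:
  fixes a :: "nat \<Rightarrow> complex"
  assumes a: "a sums S" and le: "\<And>j. j \<noteq> m \<Longrightarrow> norm (a j) \<le> B * r ^ j"
    and r: "0 \<le> r" "r < 1" and B: "0 \<le> B"
  shows "norm (a m) - B / (1 - r) \<le> norm S"
proof -
  define b where "b = (\<lambda>j. a j - (if j = m then a m else 0))"
  have b_sums: "b sums (S - a m)"
    unfolding b_def using sums_diff[OF a sums_single[of m "\<lambda>_. a m"]] by simp
  have b_le: "norm (b j) \<le> B * r ^ j" for j using le[of j] B r by (simp add: b_def)
  have g: "(\<lambda>j. B * r ^ j) sums (B * (1 / (1 - r)))" using r by (intro sums_mult geometric_sums) simp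
  have "norm (suminf b) \<le> (\<Sum>j. B * r ^ j)"
    by (rule norm_suminf_le[OF b_le sums_summable[OF g]])
  hence "norm (S - a m) \<le> B / (1 - r)" using b_sums g by (simp add: sums_iff)
  moreover have "norm (a m) \<le> norm S + norm (S - a m)"
    by (metis norm_triangle_sub norm_minus_commute)
  ultimately show ?thesis by linarith
qed

lemma lacunary_sequence_bounds:
  fixes v :: "nat \<Rightarrow> real"
  assumes v1: "0 < v 1" "v 1 < 1" and rec: "\<forall>k\<ge>2. v k = (1 / 2 ^ k) * v (k - 1) powr \<mu>"
    and \<mu>: "\<mu> \<ge> 1"
  shows "\<And>k. k \<ge> 1 \<Longrightarrow> 0 < v k" "\<And>k. k \<ge> 1 \<Longrightarrow> v k < 1"
    and "\<And>j k. 1 \<le> j \<Longrightarrow> j \<le> k \<Longrightarrow> v k \<le> v j"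
    and "\<And>j k. 1 \<le> j \<Longrightarrow> j < k \<Longrightarrow> v k \<le> (1 / 2) ^ k * v j powr \<mu>"
    and "\<And>k. k \<ge> 1 \<Longrightarrow> v k \<le> 2 * (1 / 2) ^ k"
proof -
  have step: "0 < v (Suc k) \<and> v (Suc k) < 1 \<and> v (Suc k) \<le> v k \<and> v (Suc k) = (1 / 2) ^ Suc k * v k powr \<mu>"
    if k: "k \<ge> 1" "0 < v k" "v k < 1" for k
  proof -
    have e: "v (Suc k) = (1 / 2) ^ Suc k * v k powr \<mu>" using rec[rule_format, of "Suc k"] k(1) by (simp add: power_divide)
    have "v k powr \<mu> \<le> v k powr 1" using k \<mu> by (intro powr_mono') auto
    hence p: "v k powr \<mu> \<le> v k" using k by simp
    have "(1 / 2 :: real) ^ Suc k * v k powr \<mu> \<le> 1 * v k powr \<mu>"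
      by (intro mult_right_mono power_le_one) auto
    with e p have le: "v (Suc k) \<le> v k" by linarith
    have "0 < v (Suc k)" unfolding e using k by simp
    thus ?thesis using le_less_trans[OF le k(3)] le e by blast
  qed
  have pos: "0 < v k \<and> v k < 1" if "k \<ge> 1" for k
    using that by (induction k rule: nat_induct_at_least) (use v1 step in auto)
  thus "0 < v k" "v k < 1" if "k \<ge> 1" for k using that by auto
  show dec: "v k \<le> v j" if j: "1 \<le> j" and jk: "j \<le> k" for j k
    using jk
  proof (induction k rule: nat_induct_at_least)
    case (Suc k)
    with j have "v (Suc k) \<le> v k" using step[of k] pos[of k] by simp
    with Suc show ?case by simp
  qed simp
  \<comment> \<open>The recursion expresses v k through its immediate predecessor, which
    monotonicity then replaces by any earlier term.\<close>
  show small: "v k \<le> (1 / 2) ^ k * v j powr \<mu>" if j: "1 \<le> j" and jk: "j < k" for j k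
  proof -
    obtain k' where k': "k = Suc k'" "j \<le> k'" using jk by (cases k) auto
    have "v k = (1 / 2) ^ k * v k' powr \<mu>" unfolding k'(1) using step[of k'] pos[of k'] j k' by auto
    also have "\<dots> \<le> (1 / 2) ^ k * v j powr \<mu>"
      using dec[OF j k'(2)] pos[of k'] j k' \<mu> by (intro mult_left_mono powr_mono2) auto
    finally show ?thesis .
  qed
  \<comment> \<open>The factor 2 accommodates k = 1, where only v 1 < 1 is available.\<close>
  show "v k \<le> 2 * (1 / 2) ^ k" if "k \<ge> 1" for k
  proof (cases "k = 1")
    case False
    hence "v k \<le> (1 / 2) ^ k * v 1 powr \<mu>" using that by (intro small) auto
    also have "\<dots> \<le> (1 / 2) ^ k * 1" using v1 \<mu> by (intro mult_left_mono powr_le1) auto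
    also have "\<dots> \<le> 2 * (1 / 2) ^ k" by simp
    finally show ?thesis .
  qed (use v1 in simp)
qed

text \<open>All sets lie in the unit ball, so the decreasing tail unions have finite measure and
  continuity from above applies.\<close>

lemma limsup_emeasure_ge:
  fixes A :: "nat \<Rightarrow> 'a::euclidean_space set"
  assumes A: "\<And>k. k \<ge> 1 \<Longrightarrow> A k \<in> sets lebesgue" "\<And>k. k \<ge> 1 \<Longrightarrow> A k \<subseteq> ball 0 1"
    and c: "\<And>k. k \<ge> 1 \<Longrightarrow> measure lebesgue (A k) \<ge> c"
  shows "emeasure lebesgue (\<Inter>k\<in>{1..}. \<Union>j\<in>{k..}. A j) \<ge> ennreal c"
proof -
  \<comment> \<open>The shift by \<open>Suc\<close> fits the index range starting at 1 to a sequence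
    on all naturals.\<close>
  define U where "U = (\<lambda>k. \<Union>j\<in>{Suc k..}. A j)"
  have U: "U k \<in> sets lebesgue" "U k \<subseteq> ball 0 1" for k
  proof -
    show "U k \<in> sets lebesgue" unfolding U_def by (intro sets.countable_UN'' A(1)) auto
    show "U k \<subseteq> ball 0 1" unfolding U_def by (intro UN_least A(2)) auto
  qed
  have fin: "emeasure lebesgue B \<noteq> \<infinity>" if "B \<subseteq> ball 0 1" "B \<in> sets lebesgue" for B :: "'a set"
  proof -
    have "emeasure lebesgue B \<le> emeasure lebesgue (ball (0::'a) 1)" using that by (intro emeasure_mono) auto
    also have "\<dots> < \<infinity>" using emeasure_lborel_ball_finite[of "0::'a" 1] by simp
    finally show ?thesis by simp
  qed
  have "ennreal c \<le> emeasure lebesgue (U k)" for k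
  proof -
    have "ennreal c \<le> ennreal (measure lebesgue (A (Suc k)))" by (intro ennreal_leI c) simp
    also have "\<dots> = emeasure lebesgue (A (Suc k))"
      using fin[of "A (Suc k)"] A[of "Suc k"] by (intro emeasure_eq_ennreal_measure[symmetric]) auto
    also have "\<dots> \<le> emeasure lebesgue (U k)" by (intro emeasure_mono U) (auto simp: U_def)
    finally show ?thesis .
  qed
  hence "ennreal c \<le> (INF k. emeasure lebesgue (U k))" by (intro INF_greatest)
  also have "\<dots> = emeasure lebesgue (\<Inter>k. U k)"
  proof (rule INF_emeasure_decseq)
    show "range U \<subseteq> sets lebesgue" using U(1) by auto
    show "decseq U" unfolding decseq_def U_def by (intro allI impI UN_mono) auto
    show "emeasure lebesgue (U k) \<noteq> \<infinity>" for k by (rule fin[OF U(2,1)])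
  qed
  also have "(\<Inter>k. U k) = (\<Inter>k\<in>{1..}. \<Union>j\<in>{k..}. A j)"
  proof -
    have "{1..} = range Suc" by (auto simp: image_iff Suc_le_eq gr0_conv_Suc)
    thus ?thesis by (simp add: U_def)
  qed
  finally show ?thesis .
qed

theorem theorem2p2:
  fixes v R :: "nat \<Rightarrow> real"
    and g \<psi> :: "real \<Rightarrow> complex"
    and \<Phi> :: "real ^ 'm \<Rightarrow> complex"
    and E Fk :: "nat \<Rightarrow> (real \<times> (real ^ 'm)) set"
    and F :: "(real \<times> (real ^ 'm)) set"
    and t :: "nat \<Rightarrow> real \<times> (real ^ 'm) \<Rightarrow> real"
    and h :: "real \<times> (real ^ 'm) \<Rightarrow> complex"
    and n \<mu> c0 c1 \<delta> :: real
    and K :: nat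
  assumes n: "n = real DIM(real \<times> (real ^ 'm))"
    and mu: "\<mu> = max n (2 + n / 4)"
    and v1: "0 < v 1" "v 1 < 1"
    and v_rec: "\<And>k. k \<ge> 2 \<Longrightarrow> v k = (1 / 2 ^ k) * v (k - 1) powr \<mu>"
    and R: "\<And>k. k \<ge> 1 \<Longrightarrow> R k = 1 / (v k)\<^sup>2"
    and g: "schwartz g" "closure {x. inv_fourier g x \<noteq> 0} \<subseteq> {-1<..<1}"
      "\<And>x. \<bar>x\<bar> < 1 / 2 \<Longrightarrow> inv_fourier g x = 1"
    and Phi: "schwartz \<Phi>" "closure {\<xi>. fourier \<Phi> \<xi> \<noteq> 0} \<subseteq> ball 0 1" "\<Phi> 0 = 1"
      "schwartz \<psi>" "\<And>x'. \<Phi> x' = (\<Prod>j\<in>UNIV. \<psi> (x' $ j))"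
    and c: "c0 > 0" "c1 > 0"
    and E: "\<And>k. k \<ge> 1 \<Longrightarrow> E k \<subseteq> ball 0 1"
      "\<And>k. k \<ge> 1 \<Longrightarrow> E k \<in> sets lebesgue"
      "\<And>k. k \<ge> 1 \<Longrightarrow> measure lebesgue (E k) \<ge> c1"
    and t: "\<And>k x. k \<ge> 1 \<Longrightarrow> x \<in> E k \<Longrightarrow>
        \<exists>\<tau>. t k x = fst x / (2 * R k) + \<tau> \<and> \<bar>\<tau>\<bar> < R k powr (- 3 / 2) / 10"
      "\<And>k x. k \<ge> 1 \<Longrightarrow> x \<in> E k \<Longrightarrow> cmod (schrodinger (t k x) (G_part \<Phi> (v k)) (snd x)) \<ge> c0"
      "\<And>k x. k \<ge> 1 \<Longrightarrow> x \<in> E k \<Longrightarrow> cmod (schrodinger (t k x) (f_part g (v k)) (fst x)) \<ge> c0"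
    and delta: "0 < \<delta>" "\<delta> < 1"
    and Fk: "\<And>k. k \<ge> 1 \<Longrightarrow> Fk k = E k \<inter> {x. \<bar>fst x\<bar> > \<delta> / 2}"
      "\<And>k. k \<ge> 1 \<Longrightarrow> measure lebesgue (Fk k) \<ge> c1 / 2"
    and F: "F = (\<Inter>k\<in>{1..}. \<Union>j\<in>{k..}. Fk j)"
    and K: "K \<ge> 1" "v K < \<delta> / 4"
    and h: "h = h_sum g \<Phi> v K"
  shows "(\<exists>c>0. \<forall>x\<in>F. \<forall>kj :: nat \<Rightarrow> nat.
            strict_mono kj \<and> (\<forall>j. kj j \<ge> 1 \<and> x \<in> Fk (kj j)) \<longrightarrow>
            (\<forall>\<^sub>F j in sequentially. cmod (schrodinger_L1 (t (kj j) x) h x) \<ge> c))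
       \<and> (\<forall>s. s < n / (2 * (n + 1)) \<longrightarrow> \<not> localization_ae TYPE(real \<times> (real ^ 'm)) s)"
proof -
  define d where "d = real CARD('m)"
  have nd: "n = d + 1" by (simp add: n d_def)
  have d: "d \<ge> 1" using zero_less_card_finite[where 'a = 'm] by (simp add: d_def Suc_le_eq)
  have "n \<le> \<mu>" "2 + n / 4 \<le> \<mu>" using mu by auto
  \<comment> \<open>In this order: powers with exponent \<mu> stay below v itself; v_k^\<mu>
    compensates the dispersive factor v_k^(-n) for later blocks; and v_j^(2 \<mu>) compensates the
    loss v_j^(-4 - d/2) of earlier blocks.\<close>
  hence \<mu>: "\<mu> \<ge> 1" "\<mu> \<ge> n" "2 * \<mu> \<ge> 4 + d / 2" using d by (simp_all add: nd add_divide_distrib)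
  have "\<forall>k\<ge>2. v k = (1 / 2 ^ k) * v (k - 1) powr \<mu>" using v_rec by blast
  note v = lacunary_sequence_bounds[OF v1 this \<mu>(1)]
  have pos: "0 < v (K + k)" "v (K + k) < 1" for k using v(1,2)[of "K + k"] K by auto
  \<comment> \<open>Since K >= 1, the shift by K absorbs the factor 2 of the general bound.\<close>
  have geo: "v (K + k) \<le> (1 / 2) ^ k" for k
  proof -
    have "(1 / 2 :: real) ^ K \<le> (1 / 2) ^ 1" using K(1) by (intro power_decreasing) auto
    hence "2 * (1 / 2) ^ K * (1 / 2) ^ k \<le> (1 :: real) * (1 / 2) ^ k" by (intro mult_right_mono) auto
    moreover have "v (K + k) \<le> 2 * (1 / 2) ^ (K + k)" using v(5)[of "K + k"] K(1) by simp
    ultimately show ?thesis unfolding power_add mult.assoc mult_1_left by (rule order_trans[rotated])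
  qed
  note hs = g(1,2) Phi(4,5,2) pos geo
  have vK: "v k < \<delta> / 4" if "k \<ge> K" for k using v(3)[of K k] that K by simp
  obtain A where A: "A \<ge> 1"
    "\<And>v x. 0 < v \<Longrightarrow> v \<le> \<bar>fst x\<bar> \<Longrightarrow> h_part g \<Phi> v x = 0"
    "\<And>v. 0 < v \<Longrightarrow> v < 1 \<Longrightarrow> integrable lborel (h_part g \<Phi> v)"
    "\<And>v. 0 < v \<Longrightarrow> v < 1 \<Longrightarrow> (LINT x|lborel. norm (h_part g \<Phi> v x)) \<le> A * v"
    "\<And>v t x. 0 < v \<Longrightarrow> v < 1 \<Longrightarrow> t \<noteq> 0 \<Longrightarrow> schrodinger_L1 t (h_part g \<Phi> v) x =
        schrodinger t (f_part g v) (fst x) * schrodinger t (G_part \<Phi> v) (snd x)"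
    "\<And>v t x. 0 < v \<Longrightarrow> v < 1 \<Longrightarrow> t \<noteq> 0 \<Longrightarrow> v \<le> \<bar>fst x\<bar> \<Longrightarrow>
        norm (schrodinger_L1 t (h_part g \<Phi> v) x) \<le> A * \<bar>t\<bar> * v powr (- 4 - d / 2)"
    by (rule h_part_bounds[OF g(1,2) Phi(4,5,2), folded d_def]) (rule that)
  \<comment> \<open>A square root of 1/2: a power of 1/2 can be split into r^k, which tends to 0
    with the main index, and r^j, which is summable over the other blocks.\<close>
  define r :: real where "r = sqrt (1 / 2)"
  have r: "0 < r" "r < 1" "r ^ j * r ^ j = (1 / 2) ^ j" for j
    by (auto simp: r_def power_mult_distrib[symmetric])
  \<comment> \<open>The dispersive constant at the smallest possible time, \<delta> / 5 times v_k^2,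
    multiplied by the constant of the \<open>L^1\<close> bound.\<close>
  define B where "B = pi powr (n / 2) * (\<delta> / 5) powr (- n / 2) * A"
  have B: "B \<ge> 0" using A(1) by (simp add: B_def)

  \<comment> \<open>The main part of the time has size |x_1| v_k^2 / 2, between \<delta> v_k^2 / 4
    and v_k^2 / 2. The error is below v_k^3 / 10, hence at most \<delta> v_k^2 / 40 because v_k <
    \<delta> / 4; and 1/4 - 1/40 exceeds 1/5.\<close>
  have time: "\<delta> / 5 * (v k)\<^sup>2 \<le> \<bar>t k x\<bar>" "\<bar>t k x\<bar> \<le> (v k)\<^sup>2" "t k x \<noteq> 0"
    "x \<in> E k" "\<delta> / 2 < \<bar>fst x\<bar>" if k: "k \<ge> K" and x: "x \<in> Fk k" for k x
  proof -
    have k1: "k \<ge> 1" using k K by simp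
    show xE: "x \<in> E k" and x1: "\<delta> / 2 < \<bar>fst x\<bar>" using Fk(1)[OF k1] x by auto
    have vk: "0 < v k" "v k < 1" using v(1,2)[OF k1] by auto
    obtain \<tau> where \<tau>: "t k x = fst x / (2 * R k) + \<tau>" "\<bar>\<tau>\<bar> < R k powr (- 3 / 2) / 10"
      using t(1)[OF k1 xE] by blast
    have "R k = v k powr (- 2)" using vk R[OF k1] by (simp add: powr_minus_divide)
    hence "R k powr (- 3 / 2) = v k ^ 3" using vk by (simp add: powr_powr)
    hence \<tau>3: "\<bar>\<tau>\<bar> \<le> v k * (v k)\<^sup>2 / 10" using \<tau>(2) by (simp add: eval_nat_numeral)
    have "v k * (v k)\<^sup>2 \<le> (\<delta> / 4) * (v k)\<^sup>2" using vK[OF k] by (intro mult_right_mono) auto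
    hence \<tau>4: "\<bar>\<tau>\<bar> \<le> (\<delta> / 40) * (v k)\<^sup>2" using \<tau>3 by simp
    have T: "t k x = fst x * (v k)\<^sup>2 / 2 + \<tau>" using \<tau>(1) R[OF k1] by simp
    have "norm x < 1" using E(1)[OF k1] xE by auto
    hence x2: "\<bar>fst x\<bar> \<le> 1" using norm_fst_le[of "fst x" "snd x"] by simp
    have "\<bar>fst x * (v k)\<^sup>2 / 2\<bar> = \<bar>fst x\<bar> * (v k)\<^sup>2 / 2" by (simp add: abs_mult)
    moreover have "\<bar>fst x\<bar> * (v k)\<^sup>2 \<le> 1 * (v k)\<^sup>2" by (intro mult_right_mono x2) simp
    moreover have "\<delta> / 2 * (v k)\<^sup>2 \<le> \<bar>fst x\<bar> * (v k)\<^sup>2" using x1 by (intro mult_right_mono) auto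
    moreover have "\<delta> * (v k)\<^sup>2 \<le> 1 * (v k)\<^sup>2" using delta by (intro mult_right_mono) auto
    moreover have "0 < \<delta> * (v k)\<^sup>2" using delta vk by simp
    ultimately show "\<delta> / 5 * (v k)\<^sup>2 \<le> \<bar>t k x\<bar>" "\<bar>t k x\<bar> \<le> (v k)\<^sup>2" "t k x \<noteq> 0"
      using \<tau>4 unfolding T by (auto simp: abs_if split: if_splits)
  qed

  have lower: "c0\<^sup>2 - (A + B) * r ^ k / (1 - r) \<le> norm (schrodinger_L1 (t k x) h x)"
    if k: "k \<ge> K" and x: "x \<in> Fk k" for k x
  proof -
    let ?T = "t k x"
    note T = time[OF k x]
    have k1: "k \<ge> 1" using k K by simp
    have vk: "0 < v k" "v k < 1" using v(1,2)[OF k1] by auto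
    define m where "m = k - K"
    have km: "k = K + m" using k by (simp add: m_def)
    let ?a = "\<lambda>j. schrodinger_L1 ?T (h_part g \<Phi> (v (K + j))) x"
    have sums: "?a sums schrodinger_L1 ?T h x"
      unfolding h by (rule h_sum_schrodinger_L1_sums[OF hs])
    have "norm (?a m) = norm (schrodinger ?T (f_part g (v k)) (fst x)) * norm (schrodinger ?T (G_part \<Phi> (v k)) (snd x))"
      unfolding km[symmetric] A(5)[OF vk T(3)] norm_mult ..
    also have "\<dots> \<ge> c0 * c0" using t(2,3)[OF k1 T(4)] c(1) by (intro mult_mono) auto
    finally have main: "c0\<^sup>2 \<le> norm (?a m)" by (simp add: power2_eq_square)
    have other: "norm (?a j) \<le> ((A + B) * r ^ k) * r ^ j" if j: "j \<noteq> m" for j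
    proof (cases "j < m")
      case True
      let ?w = "v (K + j)"
      have jk: "1 \<le> K + j" "K + j < k" using True K by (auto simp: km)
      have "?w \<le> \<bar>fst x\<bar>" using vK[of "K + j"] T(5) delta by simp
      hence "norm (?a j) \<le> A * \<bar>?T\<bar> * ?w powr (- 4 - d / 2)" by (intro A pos T)
      \<comment> \<open>The time is at most v_k^2, and for an earlier block w = v_(K+j) one has v_k
        <= 2^(-k) w^\<mu>.\<close>
      also have "\<dots> \<le> A * ((1 / 2) ^ k * (1 / 2) ^ k * ?w powr (2 * \<mu>)) * ?w powr (- 4 - d / 2)"
      proof (intro mult_right_mono mult_left_mono)
        have "(v k)\<^sup>2 \<le> ((1 / 2) ^ k * ?w powr \<mu>)\<^sup>2" using v(4)[OF jk] vk by (intro power_mono) auto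
        also have "\<dots> = (1 / 2) ^ k * (1 / 2) ^ k * (?w powr \<mu> * ?w powr \<mu>)" by (simp add: power2_eq_square)
        also have "?w powr \<mu> * ?w powr \<mu> = ?w powr (2 * \<mu>)" by (simp flip: powr_add)
        finally show "\<bar>?T\<bar> \<le> (1 / 2) ^ k * (1 / 2) ^ k * ?w powr (2 * \<mu>)" using T(2) by linarith
      qed (use A(1) in auto)
      also have "\<dots> = A * ((1 / 2) ^ k * (1 / 2) ^ k) * ?w powr (2 * \<mu> + (- 4 - d / 2))"
        unfolding powr_add by (simp only: mult.assoc)
      also have "\<dots> \<le> A * (r ^ k * r ^ j) * 1"
      proof (intro mult_mono mult_left_mono)
        have "(1 / 2 :: real) ^ k \<le> 1 * r ^ k" unfolding r(3)[symmetric] using r by (intro mult_right_mono power_le_one) auto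
        moreover have "r ^ k \<le> r ^ j" using r True by (intro power_decreasing) (auto simp: km)
        ultimately show "(1 / 2 :: real) ^ k \<le> r ^ k" "(1 / 2 :: real) ^ k \<le> r ^ j" by auto
        show "?w powr (2 * \<mu> + (- 4 - d / 2)) \<le> 1" using pos[of j] \<mu>(3) by (intro powr_le1) auto
      qed (use A(1) r in auto)
      also have "\<dots> \<le> ((A + B) * r ^ k) * r ^ j" using B r by (simp add: algebra_simps)
      finally show ?thesis .
    next
      case False
      with j have jk: "k < K + j" by (simp add: km)
      have "norm (?a j) \<le> pi powr (n / 2) * \<bar>?T\<bar> powr (- n / 2) * (LINT y|lborel. norm (h_part g \<Phi> (v (K + j)) y))"
        using norm_schrodinger_L1_le unfolding n .
      \<comment> \<open>The dispersive bound contributes v_k^(-n) and the norm of a later block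
        v_k^n; they cancel and leave a geometric factor.\<close>
      also have "\<dots> \<le> pi powr (n / 2) * ((\<delta> / 5) powr (- n / 2) * v k powr (- n)) * (A * ((1 / 2) ^ (K + j) * v k powr n))"
      proof (intro mult_mono mult_left_mono)
        have "\<bar>?T\<bar> powr (- n / 2) \<le> (\<delta> / 5 * (v k)\<^sup>2) powr (- n / 2)"
          using T(1) delta vk d by (intro powr_mono2') (auto simp: nd)
        also have "\<dots> = (\<delta> / 5) powr (- n / 2) * ((v k)\<^sup>2) powr (- n / 2)" by (rule powr_mult)
        also have "((v k)\<^sup>2) powr (- n / 2) = v k powr (- n)"
        proof -
          have e: "(v k)\<^sup>2 = v k powr 2" using vk by simp
          show ?thesis unfolding e powr_powr by simp
        qed
        finally show "\<bar>?T\<bar> powr (- n / 2) \<le> (\<delta> / 5) powr (- n / 2) * v k powr (- n)" .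
        have "v (K + j) \<le> (1 / 2) ^ (K + j) * v k powr \<mu>" by (rule v(4)[OF k1 jk])
        also have "\<dots> \<le> (1 / 2) ^ (K + j) * v k powr n" using vk \<mu>(2) by (intro mult_left_mono powr_mono') auto
        finally have "A * v (K + j) \<le> A * ((1 / 2) ^ (K + j) * v k powr n)" using A(1) by (intro mult_left_mono) auto
        thus "(LINT y|lborel. norm (h_part g \<Phi> (v (K + j)) y)) \<le> A * ((1 / 2) ^ (K + j) * v k powr n)"
          using A(4)[OF pos] by (rule order_trans[rotated])
      qed (auto intro: Bochner_Integration.integral_nonneg)
      also have "\<dots> = B * (1 / 2) ^ (K + j) * (v k powr (- n) * v k powr n)" by (simp add: B_def mult_ac)
      also have "v k powr (- n) * v k powr n = 1" using vk by (simp flip: powr_add)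
      also have "B * (1 / 2) ^ (K + j) * 1 \<le> B * (r ^ k * r ^ j)"
        unfolding r(3)[symmetric] mult_1_right using B r jk by (intro mult_left_mono mult_mono power_decreasing) auto
      also have "\<dots> \<le> ((A + B) * r ^ k) * r ^ j" using A(1) r by (simp add: algebra_simps)
      finally show ?thesis .
    qed
    have "norm (?a m) - (A + B) * r ^ k / (1 - r) \<le> norm (schrodinger_L1 ?T h x)"
      using A(1) B r by (intro norm_sums_ge[OF sums other]) auto
    with main show ?thesis by linarith
  qed

  have "(\<lambda>k. (A + B) * r ^ k / (1 - r)) \<longlonglongrightarrow> (A + B) * 0 / (1 - r)"
    using r by (intro tendsto_intros LIMSEQ_realpow_zero) auto
  hence "\<forall>\<^sub>F k in sequentially. (A + B) * r ^ k / (1 - r) < c0\<^sup>2 / 2"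
    using c(1) by (intro order_tendstoD(2)) auto
  then obtain N0 where N0: "\<And>k. k \<ge> N0 \<Longrightarrow> (A + B) * r ^ k / (1 - r) < c0\<^sup>2 / 2"
    by (auto simp: eventually_sequentially)
  \<comment> \<open>This threshold depends neither on the point x nor on the sequence of
    indices.\<close>
  define N where "N = max K N0"
  have lb: "c0\<^sup>2 / 2 \<le> norm (schrodinger_L1 (t k x) h x)" if "k \<ge> N" "x \<in> Fk k" for k x
    using lower[of k x] N0[of k] that by (simp add: N_def)

  show ?thesis
  proof (intro conjI exI[of _ "c0\<^sup>2 / 2"] ballI allI impI)
    show "c0\<^sup>2 / 2 > 0" using c(1) by simp
    fix x and kj :: "nat \<Rightarrow> nat"
    assume kj: "strict_mono kj \<and> (\<forall>j. kj j \<ge> 1 \<and> x \<in> Fk (kj j))"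
    \<comment> \<open>A strictly increasing sequence of naturals satisfies kj j >= j.\<close>
    have "kj j \<ge> N" if "j \<ge> N" for j using strict_mono_imp_increasing[of kj j] kj that by simp
    thus "\<forall>\<^sub>F j in sequentially. c0\<^sup>2 / 2 \<le> cmod (schrodinger_L1 (t (kj j) x) h x)"
      unfolding eventually_sequentially using kj by (intro exI[of _ N] allI impI lb) auto
  next
    fix s assume s: "s < n / (2 * (n + 1))"
    show "\<not> localization_ae TYPE(real \<times> (real ^ 'm)) s"
    proof
      assume loc: "localization_ae TYPE(real \<times> (real ^ 'm)) s"
      have "s < (real CARD('m) + 1) / (2 * (real CARD('m) + 2))" using s by (simp add: nd d_def add.commute)
      hence "distribution_of h \<in> sobolev s" unfolding h by (intro h_sum_in_sobolev[OF hs])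
      hence AE: "AE x in lborel. x \<notin> ess_supp h \<longrightarrow> ((\<lambda>t. schrodinger_L1 t h x) \<longlongrightarrow> 0) (at 0)"
        using h_sum_integrable[OF hs] h_sum_square_integrable[OF hs] unfolding h
        by (intro localization_ae_imp_tendsto_schrodinger_L1[OF loc])
      have "x \<notin> ess_supp h \<and> \<not> ((\<lambda>t. schrodinger_L1 t h x) \<longlongrightarrow> 0) (at 0)" if x: "x \<in> F" for x
      proof -
        define S where "S = {k. k \<ge> K \<and> x \<in> Fk k}"
        have "infinite S"
          unfolding infinite_nat_iff_unbounded_le
        proof
          fix k
          have "x \<in> (\<Union>j\<in>{max 1 (max k K)..}. Fk j)" using x unfolding F by auto
          thus "\<exists>j\<ge>k. j \<in> S" by (auto simp: S_def)
        qed
        then obtain kj :: "nat \<Rightarrow> nat" where kj: "strict_mono kj" "\<And>j. kj j \<in> S" using infinite_enumerate by blast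
        have kj': "kj j \<ge> K" "x \<in> Fk (kj j)" for j using kj(2)[of j] by (auto simp: S_def)
        \<comment> \<open>Every block of h is supported where |x_1| < \<delta> / 4, so h vanishes on
          this open set, which contains x. The lower bound thus concerns points off the
          support.\<close>
        have "open {y :: real \<times> (real ^ 'm). \<delta> / 2 < \<bar>fst y\<bar>}" by (intro open_Collect_less continuous_intros)
        moreover have "h y = 0" if "\<delta> / 2 < \<bar>fst y\<bar>" for y
        proof -
          have "h_part g \<Phi> (v (K + k)) y = 0" for k
            using vK[of "K + k"] that delta by (intro A pos) simp
          thus ?thesis by (simp add: h h_sum_def)
        qed
        ultimately have "x \<notin> ess_supp h"
          using time(5)[OF kj'] unfolding ess_supp_def by (auto intro!: exI[of _ "{y. \<delta> / 2 < \<bar>fst y\<bar>}"])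
        moreover have "\<not> ((\<lambda>t. schrodinger_L1 t h x) \<longlongrightarrow> 0) (at 0)"
        proof
          assume lim: "((\<lambda>t. schrodinger_L1 t h x) \<longlongrightarrow> 0) (at 0)"
          \<comment> \<open>Along nonzero times tending to 0, a limit of the means at time 0 would
            contradict their fixed lower bound.\<close>
          have "(\<lambda>j. t (kj j) x) \<longlonglongrightarrow> 0"
          proof (rule Lim_null_comparison)
            have "norm (t (kj j) x) \<le> 2 * (1 / 2) ^ kj j" for j
            proof -
              have k1: "1 \<le> kj j" using kj'(1)[of j] K by simp
              have "norm (t (kj j) x) \<le> (v (kj j))\<^sup>2" using time(2)[OF kj'] by simp
              also have "\<dots> \<le> v (kj j)" using v(1,2)[OF k1] by (simp add: power2_eq_square mult_left_le)
              also have "\<dots> \<le> 2 * (1 / 2) ^ kj j" by (rule v(5)[OF k1])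
              finally show ?thesis .
            qed
            thus "\<forall>\<^sub>F j in sequentially. norm (t (kj j) x) \<le> 2 * (1 / 2) ^ kj j" by simp
            have "(\<lambda>k. 2 * (1 / 2 :: real) ^ k) \<longlonglongrightarrow> 2 * 0" by (intro tendsto_intros LIMSEQ_realpow_zero) auto
            from LIMSEQ_subseq_LIMSEQ[OF this kj(1)]
            show "(\<lambda>j. 2 * (1 / 2 :: real) ^ kj j) \<longlonglongrightarrow> 0" by (simp add: o_def)
          qed
          hence "filterlim (\<lambda>j. t (kj j) x) (at 0) sequentially"
            using time(3)[OF kj'] by (auto simp: filterlim_at)
          from filterlim_compose[OF lim this]
          have "(\<lambda>j. norm (schrodinger_L1 (t (kj j) x) h x)) \<longlonglongrightarrow> 0" by (rule tendsto_norm_zero)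
          hence "\<forall>\<^sub>F j in sequentially. norm (schrodinger_L1 (t (kj j) x) h x) < c0\<^sup>2 / 2"
            using c(1) by (intro order_tendstoD(2)) auto
          then obtain J where J: "\<And>j. j \<ge> J \<Longrightarrow> norm (schrodinger_L1 (t (kj j) x) h x) < c0\<^sup>2 / 2"
            by (auto simp: eventually_sequentially)
          have "kj (max J N) \<ge> N" using strict_mono_imp_increasing[OF kj(1), of "max J N"] by simp
          with J[of "max J N"] lb[OF _ kj'(2)] show False by fastforce
        qed
        ultimately show ?thesis by blast
      qed
      hence "AE x in lborel. x \<notin> F" using AE by (auto elim!: eventually_mono)
      \<comment> \<open>The sets \<open>E k\<close> are assumed Lebesgue measurable, so the
        exceptional set is compared with F in the completed measure.\<close>
      hence "AE x in lebesgue. x \<notin> F" by (rule AE_completion)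
      moreover have FE: "Fk k \<in> sets lebesgue" "Fk k \<subseteq> ball 0 1" if "k \<ge> 1" for k
      proof -
        have "open {y :: real \<times> (real ^ 'm). \<delta> / 2 < \<bar>fst y\<bar>}" by (intro open_Collect_less continuous_intros)
        hence "{y :: real \<times> (real ^ 'm). \<delta> / 2 < \<bar>fst y\<bar>} \<in> sets lebesgue" by auto
        thus "Fk k \<in> sets lebesgue" unfolding Fk(1)[OF that] using E(2)[OF that] by (rule sets.Int[rotated])
        show "Fk k \<subseteq> ball 0 1" using Fk(1)[OF that] E(1)[OF that] by auto
      qed
      moreover from FE have "F \<in> sets lebesgue" unfolding F by (auto intro!: sets.countable_INT'' sets.countable_UN'')
      ultimately have "emeasure lebesgue F = 0" by (simp add: AE_iff_null_sets null_setsD1)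
      moreover have "ennreal (c1 / 2) \<le> emeasure lebesgue F"
        unfolding F by (intro limsup_emeasure_ge FE Fk(2))
      ultimately show False using c(2) by simp
    qed
  qed
qed

end
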